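(* Let $-1<\alpha<0$, and let $\varphi$ be a nonconstant analytic self-map of $\mathbb{D}$ with $\varphi(0)=0$ such that $C_\varphi$ is bounded on $\mathcal{D}_\alpha$. Suppose that $\varphi(\mathbb{D})$ satisfies the Compact-Hole Condition. Then the following statements are equivalent: (i) The range of $C_\varphi$ is closed in $\mathcal{D}_\alpha$. (ii) There exist constants $\delta>0$ and $r>0$ such that $\mu_{\varphi,\alpha}(D(z,r))\ge \delta A_\alpha(D(z,r))$ for all $z\in\mathbb{D}$. (iii) There exist constants $\delta>0$ and $r>0$ such that $A_\alpha(\varphi(\mathbb{D})\cap D(z,r))\ge\delta A_\alpha(D(z,r))$ for all $z\in\mathbb{D}$. (iv) There exists $r_0\in(0,1)$ such that $\mathbb{D}\setminus\overline{\mathbb{D}_{r_0}}\subset\varphi(\mathbb{D})$. (v) $\mu_{\varphi,\alpha}$ is a Reverse Carleson measure for $A_\alpha^2$. Moreover, these conditions are equivalent to $\mathbb{T}\subset\overline{\varphi(\mathbb{D})}$. In particular, when $\varphi(\mathbb{D})$ is simply connected, they are equivalent to $\varphi(\mathbb{D})=\mathbb{D}$.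
   Context: $\mathbb{D}$ is the open unit disk, $\mathbb{T}$ the unit circle, $\mathbb{D}_t=\{z:|z|<t\}$, and $dA$ is normalized area measure on $\mathbb{D}$. For $\alpha>-1$, $dA_\alpha(z)=(1+\alpha)(1-|z|^2)^\alpha dA(z)$ and $A_\alpha(E)=\int_E dA_\alpha$. The weighted Bergman space $A_\alpha^2$ consists of analytic $g$ on $\mathbb{D}$ with $\|g\|_{A_\alpha^2}^2=\int_{\mathbb{D}}|g|^2dA_\alpha<\infty$. The weighted Dirichlet space $\mathcal{D}_\alpha$ consists of analytic $f$ on $\mathbb{D}$ with $\|f\|_{\mathcal{D}_\alpha}^2=|f(0)|^2+\int_{\mathbb{D}}|f'|^2dA_\alpha<\infty$. $C_\varphi f=f\circ\varphi$. Counting function: $N_{\varphi,\alpha}(w)=\sum_{\varphi(z)=w}(1-|z|^2)^\alpha\in[0,+\infty]$, preimages counted with multiplicity, and $N_{\varphi,\alpha}(w)=0$ if $w\notin\varphi(\mathbb{D})$. The measure $\mu_{\varphi,\alpha}$ on $\mathbb{D}$ is $d\mu_{\varphi,\alpha}(w)=N_{\varphi,\alpha}(w)\,dA(w)$. Bergman disks: $\rho(z,w)=\left|\frac{z-w}{1-\overline z w}\right|$, $\beta(z,w)=\operatorname{arctanh}\rho(z,w)$, and $D(z,r)=\{w\in\mathbb{D}:\beta(z,w)<r\}$ for $r>0$. A positive Borel measure $\mu$ on $\mathbb{D}$ is a Reverse Carleson measure for $A_\alpha^2$ if there is $c>0$ with $\int_{\mathbb{D}}|g|^2d\mu\ge c\|g\|_{A_\alpha^2}^2$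 for all $g\in A_\alpha^2$. Compact-Hole Condition: a domain $\Omega\subseteq\mathbb{D}$ satisfies it if there exist a simply connected domain $U\subseteq\mathbb{D}$ and a compact subset $K$ of $U$ (possibly empty, with no restriction on its number of connected components) such that $\Omega=U\setminus K$. *)

theory Defs
  imports "HOL-Complex_Analysis.Complex_Analysis"
begin

abbreviation unit_disk :: "complex set" where
  "unit_disk \<equiv> ball 0 1"

definition disk_area :: "complex measure" where
  "disk_area = density (restrict_space lborel unit_disk) (\<lambda>z. ennreal (1 / pi))"

definition weighted_area :: "real \<Rightarrow> complex measure" where
  "weighted_area \<alpha> =
     density disk_area (\<lambda>z. ennreal ((1 + \<alpha>) * (1 - (cmod z)\<^sup>2) powr \<alpha>))"

text \<open>
  An analytic function on the disk is encoded as a function on the complex plane that is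
  holomorphic on the disk and vanishes off it, so that equality of such functions is equality
  on the disk and the Dirichlet norm is definite.
\<close>

definition disk_analytic :: "(complex \<Rightarrow> complex) set" where
  "disk_analytic = {f. f holomorphic_on unit_disk \<and> (\<forall>z. z \<notin> unit_disk \<longrightarrow> f z = 0)}"

definition bergman_space :: "real \<Rightarrow> (complex \<Rightarrow> complex) set" where
  "bergman_space \<alpha> =
     {g \<in> disk_analytic. integrable (weighted_area \<alpha>) (\<lambda>z. (cmod (g z))\<^sup>2)}"

definition bergman_norm :: "real \<Rightarrow> (complex \<Rightarrow> complex) \<Rightarrow> real" where
  "bergman_norm \<alpha> g = sqrt (\<integral>z. (cmod (g z))\<^sup>2 \<partial>weighted_area \<alpha>)"

definition dirichlet_space :: "real \<Rightarrow> (complex \<Rightarrow> complex) set" where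
  "dirichlet_space \<alpha> =
     {f \<in> disk_analytic. integrable (weighted_area \<alpha>) (\<lambda>z. (cmod (deriv f z))\<^sup>2)}"

definition dirichlet_norm :: "real \<Rightarrow> (complex \<Rightarrow> complex) \<Rightarrow> real" where
  "dirichlet_norm \<alpha> f =
     sqrt ((cmod (f 0))\<^sup>2 + (\<integral>z. (cmod (deriv f z))\<^sup>2 \<partial>weighted_area \<alpha>))"

definition dirichlet_dist ::
    "real \<Rightarrow> (complex \<Rightarrow> complex) \<Rightarrow> (complex \<Rightarrow> complex) \<Rightarrow> real" where
  "dirichlet_dist \<alpha> f g = dirichlet_norm \<alpha> (\<lambda>z. f z - g z)"

definition comp_op :: "(complex \<Rightarrow> complex) \<Rightarrow> (complex \<Rightarrow> complex) \<Rightarrow> complex \<Rightarrow> complex" where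
  "comp_op \<phi> f = (\<lambda>z. if z \<in> unit_disk then f (\<phi> z) else 0)"

definition bounded_comp_op :: "real \<Rightarrow> (complex \<Rightarrow> complex) \<Rightarrow> bool" where
  "bounded_comp_op \<alpha> \<phi> \<longleftrightarrow>
     comp_op \<phi> ` dirichlet_space \<alpha> \<subseteq> dirichlet_space \<alpha> \<and>
     (\<exists>C. \<forall>f\<in>dirichlet_space \<alpha>. dirichlet_norm \<alpha> (comp_op \<phi> f) \<le> C * dirichlet_norm \<alpha> f)"

definition closed_range_comp_op :: "real \<Rightarrow> (complex \<Rightarrow> complex) \<Rightarrow> bool" where
  "closed_range_comp_op \<alpha> \<phi> \<longleftrightarrow>
     closedin (Metric_space.mtopology (dirichlet_space \<alpha>) (dirichlet_dist \<alpha>))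
       (comp_op \<phi> ` dirichlet_space \<alpha>)"

text \<open>The multiplicity of a preimage \<open>z\<close> of \<open>w\<close> is the order of the zero of \<open>\<phi> - w\<close> at \<open>z\<close>.\<close>

definition counting_fun :: "(complex \<Rightarrow> complex) \<Rightarrow> real \<Rightarrow> complex \<Rightarrow> ennreal" where
  "counting_fun \<phi> \<alpha> w =
     (\<Sum>\<^sub>\<infinity>z\<in>{z \<in> unit_disk. \<phi> z = w}.
        of_nat (nat (zorder (\<lambda>\<zeta>. \<phi> \<zeta> - w) z)) * ennreal ((1 - (cmod z)\<^sup>2) powr \<alpha>))"

text \<open>
  For nonconstant analytic \<open>\<phi>\<close> and \<open>\<alpha> < 0\<close> the counting function is lower semicontinuous on the disk,
  hence Borel, as \<open>density\<close> needs.
\<close>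

definition counting_measure :: "(complex \<Rightarrow> complex) \<Rightarrow> real \<Rightarrow> complex measure" where
  "counting_measure \<phi> \<alpha> = density disk_area (counting_fun \<phi> \<alpha>)"

definition pseudo_hyperbolic :: "complex \<Rightarrow> complex \<Rightarrow> real" where
  "pseudo_hyperbolic z w = cmod ((z - w) / (1 - cnj z * w))"

definition bergman_dist :: "complex \<Rightarrow> complex \<Rightarrow> real" where
  "bergman_dist z w = artanh (pseudo_hyperbolic z w)"

definition bergman_disk :: "complex \<Rightarrow> real \<Rightarrow> complex set" where
  "bergman_disk z r = {w \<in> unit_disk. bergman_dist z w < r}"

definition reverse_carleson :: "real \<Rightarrow> complex measure \<Rightarrow> bool" where
  "reverse_carleson \<alpha> \<mu> \<longleftrightarrow>
     sets \<mu> = sets (restrict_space borel unit_disk) \<and>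
     (\<exists>c>0. \<forall>g\<in>bergman_space \<alpha>.
        (\<integral>\<^sup>+z. ennreal ((cmod (g z))\<^sup>2) \<partial>\<mu>) \<ge> ennreal (c * (bergman_norm \<alpha> g)\<^sup>2))"

definition is_domain :: "complex set \<Rightarrow> bool" where
  "is_domain U \<longleftrightarrow> open U \<and> connected U \<and> U \<noteq> {}"

definition compact_hole_condition :: "complex set \<Rightarrow> bool" where
  "compact_hole_condition \<Omega> \<longleftrightarrow>
     is_domain \<Omega> \<and> \<Omega> \<subseteq> unit_disk \<and>
     (\<exists>U K. is_domain U \<and> simply_connected U \<and> U \<subseteq> unit_disk \<and>
            compact K \<and> K \<subseteq> U \<and> \<Omega> = U - K)"

lemma weighted_area_eq:
  "weighted_area \<alpha> = density (restrict_space lborel unit_disk)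
     (\<lambda>z. ennreal (1 / pi) * ennreal ((1 + \<alpha>) * (1 - (cmod z)\<^sup>2) powr \<alpha>))"
  unfolding weighted_area_def disk_area_def
  by (subst density_density_eq) (auto intro!: measurable_restrict_space1)

lemma sets_weighted_area: "sets (weighted_area \<alpha>) = sets (restrict_space lborel unit_disk)"
  by (simp add: weighted_area_eq)

lemma AE_weighted_area:
  assumes "\<alpha> > -1"
  shows "(AE z in weighted_area \<alpha>. P z) \<longleftrightarrow> (AE z in lborel. z \<in> unit_disk \<longrightarrow> P z)"
proof -
  have pos: "0 < (1::real) - (cmod z)\<^sup>2" if "z \<in> unit_disk" for z
    using that by (simp add: abs_square_less_1)
  have "(AE z in weighted_area \<alpha>. P z) \<longleftrightarrow>
     (AE z in restrict_space lborel unit_disk.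
        0 < ennreal (1 / pi) * ennreal ((1 + \<alpha>) * (1 - (cmod z)\<^sup>2) powr \<alpha>) \<longrightarrow> P z)"
    unfolding weighted_area_eq
    by (subst AE_density) (auto intro!: measurable_restrict_space1)
  also have "\<dots> \<longleftrightarrow> (AE z in lborel. z \<in> unit_disk \<longrightarrow>
        0 < ennreal (1 / pi) * ennreal ((1 + \<alpha>) * (1 - (cmod z)\<^sup>2) powr \<alpha>) \<longrightarrow> P z)"
    by (subst AE_restrict_space_iff) auto
  also have "\<dots> \<longleftrightarrow> (AE z in lborel. z \<in> unit_disk \<longrightarrow> P z)"
  proof (rule AE_cong)
    fix z :: complex
    show "(z \<in> unit_disk \<longrightarrow> 0 < ennreal (1 / pi) * ennreal ((1 + \<alpha>) * (1 - (cmod z)\<^sup>2) powr \<alpha>)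
             \<longrightarrow> P z) \<longleftrightarrow> (z \<in> unit_disk \<longrightarrow> P z)"
    proof (cases "z \<in> unit_disk")
      case True
      have "0 < (1 + \<alpha>) * (1 - (cmod z)\<^sup>2) powr \<alpha>"
        using pos[OF True] assms by simp
      then show ?thesis by (simp add: ennreal_zero_less_mult_iff)
    qed simp
  qed
  finally show ?thesis .
qed

lemma disk_analytic_diff:
  "f \<in> disk_analytic \<Longrightarrow> g \<in> disk_analytic \<Longrightarrow> (\<lambda>z. f z - g z) \<in> disk_analytic"
  by (auto simp: disk_analytic_def intro!: holomorphic_intros)

lemma measurable_deriv:
  assumes "f \<in> disk_analytic"
  shows "(\<lambda>z. (cmod (deriv f z))\<^sup>2) \<in> borel_measurable (weighted_area \<alpha>)"
proof -
  have "deriv f holomorphic_on unit_disk"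
    using assms by (auto simp: disk_analytic_def intro!: holomorphic_deriv)
  then have "continuous_on unit_disk (\<lambda>z. (cmod (deriv f z))\<^sup>2)"
    by (intro continuous_intros holomorphic_on_imp_continuous_on)
  then have "(\<lambda>z. (cmod (deriv f z))\<^sup>2) \<in> borel_measurable (restrict_space borel unit_disk)"
    by (rule borel_measurable_continuous_on_restrict)
  then show ?thesis
    by (simp add: weighted_area_eq cong: measurable_cong_sets sets_restrict_space_cong)
qed

lemma space_weighted_area: "space (weighted_area \<alpha>) = unit_disk"
  by (simp add: weighted_area_eq space_restrict_space)

lemma deriv_disk_diff:
  assumes "f \<in> disk_analytic" "g \<in> disk_analytic" "z \<in> unit_disk"
  shows "deriv (\<lambda>z. f z - g z) z = deriv f z - deriv g z"
  using assms
  by (intro deriv_diff) (auto simp: disk_analytic_def intro!: holomorphic_on_imp_differentiable_at)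

lemma weighted_square_ineq:
  assumes "t > (0::real)"
  shows "(cmod (a - b))\<^sup>2 \<le> (1 + t) * (cmod a)\<^sup>2 + (1 + 1 / t) * (cmod b)\<^sup>2"
proof -
  let ?x = "cmod a" and ?y = "cmod b"
  have "(cmod (a - b))\<^sup>2 \<le> (?x + ?y)\<^sup>2"
    by (intro power_mono norm_triangle_ineq4) auto
  also have "\<dots> = ?x\<^sup>2 + ?y\<^sup>2 + 2 * (?x * ?y)"
    by (simp add: power2_sum)
  also have "2 * (?x * ?y) \<le> t * ?x\<^sup>2 + ?y\<^sup>2 / t"
  proof -
    have "0 \<le> (t * ?x - ?y)\<^sup>2 / t" using assms by simp
    also have "\<dots> = t * ?x\<^sup>2 + ?y\<^sup>2 / t - 2 * (?x * ?y)"
      using assms by (simp add: power2_eq_square field_simps)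
    finally show ?thesis by simp
  qed
  finally show ?thesis by (simp add: algebra_simps)
qed

lemma weighted_square_eq:
  assumes "p > (0::real)" "q > 0"
  shows "(1 + q / p) * p\<^sup>2 + (1 + 1 / (q / p)) * q\<^sup>2 = (p + q)\<^sup>2"
  using assms by (simp add: power2_eq_square field_simps)

lemma dirichlet_space_diff:
  assumes "f \<in> dirichlet_space \<alpha>" "g \<in> dirichlet_space \<alpha>"
  shows "(\<lambda>z. f z - g z) \<in> dirichlet_space \<alpha>"
proof -
  have an: "f \<in> disk_analytic" "g \<in> disk_analytic"
    using assms by (auto simp: dirichlet_space_def)
  have "integrable (weighted_area \<alpha>) (\<lambda>z. (1 + 1) * (cmod (deriv f z))\<^sup>2 + (1 + 1 / 1) * (cmod (deriv g z))\<^sup>2)"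
    using assms by (intro Bochner_Integration.integrable_add integrable_mult_right) (auto simp: dirichlet_space_def)
  then have "integrable (weighted_area \<alpha>) (\<lambda>z. (cmod (deriv (\<lambda>z. f z - g z) z))\<^sup>2)"
  proof (rule Bochner_Integration.integrable_bound)
    show "(\<lambda>z. (cmod (deriv (\<lambda>z. f z - g z) z))\<^sup>2) \<in> borel_measurable (weighted_area \<alpha>)"
      by (intro measurable_deriv disk_analytic_diff an)
    show "AE z in weighted_area \<alpha>. norm ((cmod (deriv (\<lambda>z. f z - g z) z))\<^sup>2)
        \<le> norm ((1 + 1) * (cmod (deriv f z))\<^sup>2 + (1 + 1 / 1) * (cmod (deriv g z))\<^sup>2)"
    proof (rule AE_I2)
      fix z assume "z \<in> space (weighted_area \<alpha>)"
      then have z: "z \<in> unit_disk" by (simp add: space_weighted_area)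
      show "norm ((cmod (deriv (\<lambda>z. f z - g z) z))\<^sup>2)
        \<le> norm ((1 + 1) * (cmod (deriv f z))\<^sup>2 + (1 + 1 / 1) * (cmod (deriv g z))\<^sup>2)"
        using weighted_square_ineq[of 1 "deriv f z" "deriv g z"]
        by (simp add: deriv_disk_diff[OF an z])
    qed
  qed
  then show ?thesis
    using an by (auto simp: dirichlet_space_def intro!: disk_analytic_diff)
qed

lemma dirichlet_norm_nonneg: "0 \<le> dirichlet_norm \<alpha> f"
  by (simp add: dirichlet_norm_def)

lemma dirichlet_norm_sq:
  "(dirichlet_norm \<alpha> f)\<^sup>2 = (cmod (f 0))\<^sup>2 + (\<integral>z. (cmod (deriv f z))\<^sup>2 \<partial>weighted_area \<alpha>)"
  by (simp add: dirichlet_norm_def)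

lemma dirichlet_norm_eq_0:
  assumes "\<alpha> > -1" "f \<in> dirichlet_space \<alpha>" "dirichlet_norm \<alpha> f = 0"
  shows "f = (\<lambda>z. 0)"
proof -
  have an: "f holomorphic_on unit_disk" "\<And>z. z \<notin> unit_disk \<Longrightarrow> f z = 0"
    and int: "integrable (weighted_area \<alpha>) (\<lambda>z. (cmod (deriv f z))\<^sup>2)"
    using assms(2) by (auto simp: dirichlet_space_def disk_analytic_def)
  have "(cmod (f 0))\<^sup>2 + (\<integral>z. (cmod (deriv f z))\<^sup>2 \<partial>weighted_area \<alpha>) = 0"
    using dirichlet_norm_sq[of \<alpha> f] assms(3) by simp
  moreover have "0 \<le> (\<integral>z. (cmod (deriv f z))\<^sup>2 \<partial>weighted_area \<alpha>)" by simp
  ultimately have f0: "f 0 = 0" and i0: "(\<integral>z. (cmod (deriv f z))\<^sup>2 \<partial>weighted_area \<alpha>) = 0"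
    by (smt (verit) zero_le_power2 power2_eq_iff_nonneg norm_ge_zero zero_power2 norm_eq_zero)+
  have "AE z in weighted_area \<alpha>. (cmod (deriv f z))\<^sup>2 = 0"
    using integral_nonneg_eq_0_iff_AE[OF int] i0 by simp
  then have ae: "AE z in lborel. z \<in> unit_disk \<longrightarrow> deriv f z = 0"
    using AE_weighted_area[OF assms(1)] by simp
  have "deriv f holomorphic_on unit_disk"
    using an by (auto intro!: holomorphic_deriv)
  then have cont: "continuous_on unit_disk (deriv f)"
    by (rule holomorphic_on_imp_continuous_on)
  let ?S = "unit_disk \<inter> deriv f -` (- {0})"
  have "open ?S"
    by (rule continuous_open_preimage[OF cont]) auto
  moreover have "negligible ?S"
  proof -
    have "AE z in lebesgue. z \<in> unit_disk \<longrightarrow> deriv f z = 0"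
      using ae by (rule AE_completion)
    then have "AE z in lebesgue. z \<notin> ?S" by eventually_elim auto
    moreover have "?S \<in> sets lebesgue" using \<open>open ?S\<close> by auto
    ultimately show ?thesis
      by (subst negligible_iff_null_sets) (simp add: AE_iff_null_sets)
  qed
  ultimately have "?S = {}" using open_not_negligible by blast
  then have d0: "deriv f z = 0" if "z \<in> unit_disk" for z using that by auto
  have "\<exists>c. \<forall>z\<in>unit_disk. f z = c"
  proof (rule has_field_derivative_zero_constant)
    show "convex unit_disk" by simp
    fix z :: complex assume z: "z \<in> unit_disk"
    then have "(f has_field_derivative deriv f z) (at z within unit_disk)"
      using an(1) holomorphic_derivI by blast
    then show "(f has_field_derivative 0) (at z within unit_disk)" using d0[OF z] by simp
  qed
  then obtain c where c: "\<And>z. z \<in> unit_disk \<Longrightarrow> f z = c" by auto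
  have "c = 0" using f0 c[of 0] by simp
  show ?thesis
  proof
    fix z show "f z = 0"
      using c[of z] an(2)[of z] \<open>c = 0\<close> by (cases "z \<in> unit_disk") auto
  qed
qed

lemma dirichlet_dist_commute: "dirichlet_dist \<alpha> f g = dirichlet_dist \<alpha> g f"
proof -
  have deq: "cmod (deriv (\<lambda>z. f z - g z) z) = cmod (deriv (\<lambda>z. g z - f z) z)" for z
  proof (cases "(\<lambda>z. g z - f z) field_differentiable (at z)")
    case True
    then have "deriv (\<lambda>z. - (g z - f z)) z = - deriv (\<lambda>z. g z - f z) z"
      by (intro DERIV_imp_deriv DERIV_minus) (simp add: DERIV_deriv_iff_field_differentiable)
    moreover have "(\<lambda>z. - (g z - f z)) = (\<lambda>z. f z - g z)" by simp
    ultimately show ?thesis by (metis norm_minus_cancel)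
  next
    case False
    have "\<not> (\<lambda>z. f z - g z) field_differentiable (at z)"
    proof
      assume "(\<lambda>z. f z - g z) field_differentiable (at z)"
      then have "(\<lambda>z. - (f z - g z)) field_differentiable (at z)"
        by (rule field_differentiable_minus)
      with False show False by simp
    qed
    then show ?thesis
      using False unfolding deriv_def field_differentiable_def by simp
  qed
  show ?thesis
    unfolding dirichlet_dist_def dirichlet_norm_def by (simp add: deq norm_minus_commute)
qed

lemma dirichlet_norm_diff_le:
  assumes "\<alpha> > -1" "f \<in> dirichlet_space \<alpha>" "g \<in> dirichlet_space \<alpha>"
  shows "dirichlet_norm \<alpha> (\<lambda>z. f z - g z) \<le> dirichlet_norm \<alpha> f + dirichlet_norm \<alpha> g"
proof -
  let ?p = "dirichlet_norm \<alpha> f" and ?q = "dirichlet_norm \<alpha> g" and ?h = "\<lambda>z. f z - g z"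
  have an: "f \<in> disk_analytic" "g \<in> disk_analytic"
    and int: "integrable (weighted_area \<alpha>) (\<lambda>z. (cmod (deriv f z))\<^sup>2)"
             "integrable (weighted_area \<alpha>) (\<lambda>z. (cmod (deriv g z))\<^sup>2)"
    using assms by (auto simp: dirichlet_space_def)
  have inth: "integrable (weighted_area \<alpha>) (\<lambda>z. (cmod (deriv ?h z))\<^sup>2)"
    using dirichlet_space_diff[OF assms(2,3)] by (simp add: dirichlet_space_def)
  consider "?p = 0" | "?q = 0" | "?p > 0" "?q > 0"
    using dirichlet_norm_nonneg[of \<alpha> f] dirichlet_norm_nonneg[of \<alpha> g] by linarith
  then show ?thesis
  proof cases
    case 1
    then have "f = (\<lambda>z. 0)" using dirichlet_norm_eq_0 assms by blast
    then show ?thesis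
      using dirichlet_dist_commute[of \<alpha> "\<lambda>z. 0" g] dirichlet_norm_nonneg[of \<alpha> f]
      unfolding dirichlet_dist_def by simp
  next
    case 2
    then have "g = (\<lambda>z. 0)" using dirichlet_norm_eq_0 assms by blast
    then show ?thesis using dirichlet_norm_nonneg[of \<alpha> g] by simp
  next
    case 3
    define t where "t = ?q / ?p"
    have t: "t > 0" using 3 by (simp add: t_def)
    have "(\<integral>z. (cmod (deriv ?h z))\<^sup>2 \<partial>weighted_area \<alpha>) \<le>
       (\<integral>z. (1 + t) * (cmod (deriv f z))\<^sup>2 + (1 + 1 / t) * (cmod (deriv g z))\<^sup>2 \<partial>weighted_area \<alpha>)"
    proof (rule integral_mono[OF inth])
      show "integrable (weighted_area \<alpha>)
          (\<lambda>z. (1 + t) * (cmod (deriv f z))\<^sup>2 + (1 + 1 / t) * (cmod (deriv g z))\<^sup>2)"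
        using int by (intro Bochner_Integration.integrable_add integrable_mult_right) auto
      fix z assume "z \<in> space (weighted_area \<alpha>)"
      then have z: "z \<in> unit_disk" by (simp add: space_weighted_area)
      show "(cmod (deriv ?h z))\<^sup>2 \<le> (1 + t) * (cmod (deriv f z))\<^sup>2 + (1 + 1 / t) * (cmod (deriv g z))\<^sup>2"
        unfolding deriv_disk_diff[OF an z] by (rule weighted_square_ineq[OF t])
    qed
    also have "\<dots> = (1 + t) * (\<integral>z. (cmod (deriv f z))\<^sup>2 \<partial>weighted_area \<alpha>)
        + (1 + 1 / t) * (\<integral>z. (cmod (deriv g z))\<^sup>2 \<partial>weighted_area \<alpha>)"
      using int by (subst Bochner_Integration.integral_add) auto
    finally have "(dirichlet_norm \<alpha> ?h)\<^sup>2 \<le> (1 + t) * ?p\<^sup>2 + (1 + 1 / t) * ?q\<^sup>2"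
      using weighted_square_ineq[OF t, of "f 0" "g 0"]
      unfolding dirichlet_norm_sq distrib_left by linarith
    also have "\<dots> = (?p + ?q)\<^sup>2"
      unfolding t_def using 3 by (rule weighted_square_eq)
    finally show ?thesis
      by (rule power2_le_imp_le) (use 3 in linarith)
  qed
qed

lemma Metric_space_dirichlet:
  assumes "\<alpha> > -1"
  shows "Metric_space (dirichlet_space \<alpha>) (dirichlet_dist \<alpha>)"
proof
  fix f g h
  show "0 \<le> dirichlet_dist \<alpha> f g"
    by (simp add: dirichlet_dist_def dirichlet_norm_nonneg)
  show "dirichlet_dist \<alpha> f g = dirichlet_dist \<alpha> g f"
    by (rule dirichlet_dist_commute)
  assume f: "f \<in> dirichlet_space \<alpha>" and g: "g \<in> dirichlet_space \<alpha>"
  show "dirichlet_dist \<alpha> f g = 0 \<longleftrightarrow> f = g"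
  proof
    assume "dirichlet_dist \<alpha> f g = 0"
    then have "(\<lambda>z. f z - g z) = (\<lambda>z. 0)"
      unfolding dirichlet_dist_def
      by (intro dirichlet_norm_eq_0[OF assms]) (auto intro: dirichlet_space_diff f g)
    then show "f = g" by (auto simp: fun_eq_iff)
  qed (simp add: dirichlet_dist_def dirichlet_norm_def)
  assume h: "h \<in> dirichlet_space \<alpha>"
  have "dirichlet_dist \<alpha> f h = dirichlet_norm \<alpha> (\<lambda>z. (f z - g z) - (h z - g z))"
    by (simp add: dirichlet_dist_def)
  also have "\<dots> \<le> dirichlet_norm \<alpha> (\<lambda>z. f z - g z) + dirichlet_norm \<alpha> (\<lambda>z. h z - g z)"
    by (intro dirichlet_norm_diff_le assms dirichlet_space_diff f g h)
  also have "\<dots> = dirichlet_dist \<alpha> f g + dirichlet_dist \<alpha> g h"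
    using dirichlet_dist_commute[of \<alpha> g h] by (simp add: dirichlet_dist_def)
  finally show "dirichlet_dist \<alpha> f h \<le> dirichlet_dist \<alpha> f g + dirichlet_dist \<alpha> g h" .
qed

end

theory Submission
  imports Defs
begin

text \<open>
  Write \<open>\<Omega>\<close> for the range of \<open>\<phi>\<close>, \<open>D\<close> for the disk, \<open>T\<close> for the circle
  and \<open>\<mu>\<close> for the counting measure. For \<open>-1 < \<alpha> < 0\<close> a function of the Dirichlet space varies
  by at most a multiple of \<open>(1 - r) powr (-\<alpha>/2)\<close> on the part of a radius with modulus at least \<open>r\<close>
  (\<open>dirichlet_radial_bound\<close>), and this rigidity makes every condition of the theorem equivalent to
  \<open>T \<subseteq> closure \<Omega>\<close>.

  The main step, \<open>simply_connected_hull_full\<close>, is that \<open>T \<subseteq> closure \<Omega>\<close> forces a simply connected open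
  set \<open>U\<close> with \<open>\<Omega> \<subseteq> U \<subseteq> D\<close> to be all of \<open>D\<close>. Boundedness of the composition operator enters by
  testing it on the logarithms \<open>- Ln (1 - cnj w * u)\<close>: together with the radial estimate it shows that
  every point of \<open>T\<close> is a limit of values \<open>\<phi> (z n)\<close> for which \<open>1 - cmod (\<phi> (z n))\<close> is at most a fixed
  multiple \<open>L\<close> of \<open>1 - cmod (z n)\<close>. Now write \<open>\<phi> = \<psi> \<circ> h\<close> with a Riemann map \<open>\<psi>\<close> onto \<open>U\<close>. By the
  Schwarz-Pick lemma \<open>\<psi>\<close> has approximating sequences of the same kind, and Julia's lemma turns
  them into pairs \<open>(\<eta>, \<zeta>)\<close> of points of \<open>T\<close> such that \<open>\<psi>\<close> sends \<open>\<eta>\<close> to \<open>\<zeta>\<close> with a bounded angular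
  derivative. Every \<open>\<zeta>\<close> occurs, and \<open>\<eta>\<close> determines \<open>\<zeta>\<close>. Conversely \<open>\<zeta>\<close> determines \<open>\<eta>\<close>: near each such
  \<open>\<eta>\<close> the map \<open>\<psi>\<close> takes all values on the last piece of the radius to \<open>\<zeta>\<close> (Julia-Caratheodory), and
  \<open>\<psi>\<close> is injective. So \<open>\<zeta> \<mapsto> \<eta>\<close> is a continuous injection of the circle into itself, hence
  onto. Julia's inequality therefore holds at every \<open>\<eta>\<close>, which gives \<open>cmod (\<psi> z) \<longrightarrow> 1\<close> at the
  boundary; so \<open>\<psi>\<close> is proper and \<open>U = D\<close>. When \<open>\<Omega> = U - K\<close>, this says that \<open>\<Omega>\<close> contains an annulus
  next to \<open>T\<close>.

  The other implications close a cycle. By the Schwarz lemma and \<open>\<alpha> < 0\<close>, the counting function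
  is at least \<open>(1 - (cmod w)\<^sup>2) powr \<alpha>\<close> on \<open>\<Omega>\<close> (\<open>counting_fun_ge_weight\<close>). If \<open>\<Omega>\<close> contains an
  annulus, which carries a fixed share of every Bergman norm (\<open>annulus_controls_bergman_integral\<close>)
  and of the area of every Bergman disk of a suitable radius, then \<open>\<mu>\<close> is a
  reverse Carleson measure and the two area conditions hold. A change of variables (\<open>nn_integral_counting_measure\<close>) identifies the integral
  of \<open>(cmod (deriv f z))\<^sup>2\<close> against \<open>\<mu>\<close> with the derivative part of the norm of \<open>f \<circ> \<phi>\<close>, up to
  the factor \<open>1 + \<alpha>\<close>; so a reverse Carleson measure makes the operator bounded below, and its range
  closed. Finally let \<open>\<zeta>\<close> in \<open>T\<close> have a neighbourhood without points of \<open>\<Omega>\<close>. Then \<open>\<mu>\<close> vanishes on the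
  Bergman disks close to \<open>\<zeta>\<close>, and \<open>1 / (\<zeta> - \<phi> z)\<close> is a limit of functions in the range that is not in
  the range, since the functions of the Dirichlet space are bounded.
\<close>

section \<open>Schwarz-Pick estimates and angular derivatives in a half-plane\<close>

lemma moebius_identity:
  fixes z w :: complex
  shows "(cmod (1 - cnj w * z))\<^sup>2 - (cmod (z - w))\<^sup>2 = (1 - (cmod z)\<^sup>2) * (1 - (cmod w)\<^sup>2)"
  unfolding cmod_power2 by (simp add: power2_eq_square algebra_simps)

lemma moebius_denominator_nonzero:
  fixes z w :: complex
  assumes "cmod z < 1" "cmod w \<le> 1"
  shows "1 - cnj w * z \<noteq> 0"
proof
  assume "1 - cnj w * z = 0"
  then have "cnj w * z = 1" by simp
  then have "cmod w * cmod z = 1" by (metis complex_mod_cnj norm_mult norm_one)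
  moreover have "cmod w * cmod z \<le> 1 * cmod z" using assms(2) by (intro mult_right_mono) auto
  ultimately show False using assms(1) by simp
qed

lemma one_minus_norm_sq_pos: "cmod z < 1 \<Longrightarrow> 0 < 1 - (cmod z)\<^sup>2"
  by (simp add: abs_square_less_1)

text \<open>
  Contraction of the pseudohyperbolic distance, with the distances eliminated by
  \<open>moebius_identity\<close>. In this form both sides extend continuously to boundary points, which is what the
  limit in \<open>Julia_lemma\<close> needs.
\<close>

lemma moebius_contraction_imp_sq_le:
  fixes z w u v :: complex
  assumes z: "cmod z < 1" and w: "cmod w < 1" and u: "cmod u < 1" and v: "cmod v < 1"
    and le: "cmod ((u - v) / (1 - cnj v * u)) \<le> cmod ((z - w) / (1 - cnj w * z))"
  shows "(cmod (1 - cnj v * u))\<^sup>2 * ((1 - (cmod z)\<^sup>2) * (1 - (cmod w)\<^sup>2))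
    \<le> (cmod (1 - cnj w * z))\<^sup>2 * ((1 - (cmod u)\<^sup>2) * (1 - (cmod v)\<^sup>2))"
proof -
  define A where "A = (cmod (1 - cnj v * u))\<^sup>2"
  define B where "B = (cmod (1 - cnj w * z))\<^sup>2"
  have A: "A > 0" using moebius_denominator_nonzero[of u v] u v by (simp add: A_def)
  have B: "B > 0" using moebius_denominator_nonzero[of z w] z w by (simp add: B_def)
  have "(cmod (u - v))\<^sup>2 / A \<le> (cmod (z - w))\<^sup>2 / B"
    using power_mono[OF le, of 2] by (simp add: A_def B_def norm_divide power_divide)
  then have "(cmod (u - v))\<^sup>2 * B \<le> (cmod (z - w))\<^sup>2 * A"
    using A B by (simp add: divide_simps mult.commute)
  moreover have "(cmod (u - v))\<^sup>2 = A - (1 - (cmod u)\<^sup>2) * (1 - (cmod v)\<^sup>2)"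
    "(cmod (z - w))\<^sup>2 = B - (1 - (cmod z)\<^sup>2) * (1 - (cmod w)\<^sup>2)"
    unfolding A_def B_def using moebius_identity[of v u] moebius_identity[of w z] by linarith+
  ultimately show ?thesis
    unfolding A_def[symmetric] B_def[symmetric] by (simp add: algebra_simps)
qed

lemma Schwarz_Pick_disk:
  assumes f: "f holomorphic_on unit_disk" and ran: "f ` unit_disk \<subseteq> unit_disk"
    and z: "z \<in> unit_disk" and w: "w \<in> unit_disk"
  shows "(cmod (1 - cnj (f w) * f z))\<^sup>2 * ((1 - (cmod z)\<^sup>2) * (1 - (cmod w)\<^sup>2))
    \<le> (cmod (1 - cnj w * z))\<^sup>2 * ((1 - (cmod (f z))\<^sup>2) * (1 - (cmod (f w))\<^sup>2))"
proof -
  let ?M = "Moebius_function 0"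
  define g where "g = ?M (f w) \<circ> f \<circ> ?M (- w)"
  have nz: "cmod z < 1" and nw: "cmod w < 1" using z w by auto
  have fz: "cmod (f x) < 1" if "cmod x < 1" for x using ran that by force
  have M: "cmod (?M a x) < 1" if "cmod a < 1" "cmod x < 1" for a x
    using Moebius_function_norm_lt_1 that by blast
  have "g holomorphic_on ball 0 1"
    unfolding g_def
    apply (intro holomorphic_on_compose_gen[where t = "ball 0 1"] Moebius_function_holomorphic f)
    using M nw fz by auto
  moreover have "g 0 = 0"
    by (simp add: g_def Moebius_function_of_zero Moebius_function_eq_zero)
  moreover have "cmod (g x) < 1" if "cmod x < 1" for x
    unfolding g_def using M nw fz that by auto
  ultimately have "cmod (g (?M w z)) \<le> cmod (?M w z)"
    using Schwarz_Lemma(1)[of g "?M w z"] M[OF nw nz] by blast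
  moreover have "g (?M w z) = ?M (f w) (f z)"
    using Moebius_function_compose[of "-w" w z] nw nz by (simp add: g_def)
  ultimately have "cmod ((f z - f w) / (1 - cnj (f w) * f z)) \<le> cmod ((z - w) / (1 - cnj w * z))"
    by (simp add: Moebius_function_simple)
  then show ?thesis
    by (intro moebius_contraction_imp_sq_le fz nz nw)
qed

text \<open>
  The right half-plane is carried to the disk by the Cayley maps based at \<open>w\<close> and at \<open>G w\<close>, so the Schwarz
  lemma bounds \<open>cmod (G z - G w) / cmod (G z + cnj (G w))\<close> by \<open>cmod (z - w) / cmod (z + cnj w)\<close>. Solving for
  \<open>G z - G w\<close> gives a bound proportional to \<open>Re (G w)\<close>: a function whose real part is small at one
  point moves slowly everywhere.
\<close>

lemma Schwarz_Pick_half_plane: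
  fixes G :: "complex \<Rightarrow> complex"
  assumes G: "G holomorphic_on {z. 0 < Re z}" and pos: "\<And>z. 0 < Re z \<Longrightarrow> 0 < Re (G z)"
    and z: "0 < Re z" and w: "0 < Re w"
  shows "cmod (G z - G w) \<le> 2 * Re (G w) * (cmod (z + cnj w))\<^sup>2 / (2 * Re z * Re w)"
proof -
  define m where "m \<xi> = (w + cnj w * \<xi>) / (1 - \<xi>)" for \<xi>
  define q where "q \<xi> = (G (m \<xi>) - G w) / (G (m \<xi>) + cnj (G w))" for \<xi>
  have sumnz: "a + cnj b \<noteq> 0" if "0 < Re a" "0 < Re b" for a b
    using that by (metis add_pos_pos complex_cnj_cnj order_less_irrefl plus_complex.simps(1) cnj.simps(1) zero_complex.simps(1))
  have key: "(cmod (a + cnj b))\<^sup>2 - (cmod (a - b))\<^sup>2 = 4 * Re a * Re b" for a b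
    unfolding cmod_power2 by (simp add: power2_eq_square algebra_simps)
  have lt: "cmod ((a - b) / (a + cnj b)) < 1" if "0 < Re a" "0 < Re b" for a b
  proof -
    have "(cmod (a - b))\<^sup>2 < (cmod (a + cnj b))\<^sup>2" using key[of a b] mult_pos_pos[OF that] by linarith
    then have "cmod (a - b) < cmod (a + cnj b)" by (rule power2_less_imp_less) simp
    then show ?thesis using sumnz[OF that] by (simp add: norm_divide divide_simps)
  qed
  have mpos: "0 < Re (m \<xi>)" if "cmod \<xi> < 1" for \<xi>
  proof -
    have n: "1 - \<xi> \<noteq> 0" using that by auto
    have "Re (m \<xi>) = Re ((w + cnj w * \<xi>) * cnj (1 - \<xi>)) / (cmod (1 - \<xi>))\<^sup>2"
      unfolding m_def complex_div_cnj[of _ "1 - \<xi>"] by (simp only: Re_divide_of_real of_real_power[symmetric])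
    also have "Re ((w + cnj w * \<xi>) * cnj (1 - \<xi>)) = Re w * (1 - (cmod \<xi>)\<^sup>2)"
      unfolding cmod_power2 by (simp add: power2_eq_square algebra_simps)
    finally show ?thesis using w n one_minus_norm_sq_pos[OF that] by simp
  qed
  have holm: "m holomorphic_on ball 0 1"
    unfolding m_def by (intro holomorphic_intros) auto
  have "(G \<circ> m) holomorphic_on ball 0 1"
    by (rule holomorphic_on_compose_gen[OF holm G]) (use mpos in auto)
  then have holGm: "(\<lambda>\<xi>. G (m \<xi>)) holomorphic_on ball 0 1" by (simp add: o_def)
  have "q holomorphic_on ball 0 1"
    unfolding q_def by (intro holomorphic_intros holGm) (use sumnz mpos pos w in auto)
  moreover have "q 0 = 0" by (simp add: q_def m_def)
  moreover have "cmod (q \<xi>) < 1" if "cmod \<xi> < 1" for \<xi>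
    unfolding q_def using lt pos mpos[OF that] w by blast
  ultimately have sch: "cmod (q \<xi>) \<le> cmod \<xi>" if "cmod \<xi> < 1" for \<xi>
    using Schwarz_Lemma(1) that by blast
  \<comment> \<open>The point that the Cayley map \<open>m\<close> sends to \<open>z\<close>.\<close>
  define \<xi> where "\<xi> = (z - w) / (z + cnj w)"
  have \<xi>1: "cmod \<xi> < 1" unfolding \<xi>_def by (rule lt[OF z w])
  have szw: "z + cnj w \<noteq> 0" by (rule sumnz[OF z w])
  have "1 - \<xi> = (w + cnj w) / (z + cnj w)" using szw by (simp add: \<xi>_def field_simps)
  moreover have "w + cnj w * \<xi> = z * (w + cnj w) / (z + cnj w)"
    using szw by (simp add: \<xi>_def field_simps)
  moreover have "w + cnj w \<noteq> 0" using sumnz[OF w w] .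
  ultimately have mz: "m \<xi> = z" using szw by (simp add: m_def)
  define r where "r = cmod \<xi>"
  define D where "D = cmod (G z - G w)"
  have snz: "G z + cnj (G w) \<noteq> 0" using sumnz pos z w by blast
  have r0: "0 \<le> r" "r < 1" using \<xi>1 by (auto simp: r_def)
  have "D \<le> r * cmod (G z + cnj (G w))"
    using sch[OF \<xi>1] snz unfolding q_def mz r_def D_def by (simp add: norm_divide divide_simps)
  also have "r * cmod (G z + cnj (G w)) \<le> r * (D + 2 * Re (G w))"
  proof -
    have "G z + cnj (G w) = (G z - G w) + of_real (2 * Re (G w))" by (simp add: complex_eq_iff)
    then have "cmod (G z + cnj (G w)) \<le> D + 2 * Re (G w)" unfolding D_def
      by (metis norm_triangle_ineq norm_of_real abs_of_nonneg pos[OF w] less_imp_le mult_nonneg_nonneg zero_le_numeral)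
    then show ?thesis using r0 by (intro mult_left_mono)
  qed
  finally have D_le: "D \<le> r * (D + 2 * Re (G w))" .
  then have 1: "D * (1 - r) \<le> r * (2 * Re (G w))" by (simp add: algebra_simps)
  have cp: "0 < (cmod (z + cnj w))\<^sup>2" using szw by simp
  have "r\<^sup>2 = ((cmod (z + cnj w))\<^sup>2 - 4 * Re z * Re w) / (cmod (z + cnj w))\<^sup>2"
    using key[of z w] by (simp add: r_def \<xi>_def norm_divide power_divide)
  then have r2: "1 - r\<^sup>2 = 4 * Re z * Re w / (cmod (z + cnj w))\<^sup>2"
    using cp by (simp only: diff_divide_distrib) simp
  have "1 - r\<^sup>2 = (1 - r) * (1 + r)" by (simp add: power2_eq_square algebra_simps)
  also have "\<dots> \<le> (1 - r) * 2" using r0 by (intro mult_left_mono) auto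
  finally have r3: "2 * Re z * Re w / (cmod (z + cnj w))\<^sup>2 \<le> 1 - r" using r2 by simp
  have p: "0 < 2 * Re z * Re w / (cmod (z + cnj w))\<^sup>2" using z w szw by simp
  have gw: "0 < Re (G w)" by (rule pos[OF w])
  have "D \<le> r * (2 * Re (G w)) / (1 - r)" using 1 r0 by (simp add: pos_le_divide_eq)
  also have "\<dots> \<le> 2 * Re (G w) / (1 - r)"
    using r0 gw by (intro divide_right_mono) (auto intro: mult_left_le_one_le)
  also have "\<dots> \<le> 2 * Re (G w) / (2 * Re z * Re w / (cmod (z + cnj w))\<^sup>2)"
    using r3 p gw r0 by (intro divide_left_mono mult_pos_pos) auto
  finally show ?thesis by (simp add: D_def)
qed

text \<open>
  The Julia-Caratheodory theorem at infinity, in the form of a covering statement. Let \<open>c\<close> be the infimum of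
  \<open>Re (F z) / Re z\<close>. Then \<open>F z - c * z\<close> has nonnegative real part, and that part is small relative to
  \<open>Re w\<close> at a suitable \<open>w\<close>; by Schwarz-Pick \<open>F z - c * z\<close> is then small compared with \<open>z\<close> on the disk
  around \<open>x / c\<close> of radius \<open>x / (2 * c)\<close>, for large \<open>x\<close>. There \<open>F\<close> is a perturbation of multiplication
  by \<open>c\<close>, and Brouwer's theorem solves \<open>F z = x\<close>.
\<close>

lemma Julia_Caratheodory_covering:
  fixes F :: "complex \<Rightarrow> complex"
  assumes F: "F holomorphic_on {z. 0 < Re z}" and m: "0 < m"
    and bd: "\<And>z. 0 < Re z \<Longrightarrow> m * Re z \<le> Re (F z)"
  shows "\<exists>c>0. \<exists>X. \<forall>x\<ge>X. \<exists>z. cmod (z - of_real (x / c)) \<le> x / (2 * c) \<and> F z = of_real x"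
proof -
  define c where "c = (INF z\<in>{z. 0 < Re z}. Re (F z) / Re z)"
  have bb: "bdd_below ((\<lambda>z. Re (F z) / Re z) ` {z. 0 < Re z})"
    by (rule bdd_belowI[of _ m]) (auto simp: bd pos_le_divide_eq)
  have ne: "{z. 0 < Re z} \<noteq> {}" by (auto intro!: exI[of _ 1])
  have "m \<le> c" unfolding c_def
    by (rule cINF_greatest[OF ne]) (auto simp: bd pos_le_divide_eq)
  then have c: "0 < c" using m by simp
  have cF: "c * Re z \<le> Re (F z)" if "0 < Re z" for z
    using cINF_lower[OF bb, of z] that by (simp add: c_def[symmetric] pos_le_divide_eq)
  \<comment> \<open>With \<open>e = c / 64\<close> the Schwarz-Pick bound below is \<open>x / 4\<close>; the constant terms take another \<open>x / 4\<close>.\<close>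
  define e where "e = c / 64"
  have e: "0 < e" using c by (simp add: e_def)
  obtain w where w: "0 < Re w" and "Re (F w) / Re w < c + e"
    using cINF_less_iff[OF ne bb, of "c + e"] e by (auto simp: c_def[symmetric])
  then have Fw: "Re (F w) < (c + e) * Re w" by (simp add: pos_divide_less_eq)
  \<comment> \<open>The added constant makes the real part positive, as Schwarz-Pick requires.\<close>
  define G where "G z = F z - of_real c * z + of_real (e * Re w)" for z
  have G: "G holomorphic_on {z. 0 < Re z}" unfolding G_def by (intro holomorphic_intros F)
  have ew: "0 < e * Re w" using e w by simp
  have Gpos: "0 < Re (G z)" if "0 < Re z" for z
    using cF[OF that] ew by (simp add: G_def)
  have Gw: "Re (G w) \<le> 2 * (e * Re w)"
    using Fw by (simp add: G_def algebra_simps)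
  define X where "X = max (2 * c * cmod w) (max (4 * (cmod (G w) + e * Re w)) 1)"
  have "\<exists>z. cmod (z - of_real (x / c)) \<le> x / (2 * c) \<and> F z = of_real x" if x: "X \<le> x" for x
  proof -
    have x0: "0 < x" using x by (simp add: X_def)
    have wx: "cmod w \<le> x / (2 * c)" using x c by (simp add: X_def field_simps)
    have Gx: "cmod (G w) + e * Re w \<le> x / 4" using x by (simp add: X_def)
    let ?B = "cball (of_real (x / c) :: complex) (x / (2 * c))"
    have inB: "x / (2 * c) \<le> Re z \<and> cmod z \<le> 3 * x / (2 * c)" if "z \<in> ?B" for z
    proof -
      have d: "cmod (z - of_real (x / c)) \<le> x / (2 * c)"
        using that by (simp add: dist_norm norm_minus_commute)
      have "\<bar>Re z - x / c\<bar> \<le> x / (2 * c)"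
        using abs_Re_le_cmod[of "z - of_real (x / c)"] d by simp
      moreover have "cmod z \<le> cmod (z - of_real (x / c)) + cmod (of_real (x / c) :: complex)"
        using norm_triangle_ineq[of "z - of_real (x / c)" "of_real (x / c)"] by simp
      moreover have "cmod (of_real (x / c) :: complex) = x / c"
        unfolding norm_of_real using x0 c by simp
      moreover have "x / c - x / (2 * c) = x / (2 * c)" "x / (2 * c) + x / c = 3 * x / (2 * c)"
        using c by (simp_all add: field_simps)
      ultimately show ?thesis using d by linarith
    qed
    have main: "cmod (F z - of_real c * z) \<le> x / 2" if zB: "z \<in> ?B" for z
    proof -
      have rz: "0 < x / (2 * c)" using x0 c by simp
      have z0: "0 < Re z" using inB[OF zB] rz by linarith
      have "cmod (z + cnj w) \<le> cmod z + cmod w" using norm_triangle_ineq[of z "cnj w"] by simp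
      also have "\<dots> \<le> 3 * x / (2 * c) + x / (2 * c)" using inB[OF zB] wx by linarith
      also have "\<dots> = 2 * x / c" using c by (simp add: field_simps)
      finally have zw: "cmod (z + cnj w) \<le> 2 * x / c" .
      have "cmod (G z - G w) \<le> 2 * Re (G w) * (cmod (z + cnj w))\<^sup>2 / (2 * Re z * Re w)"
        by (rule Schwarz_Pick_half_plane[OF G Gpos z0 w])
      also have "\<dots> \<le> 2 * (2 * (e * Re w)) * (2 * x / c)\<^sup>2 / (2 * (x / (2 * c)) * Re w)"
        using Gw zw inB[OF zB] rz w e Gpos[OF w] mult_pos_pos[OF x0 w] c
        by (intro frac_le mult_mono power_mono) auto
      also have "\<dots> = x / 4" using w x0 c by (simp add: e_def power2_eq_square field_simps)
      finally have "cmod (G z - G w) \<le> x / 4" .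
      moreover have "F z - of_real c * z = (G z - G w) + (G w - of_real (e * Re w))"
        by (simp add: G_def)
      then have "cmod (F z - of_real c * z) \<le> cmod (G z - G w) + cmod (G w - of_real (e * Re w))"
        by (metis norm_triangle_ineq)
      moreover have "cmod (G w - of_real (e * Re w)) \<le> cmod (G w) + e * Re w"
        using norm_triangle_ineq4[of "G w" "of_real (e * Re w)"] ew
        unfolding norm_of_real by simp
      ultimately show ?thesis using Gx by linarith
    qed
    \<comment> \<open>Fixed points of \<open>T\<close> are the solutions of \<open>F z = x\<close>.\<close>
    define T where "T z = z - (F z - of_real x) / of_real c" for z
    have "?B \<subseteq> {z. 0 < Re z}"
      using inB x0 c by (force simp: intro: less_le_trans[of 0 "x / (2 * c)"])
    then have "continuous_on ?B F"
      using F holomorphic_on_imp_continuous_on holomorphic_on_subset by blast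
    then have "continuous_on ?B T" unfolding T_def using c by (intro continuous_intros) auto
    moreover have "T \<in> ?B \<rightarrow> ?B"
    proof
      fix z assume zB: "z \<in> ?B"
      have "T z - of_real (x / c) = - (F z - of_real c * z) / of_real c"
        using c by (simp add: T_def field_simps)
      then have "cmod (T z - of_real (x / c)) = cmod (F z - of_real c * z) / c"
        using c by (simp add: norm_divide norm_minus_commute)
      also have "\<dots> \<le> (x / 2) / c" using main[OF zB] c by (intro divide_right_mono) auto
      finally show "T z \<in> ?B" by (simp add: dist_norm norm_minus_commute)
    qed
    ultimately obtain z where z: "z \<in> ?B" "T z = z"
      using brouwer_ball[of "x / (2 * c)" "of_real (x / c)" T] x0 c by auto
    have "F z = of_real x" using z(2) c by (simp add: T_def)
    then show ?thesis using z(1) by (auto simp: dist_norm norm_minus_commute)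
  qed
  then show ?thesis using c by blast
qed

section \<open>Julia's lemma and univalent maps with boundary contact everywhere\<close>

text \<open>
  Julia's inequality: \<open>f\<close> maps each horodisk at \<open>\<eta>\<close> into the horodisk at \<open>\<zeta>\<close> whose parameter is \<open>L\<close> times as
  large. For boundary points it expresses that \<open>f\<close> sends \<open>\<eta>\<close> to \<open>\<zeta>\<close> with angular derivative of modulus at
  most \<open>L\<close>. As a relation between \<open>\<eta>\<close> and \<open>\<zeta>\<close> it is closed.
\<close>

definition julia_pair :: "(complex \<Rightarrow> complex) \<Rightarrow> real \<Rightarrow> complex \<Rightarrow> complex \<Rightarrow> bool" where
  "julia_pair f L \<eta> \<zeta> \<longleftrightarrow> (\<forall>z\<in>unit_disk.
     (cmod (1 - cnj \<zeta> * f z))\<^sup>2 * (1 - (cmod z)\<^sup>2)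
       \<le> L * (cmod (1 - cnj \<eta> * z))\<^sup>2 * (1 - (cmod (f z))\<^sup>2))"

text \<open>
  The Schwarz-Pick inequality between \<open>z\<close> and \<open>w n\<close>, divided by \<open>1 - (cmod (w n))\<^sup>2\<close>, has the asserted
  inequality as its limit.
\<close>

lemma Julia_lemma:
  assumes f: "f holomorphic_on unit_disk" "f ` unit_disk \<subseteq> unit_disk"
    and w: "\<And>n. w n \<in> unit_disk" and lim: "w \<longlonglongrightarrow> \<eta>" "(\<lambda>n. f (w n)) \<longlonglongrightarrow> \<zeta>"
    and le: "\<And>n. 1 - (cmod (f (w n)))\<^sup>2 \<le> L * (1 - (cmod (w n))\<^sup>2)"
  shows "julia_pair f L \<eta> \<zeta>"
  unfolding julia_pair_def
proof
  fix z assume z: "z \<in> unit_disk"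
  have fz: "f z \<in> unit_disk" using f z by blast
  have "(cmod (1 - cnj (f (w n)) * f z))\<^sup>2 * (1 - (cmod z)\<^sup>2)
       \<le> L * (cmod (1 - cnj (w n) * z))\<^sup>2 * (1 - (cmod (f z))\<^sup>2)" for n
  proof -
    have p: "0 < 1 - (cmod (w n))\<^sup>2" using w[of n] by (intro one_minus_norm_sq_pos) simp
    have q: "0 \<le> (cmod (1 - cnj (w n) * z))\<^sup>2 * (1 - (cmod (f z))\<^sup>2)"
      using fz one_minus_norm_sq_pos[of "f z"] by (intro mult_nonneg_nonneg) auto
    have "((cmod (1 - cnj (f (w n)) * f z))\<^sup>2 * (1 - (cmod z)\<^sup>2)) * (1 - (cmod (w n))\<^sup>2)
       \<le> ((cmod (1 - cnj (w n) * z))\<^sup>2 * (1 - (cmod (f z))\<^sup>2)) * (1 - (cmod (f (w n)))\<^sup>2)"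
      using Schwarz_Pick_disk[OF f z w[of n]] by (simp only: mult.assoc)
    also have "\<dots> \<le> ((cmod (1 - cnj (w n) * z))\<^sup>2 * (1 - (cmod (f z))\<^sup>2)) * (L * (1 - (cmod (w n))\<^sup>2))"
      by (rule mult_left_mono[OF le q])
    also have "\<dots> = (L * (cmod (1 - cnj (w n) * z))\<^sup>2 * (1 - (cmod (f z))\<^sup>2)) * (1 - (cmod (w n))\<^sup>2)"
      by (simp only: mult.assoc mult.commute mult.left_commute)
    finally show ?thesis using p by (rule mult_right_le_imp_le)
  qed
  then show "(cmod (1 - cnj \<zeta> * f z))\<^sup>2 * (1 - (cmod z)\<^sup>2)
       \<le> L * (cmod (1 - cnj \<eta> * z))\<^sup>2 * (1 - (cmod (f z))\<^sup>2)"
    by (intro LIMSEQ_le[where X = "\<lambda>n. (cmod (1 - cnj (f (w n)) * f z))\<^sup>2 * (1 - (cmod z)\<^sup>2)"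
            and Y = "\<lambda>n. L * (cmod (1 - cnj (w n) * z))\<^sup>2 * (1 - (cmod (f z))\<^sup>2)"]
        tendsto_intros lim) auto
qed

lemma cmod_one_minus_cnj_mult:
  assumes "cmod \<zeta> = 1"
  shows "cmod (1 - cnj \<zeta> * u) = cmod (\<zeta> - u)"
proof -
  have "\<zeta> * cnj \<zeta> = 1" using assms by (simp add: complex_norm_square[symmetric])
  then have "\<zeta> * (1 - cnj \<zeta> * u) = \<zeta> - u" by (simp add: right_diff_distrib mult.assoc[symmetric])
  moreover have "cmod (\<zeta> * (1 - cnj \<zeta> * u)) = cmod (1 - cnj \<zeta> * u)"
    using assms by (simp only: norm_mult mult_1)
  ultimately show ?thesis by simp
qed

text \<open>
  On the radius to \<open>\<eta>\<close> the right side of Julia's inequality is of second order in \<open>1 - r\<close>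
  and the left side has only one such factor, so \<open>\<zeta>\<close> is the radial limit of \<open>f\<close> at \<open>\<eta>\<close>.
\<close>

lemma julia_pair_radial:
  assumes J: "julia_pair f L \<eta> \<zeta>" and 1: "cmod \<eta> = 1" "cmod \<zeta> = 1"
    and r: "0 \<le> r" "r < 1" and L: "0 \<le> L"
  shows "(cmod (\<zeta> - f (of_real r * \<eta>)))\<^sup>2 \<le> L * (1 - r)"
proof -
  let ?z = "of_real r * \<eta>"
  have z: "?z \<in> unit_disk" "cmod ?z = r" using 1 r by (auto simp: norm_mult)
  have e: "cmod (1 - cnj \<eta> * ?z) = 1 - r"
  proof -
    have "\<eta> - ?z = of_real (1 - r) * \<eta>" by (simp add: algebra_simps)
    then have "cmod (\<eta> - ?z) = \<bar>1 - r\<bar>" using 1 by (metis norm_mult norm_of_real mult.right_neutral)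
    then show ?thesis using 1 r by (simp add: cmod_one_minus_cnj_mult)
  qed
  have "(cmod (\<zeta> - f ?z))\<^sup>2 * (1 - r\<^sup>2) \<le> L * (1 - r)\<^sup>2 * (1 - (cmod (f ?z))\<^sup>2)"
    using J z e 1 unfolding julia_pair_def by (metis cmod_one_minus_cnj_mult)
  also have "\<dots> \<le> L * (1 - r)\<^sup>2 * 1" using L by (intro mult_left_mono) auto
  finally have "(cmod (\<zeta> - f ?z))\<^sup>2 * (1 + r) * (1 - r) \<le> L * (1 - r) * (1 - r)"
    by (simp add: power2_eq_square algebra_simps)
  then have "(cmod (\<zeta> - f ?z))\<^sup>2 * (1 + r) \<le> L * (1 - r)" using r by simp
  moreover have "(cmod (\<zeta> - f ?z))\<^sup>2 * 1 \<le> (cmod (\<zeta> - f ?z))\<^sup>2 * (1 + r)"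
    using r by (intro mult_left_mono) auto
  ultimately show ?thesis by simp
qed

lemma julia_pair_target_unique:
  assumes J: "julia_pair f L \<eta> \<zeta>" "julia_pair f L \<eta> \<zeta>'"
    and 1: "cmod \<eta> = 1" "cmod \<zeta> = 1" "cmod \<zeta>' = 1" and L: "0 \<le> L"
  shows "\<zeta> = \<zeta>'"
proof -
  define r where "r n = 1 - inverse (real (Suc n))" for n
  have r: "0 \<le> r n" "r n < 1" for n by (auto simp: r_def field_simps)
  have rl: "(\<lambda>n. L * (1 - r n)) \<longlonglongrightarrow> 0"
    unfolding r_def using tendsto_mult_left[OF LIMSEQ_inverse_real_of_nat, of L] by simp
  have lim: "(\<lambda>n. f (of_real (r n) * \<eta>)) \<longlonglongrightarrow> \<xi>" if "julia_pair f L \<eta> \<xi>" "cmod \<xi> = 1" for \<xi>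
  proof -
    have "(\<lambda>n. (cmod (\<xi> - f (of_real (r n) * \<eta>)))\<^sup>2) \<longlonglongrightarrow> 0"
      by (rule tendsto_sandwich[OF _ _ tendsto_const rl])
        (auto intro!: always_eventually julia_pair_radial[OF that(1) 1(1) that(2)] r L)
    then have "(\<lambda>n. cmod (\<xi> - f (of_real (r n) * \<eta>))) \<longlonglongrightarrow> 0"
      using tendsto_real_sqrt by fastforce
    then have "(\<lambda>n. cmod (f (of_real (r n) * \<eta>) - \<xi>)) \<longlonglongrightarrow> 0"
      by (simp add: norm_minus_commute)
    then show ?thesis by (simp only: tendsto_norm_zero_iff LIM_zero_iff)
  qed
  show ?thesis using LIMSEQ_unique[OF lim lim] J 1 by blast
qed

text \<open>
  Cayley maps send \<open>\<eta>\<close> and \<open>\<zeta>\<close> to infinity. Julia's inequality becomes \<open>Re v \<le> L * Re (F v)\<close>, which is the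
  hypothesis of \<open>Julia_Caratheodory_covering\<close>; the value \<open>x\<close> of \<open>F\<close> corresponds to the point
  \<open>\<zeta> * (x - 1) / (x + 1)\<close> of the radius to \<open>\<zeta>\<close>.
\<close>

lemma julia_pair_covers_radius:
  assumes f: "f holomorphic_on unit_disk" "f ` unit_disk \<subseteq> unit_disk"
    and J: "julia_pair f L \<eta> \<zeta>" and 1: "cmod \<eta> = 1" "cmod \<zeta> = 1" and L: "0 < L"
  shows "\<exists>K X. \<forall>x\<ge>X. \<exists>z\<in>unit_disk. f z = \<zeta> * of_real ((x - 1) / (x + 1)) \<and> cmod (z - \<eta>) \<le> K / x"
proof -
  define C :: "complex \<Rightarrow> complex" where "C v = (v - 1) / (v + 1)" for v
  define F where "F v = (1 + cnj \<zeta> * f (\<eta> * C v)) / (1 - cnj \<zeta> * f (\<eta> * C v))" for v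
  have v1: "v + 1 \<noteq> 0" if "0 < Re v" for v :: complex
    using that by (auto simp: complex_eq_iff)
  have ReC: "Re v * (cmod (1 - C v))\<^sup>2 = 1 - (cmod (C v))\<^sup>2" if "0 < Re v" for v
  proof -
    have "1 - C v = 2 / (v + 1)" using v1[OF that] by (simp add: C_def field_simps)
    then have A: "(cmod (1 - C v))\<^sup>2 = 4 / (cmod (v + 1))\<^sup>2" by (simp add: norm_divide power_divide)
    have "(cmod (v + 1))\<^sup>2 - (cmod (v - 1))\<^sup>2 = 4 * Re v"
      unfolding cmod_power2 by (simp add: power2_eq_square algebra_simps)
    then have "(cmod (C v))\<^sup>2 = ((cmod (v + 1))\<^sup>2 - 4 * Re v) / (cmod (v + 1))\<^sup>2"
      by (simp add: C_def norm_divide power_divide)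
    moreover have "0 < (cmod (v + 1))\<^sup>2" using v1[OF that] by simp
    ultimately have "1 - (cmod (C v))\<^sup>2 = 4 * Re v / (cmod (v + 1))\<^sup>2"
      by (simp only: diff_divide_distrib) simp
    with A show ?thesis by simp
  qed
  have C1: "cmod (C v) < 1" if "0 < Re v" for v
  proof -
    have "1 - C v = 2 / (v + 1)" using v1[OF that] by (simp add: C_def field_simps)
    then have "0 < (cmod (1 - C v))\<^sup>2" using v1[OF that] by simp
    then have "0 < 1 - (cmod (C v))\<^sup>2" using ReC[OF that] that by (metis mult_pos_pos)
    then show ?thesis by (simp add: abs_square_less_1)
  qed
  have D: "\<eta> * C v \<in> unit_disk" if "0 < Re v" for v using C1[OF that] 1 by (simp add: norm_mult)
  have fD: "cmod (f (\<eta> * C v)) < 1" if "0 < Re v" for v using D[OF that] f(2) by force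
  have nz: "1 - cnj \<zeta> * f (\<eta> * C v) \<noteq> 0" if "0 < Re v" for v
    using moebius_denominator_nonzero[OF fD[OF that], of \<zeta>] 1 by simp
  have holC: "(\<lambda>v. \<eta> * C v) holomorphic_on {v. 0 < Re v}"
    unfolding C_def by (intro holomorphic_intros) (use v1 in auto)
  have "(f \<circ> (\<lambda>v. \<eta> * C v)) holomorphic_on {v. 0 < Re v}"
    by (rule holomorphic_on_compose_gen[OF holC f(1)]) (use D in auto)
  then have "(\<lambda>v. f (\<eta> * C v)) holomorphic_on {v. 0 < Re v}" by (simp add: o_def)
  then have F: "F holomorphic_on {v. 0 < Re v}"
    unfolding F_def by (intro holomorphic_intros) (use nz in auto)
  have bd: "(1 / L) * Re v \<le> Re (F v)" if v: "0 < Re v" for v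
  proof -
    define u where "u = cnj \<zeta> * f (\<eta> * C v)"
    have "Re (F v) = Re ((1 + u) * cnj (1 - u)) / (cmod (1 - u))\<^sup>2"
      unfolding F_def u_def[symmetric] complex_div_cnj[of _ "1 - u"]
      by (simp only: Re_divide_of_real of_real_power[symmetric])
    also have "Re ((1 + u) * cnj (1 - u)) = 1 - (cmod u)\<^sup>2"
      unfolding cmod_power2 by (simp add: power2_eq_square algebra_simps)
    also have "cmod u = cmod (f (\<eta> * C v))" using 1 by (simp add: u_def norm_mult)
    finally have ReF: "Re (F v) = (1 - (cmod (f (\<eta> * C v)))\<^sup>2) / (cmod (1 - u))\<^sup>2" .
    have u0: "0 < (cmod (1 - u))\<^sup>2" using nz[OF v] by (simp add: u_def)
    have "cnj \<eta> * (\<eta> * C v) = C v"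
      using 1 by (simp add: mult.assoc[symmetric] complex_norm_square[symmetric] mult.commute[of "cnj \<eta>"])
    then have "(cmod (1 - u))\<^sup>2 * (1 - (cmod (\<eta> * C v))\<^sup>2)
        \<le> L * (cmod (1 - C v))\<^sup>2 * (1 - (cmod (f (\<eta> * C v)))\<^sup>2)"
      using J D[OF v] unfolding julia_pair_def u_def by metis
    also have "(cmod (\<eta> * C v)) = cmod (C v)" using 1 by (simp add: norm_mult)
    finally have "(cmod (1 - u))\<^sup>2 * Re v * (cmod (1 - C v))\<^sup>2
        \<le> L * (1 - (cmod (f (\<eta> * C v)))\<^sup>2) * (cmod (1 - C v))\<^sup>2"
      unfolding ReC[OF v, symmetric] by (simp add: mult_ac)
    moreover have "0 < (cmod (1 - C v))\<^sup>2" using C1[OF v] by auto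
    ultimately have "(cmod (1 - u))\<^sup>2 * Re v \<le> L * (1 - (cmod (f (\<eta> * C v)))\<^sup>2)"
      by (rule mult_right_le_imp_le)
    then show ?thesis unfolding ReF using L u0 by (simp add: divide_simps mult_ac)
  qed
  obtain c X where c: "0 < c"
    and X: "\<And>x. x \<ge> X \<Longrightarrow> \<exists>v. cmod (v - of_real (x / c)) \<le> x / (2 * c) \<and> F v = of_real x"
    using Julia_Caratheodory_covering[OF F _ bd] L by (metis divide_pos_pos zero_less_one)
  show ?thesis
  proof (intro exI allI impI)
    fix x assume x: "max X 1 \<le> x"
    obtain v where v: "cmod (v - of_real (x / c)) \<le> x / (2 * c)" "F v = of_real x"
      using X[of x] x by auto
    have "\<bar>Re v - x / c\<bar> \<le> x / (2 * c)"
      using abs_Re_le_cmod[of "v - of_real (x / c)"] v(1) by simp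
    moreover have "x / c - x / (2 * c) = x / (2 * c)" using c by (simp add: field_simps)
    ultimately have Rev: "x / (2 * c) \<le> Re v" by linarith
    have xc: "0 < x / (2 * c)" using x c by simp
    have v0: "0 < Re v" using Rev xc by linarith
    define u where "u = cnj \<zeta> * f (\<eta> * C v)"
    have u1: "1 - u \<noteq> 0" using nz[OF v0] by (simp add: u_def)
    have x1: "of_real x + 1 \<noteq> (0::complex)" using x
      by (metis add_pos_pos less_irrefl of_real_1 of_real_add of_real_eq_0_iff max.bounded_iff zero_less_one order_less_le_trans)
    have "1 + u = of_real x * (1 - u)" using v(2) u1 by (simp add: F_def u_def[symmetric] divide_simps)
    then have "u = of_real ((x - 1) / (x + 1))" using x1 by (simp add: field_simps)
    moreover have "\<zeta> * u = f (\<eta> * C v)"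
      using 1 by (simp add: u_def mult.assoc[symmetric] complex_norm_square[symmetric])
    ultimately have "f (\<eta> * C v) = \<zeta> * of_real ((x - 1) / (x + 1))" by metis
    moreover have "cmod (\<eta> * C v - \<eta>) \<le> (4 * c) / x"
    proof -
      have "\<eta> * C v - \<eta> = \<eta> * (- 2 / (v + 1))" using v1[OF v0] by (simp add: C_def field_simps)
      then have "cmod (\<eta> * C v - \<eta>) = 2 / cmod (v + 1)" using 1 by (simp add: norm_mult norm_divide)
      also have "\<dots> \<le> 2 / (x / (2 * c))"
      proof (rule divide_left_mono)
        show "x / (2 * c) \<le> cmod (v + 1)"
          using complex_Re_le_cmod[of "v + 1"] Rev by simp
        then show "0 < cmod (v + 1) * (x / (2 * c))" using xc by (intro mult_pos_pos) linarith+
      qed simp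
      finally show ?thesis by (simp add: field_simps)
    qed
    ultimately show "\<exists>z\<in>unit_disk. f z = \<zeta> * of_real ((x - 1) / (x + 1)) \<and> cmod (z - \<eta>) \<le> (4 * c) / x"
      using D[OF v0] by blast
  qed
qed

text \<open>
  Preimages of one point of the radius to \<open>\<zeta>\<close> exist near \<open>\<eta>\<close> and near \<open>\<eta>'\<close>; by injectivity they coincide.
\<close>

lemma julia_pair_source_unique:
  assumes f: "f holomorphic_on unit_disk" "f ` unit_disk \<subseteq> unit_disk" "inj_on f unit_disk"
    and J: "julia_pair f L \<eta> \<zeta>" "julia_pair f L \<eta>' \<zeta>"
    and 1: "cmod \<eta> = 1" "cmod \<eta>' = 1" "cmod \<zeta> = 1" and L: "0 < L"
  shows "\<eta> = \<eta>'"
proof -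
  obtain K X where K: "\<And>x. x \<ge> X \<Longrightarrow> \<exists>z\<in>unit_disk. f z = \<zeta> * of_real ((x - 1) / (x + 1)) \<and> cmod (z - \<eta>) \<le> K / x"
    using julia_pair_covers_radius[OF f(1,2) J(1) 1(1,3) L] by metis
  obtain K' X' where K': "\<And>x. x \<ge> X' \<Longrightarrow> \<exists>z\<in>unit_disk. f z = \<zeta> * of_real ((x - 1) / (x + 1)) \<and> cmod (z - \<eta>') \<le> K' / x"
    using julia_pair_covers_radius[OF f(1,2) J(2) 1(2,3) L] by metis
  have "cmod (\<eta> - \<eta>') \<le> (K + K') / x" if x: "x \<ge> max X X'" for x
  proof -
    obtain z where z: "z \<in> unit_disk" "f z = \<zeta> * of_real ((x - 1) / (x + 1))" "cmod (z - \<eta>) \<le> K / x"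
      using K[of x] x by auto
    obtain z' where z': "z' \<in> unit_disk" "f z' = \<zeta> * of_real ((x - 1) / (x + 1))" "cmod (z' - \<eta>') \<le> K' / x"
      using K'[of x] x by auto
    have "z = z'" using f(3) z z' by (metis inj_onD)
    then have "cmod (\<eta> - \<eta>') \<le> cmod (z' - \<eta>') + cmod (z - \<eta>)"
      using norm_triangle_ineq4[of "z' - \<eta>'" "z - \<eta>"] by simp
    then show ?thesis using z z' by (simp add: add_divide_distrib)
  qed
  then have "eventually (\<lambda>x. cmod (\<eta> - \<eta>') \<le> (K + K') / x) at_top"
    unfolding eventually_at_top_linorder by blast
  moreover have "((\<lambda>x::real. (K + K') / x) \<longlongrightarrow> 0) at_top"
    by (rule tendsto_divide_0[OF tendsto_const filterlim_at_top_imp_at_infinity[OF filterlim_ident]])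
  ultimately have "cmod (\<eta> - \<eta>') \<le> 0"
    using tendsto_lowerbound by (metis trivial_limit_at_top_linorder)
  then show ?thesis by simp
qed

text \<open>
  If a point were missed, the argument would be continuous and injective on the image, and the circle
  would embed in the line.
\<close>

lemma circle_injection_surjective:
  fixes e :: "complex \<Rightarrow> complex"
  assumes e: "continuous_on (sphere 0 1) e" "e ` sphere 0 1 \<subseteq> sphere 0 1" "inj_on e (sphere 0 1)"
  shows "e ` sphere 0 1 = sphere 0 1"
proof (rule ccontr)
  assume "e ` sphere 0 1 \<noteq> sphere 0 1"
  with e(2) obtain p where "p \<in> sphere 0 1" and pe: "p \<notin> e ` sphere 0 1" by blast
  with pe have p: "cmod p = 1" "p \<notin> e ` sphere 0 1" by simp_all
  have p0: "p \<noteq> 0" using p by auto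
  have e1: "cmod (e x) = 1" if "cmod x = 1" for x
    using subsetD[OF e(2), of "e x"] that by simp
  have np: "- (e x / p) \<notin> \<real>\<^sub>\<le>\<^sub>0" if x: "cmod x = 1" for x
  proof
    assume "- (e x / p) \<in> \<real>\<^sub>\<le>\<^sub>0"
    then obtain t where t: "t \<ge> 0" "e x / p = of_real t"
      by (metis add.inverse_inverse neg_le_0_iff_le nonpos_Reals_cases of_real_minus)
    moreover have "cmod (e x / p) = 1" using e1[OF x] p by (simp add: norm_divide)
    ultimately have "e x / p = 1" by simp
    then show False using p x p0 by auto
  qed
  \<comment> \<open>The branch cut of the argument is placed at the missed point \<open>p\<close>.\<close>
  define g where "g x = Arg (- (e x / p))" for x
  have "continuous_on (sphere 0 1) g"
    unfolding g_def
    by (intro continuous_on_Arg' continuous_intros e) (use np p0 in auto)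
  moreover have "inj_on g (sphere 0 1)"
  proof
    fix x y assume xy: "x \<in> sphere 0 1" "y \<in> sphere 0 1" "g x = g y"
    then have "cmod x = 1" "cmod y = 1" by auto
    then have "cmod (- (e x / p)) = 1" "cmod (- (e y / p)) = 1" using e1 p by (auto simp: norm_divide)
    then have "- (e x / p) = - (e y / p)"
      using xy(3) Arg_eq[of "- (e x / p)"] Arg_eq[of "- (e y / p)"] unfolding g_def
      by (metis norm_zero zero_neq_one)
    then have "e x = e y" using p0 by simp
    then show "x = y" using e(3) xy by (meson inj_onD)
  qed
  ultimately have "DIM(complex) \<le> DIM(real)"
    by (rule no_embedding_sphere_lowdim) simp
  then show False by simp
qed

text \<open>
  Each \<open>\<zeta>\<close> on the circle has exactly one partner \<open>e \<zeta>\<close>, and \<open>e\<close> is continuous because its graph is closed.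
  As a continuous injection of the circle, \<open>e\<close> is onto, so Julia's inequality is available at the
  point \<open>z / cmod z\<close> for every \<open>z\<close>. This bounds \<open>1 - cmod (f z)\<close> by a multiple of \<open>1 - cmod z\<close>, and the
  range of \<open>f\<close> is closed in the disk as well as open.
\<close>

theorem conformal_self_map_onto:
  assumes f: "f holomorphic_on unit_disk" "f ` unit_disk \<subseteq> unit_disk" "inj_on f unit_disk" and L: "0 < L"
    and app: "\<And>\<zeta>. cmod \<zeta> = 1 \<Longrightarrow> \<exists>w. (\<forall>n. w n \<in> unit_disk \<and>
         1 - (cmod (f (w n)))\<^sup>2 \<le> L * (1 - (cmod (w n))\<^sup>2)) \<and> (\<lambda>n. f (w n)) \<longlonglongrightarrow> \<zeta>"
  shows "f ` unit_disk = unit_disk"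
proof -
  have fc: "continuous_on unit_disk f" using f(1) holomorphic_on_imp_continuous_on by blast
  have ex: "\<exists>\<eta>. cmod \<eta> = 1 \<and> julia_pair f L \<eta> \<zeta>" if \<zeta>: "cmod \<zeta> = 1" for \<zeta>
  proof -
    obtain w where w: "\<And>n::nat. w n \<in> unit_disk" "\<And>n. 1 - (cmod (f (w n)))\<^sup>2 \<le> L * (1 - (cmod (w n))\<^sup>2)"
      and lim: "(\<lambda>n. f (w n)) \<longlonglongrightarrow> \<zeta>" using app[OF \<zeta>] by auto
    have "\<forall>n. w n \<in> cball 0 1" using w(1) by (auto simp: less_imp_le)
    then obtain \<eta> s where \<eta>: "\<eta> \<in> cball 0 1" and s: "strict_mono s" "(w \<circ> s) \<longlonglongrightarrow> \<eta>"
      using compact_cball[of "0::complex" 1] unfolding compact_def by blast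
    have lim': "(\<lambda>n. f ((w \<circ> s) n)) \<longlonglongrightarrow> \<zeta>"
      using LIMSEQ_subseq_LIMSEQ[OF lim s(1)] by (simp add: o_def)
    have "cmod \<eta> = 1"
    proof (rule ccontr)
      assume "cmod \<eta> \<noteq> 1"
      then have \<eta>D: "\<eta> \<in> unit_disk" using \<eta> by auto
      then have "isCont f \<eta>" using fc continuous_on_eq_continuous_at[of unit_disk f] by auto
      then have "(\<lambda>n. f ((w \<circ> s) n)) \<longlonglongrightarrow> f \<eta>" using s(2) by (rule isCont_tendsto_compose)
      then have "f \<eta> = \<zeta>" using lim' LIMSEQ_unique by blast
      then show False using \<eta>D f(2) \<zeta> by force
    qed
    moreover have "julia_pair f L \<eta> \<zeta>"
      by (rule Julia_lemma[OF f(1,2) _ s(2) lim']) (use w in auto)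
    ultimately show ?thesis by blast
  qed
  define e where "e \<zeta> = (SOME \<eta>. cmod \<eta> = 1 \<and> julia_pair f L \<eta> \<zeta>)" for \<zeta>
  have e: "cmod (e \<zeta>) = 1" "julia_pair f L (e \<zeta>) \<zeta>" if "cmod \<zeta> = 1" for \<zeta>
    using someI_ex[OF ex[OF that]] by (auto simp: e_def)
  have eq: "\<eta> = e \<zeta>" if "cmod \<zeta> = 1" "cmod \<eta> = 1" "julia_pair f L \<eta> \<zeta>" for \<zeta> \<eta>
    using julia_pair_source_unique[OF f that(3) e(2)[OF that(1)] that(2) e(1)[OF that(1)] that(1) L] .
  have cont: "continuous_on (sphere 0 1) e"
  proof (rule continuous_from_closed_graph[of "sphere 0 1"])
    show "compact (sphere (0::complex) 1)" by simp
    show "e \<in> sphere 0 1 \<rightarrow> sphere 0 1" using e by auto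
    have "(\<lambda>x. (x, e x)) ` sphere 0 1 =
       (sphere 0 1 \<times> sphere 0 1) \<inter> (\<Inter>z\<in>unit_disk. {p. (cmod (1 - cnj (fst p) * f z))\<^sup>2 * (1 - (cmod z)\<^sup>2)
       \<le> L * (cmod (1 - cnj (snd p) * z))\<^sup>2 * (1 - (cmod (f z))\<^sup>2)})" (is "?A = ?B")
    proof
      show "?A \<subseteq> ?B" using e unfolding julia_pair_def by force
      show "?B \<subseteq> ?A"
      proof
        fix p assume p: "p \<in> ?B"
        then have "julia_pair f L (snd p) (fst p)" "cmod (fst p) = 1" "cmod (snd p) = 1"
          unfolding julia_pair_def by auto
        then have "snd p = e (fst p)" using eq by blast
        then have "p = (\<lambda>x. (x, e x)) (fst p)" by (metis prod.collapse)
        moreover have "fst p \<in> sphere 0 1" using \<open>cmod (fst p) = 1\<close> by simp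
        ultimately show "p \<in> ?A" by (rule image_eqI)
      qed
    qed
    moreover have "closed ?B"
      by (intro closed_Int closed_Times closed_INT ballI closed_Collect_le continuous_intros) auto
    ultimately show "closed ((\<lambda>x. (x, e x)) ` sphere 0 1)" by simp
  qed
  have "inj_on e (sphere 0 1)"
    using julia_pair_target_unique e L by (intro inj_onI) (metis less_imp_le mem_sphere_0)
  then have onto: "e ` sphere 0 1 = sphere 0 1"
    by (intro circle_injection_surjective cont) (use e in auto)
  \<comment> \<open>Julia's inequality at the boundary point on the ray through \<open>z\<close>.\<close>
  have bdry: "1 - cmod (f z) \<le> 2 * L * (1 - cmod z)" if z: "z \<in> unit_disk" for z
  proof -
    obtain \<eta> where \<eta>: "cmod \<eta> = 1" "z = of_real (cmod z) * \<eta>"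
    proof (cases "z = 0")
      case True then show ?thesis using that[of 1] by simp
    next
      case False then show ?thesis using that[of "z / of_real (cmod z)"] by (simp add: norm_divide)
    qed
    obtain \<zeta> where \<zeta>: "cmod \<zeta> = 1" "\<eta> = e \<zeta>" using onto \<eta> by force
    have J: "julia_pair f L \<eta> \<zeta>" using e \<zeta> by simp
    have fz: "cmod (f z) < 1" using f(2) z by force
    have e1: "cmod (1 - cnj \<eta> * z) = 1 - cmod z"
    proof -
      have "\<eta> - z = of_real (1 - cmod z) * \<eta>" using \<eta>(2) by (simp add: algebra_simps)
      then have "cmod (\<eta> - z) = \<bar>1 - cmod z\<bar>" using \<eta>(1) by (metis norm_mult norm_of_real mult.right_neutral)
      then show ?thesis using \<eta>(1) z by (simp add: cmod_one_minus_cnj_mult)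
    qed
    have "(1 - cmod (f z))\<^sup>2 * (1 - (cmod z)\<^sup>2) \<le> (cmod (1 - cnj \<zeta> * f z))\<^sup>2 * (1 - (cmod z)\<^sup>2)"
    proof (intro mult_right_mono power_mono)
      show "1 - cmod (f z) \<le> cmod (1 - cnj \<zeta> * f z)"
        using norm_triangle_ineq2[of 1 "cnj \<zeta> * f z"] \<zeta> by (simp add: norm_mult)
    qed (use fz z one_minus_norm_sq_pos[of z] in auto)
    also have "\<dots> \<le> L * (1 - cmod z)\<^sup>2 * (1 - (cmod (f z))\<^sup>2)"
      using J z e1 unfolding julia_pair_def by metis
    finally have "((1 - cmod (f z)) * (1 + cmod z)) * ((1 - cmod (f z)) * (1 - cmod z))
       \<le> (L * (1 - cmod z) * (1 + cmod (f z))) * ((1 - cmod (f z)) * (1 - cmod z))"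
      by (simp add: power2_eq_square algebra_simps)
    moreover have "0 < (1 - cmod (f z)) * (1 - cmod z)" using fz z by simp
    ultimately have a: "(1 - cmod (f z)) * (1 + cmod z) \<le> L * (1 - cmod z) * (1 + cmod (f z))"
      by (rule mult_right_le_imp_le)
    have "1 - cmod (f z) \<le> (1 - cmod (f z)) * (1 + cmod z)"
      using fz mult_left_mono[of 1 "1 + cmod z" "1 - cmod (f z)"] by simp
    also note a
    also have "L * (1 - cmod z) * (1 + cmod (f z)) \<le> L * (1 - cmod z) * 2"
      using fz z L by (intro mult_left_mono mult_nonneg_nonneg) auto
    finally show ?thesis by simp
  qed
  have "closedin (top_of_set unit_disk) (f ` unit_disk)"
    unfolding closedin_limpt
  proof (intro conjI allI impI f(2))
    fix p assume "p islimpt f ` unit_disk \<and> p \<in> unit_disk"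
    then obtain q where q: "\<And>n::nat. q n \<in> f ` unit_disk" "q \<longlonglongrightarrow> p" and p: "cmod p < 1"
      unfolding islimpt_sequential by auto
    have "\<forall>n. \<exists>x\<in>unit_disk. q n = f x" using q(1) by blast
    then obtain z where z: "\<And>n. z n \<in> unit_disk" "\<And>n. q n = f (z n)" by metis
    \<comment> \<open>By \<open>bdry\<close>, preimages of points that are at distance at least \<open>(1 - cmod p) / 2\<close> from the circle have modulus at most \<open>R\<close>.\<close>
    define R where "R = 1 - (1 - cmod p) / (4 * L)"
    have "(\<lambda>n. cmod (q n)) \<longlonglongrightarrow> cmod p" using q(2) by (rule tendsto_norm)
    then have "eventually (\<lambda>n. cmod (q n) < (1 + cmod p) / 2) sequentially"
      by (rule order_tendstoD) (use p in simp)
    then obtain N where N: "\<And>n. n \<ge> N \<Longrightarrow> cmod (q n) < (1 + cmod p) / 2"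
      unfolding eventually_sequentially by blast
    have "z (n + N) \<in> cball 0 R" for n
    proof -
      have "(1 - cmod p) / 2 < 1 - cmod (q (n + N))" using N[of "n + N"] by (simp add: field_simps)
      also have "\<dots> \<le> 2 * L * (1 - cmod (z (n + N)))" using bdry[OF z(1)] z(2) by simp
      finally have "(1 - cmod p) / (4 * L) \<le> 1 - cmod (z (n + N))" using L by (simp add: field_simps)
      then show ?thesis by (simp add: R_def)
    qed
    then obtain \<xi> s where \<xi>: "\<xi> \<in> cball 0 R" and s: "strict_mono s" "((\<lambda>n. z (n + N)) \<circ> s) \<longlonglongrightarrow> \<xi>"
      using compact_cball[of "0::complex" R] unfolding compact_def by metis
    have \<xi>D: "\<xi> \<in> unit_disk"
    proof -
      have "R < 1" using L p by (simp add: R_def)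
      then show ?thesis using \<xi> by simp
    qed
    then have "isCont f \<xi>" using fc continuous_on_eq_continuous_at[of unit_disk f] by auto
    then have "(\<lambda>n. f (((\<lambda>n. z (n + N)) \<circ> s) n)) \<longlonglongrightarrow> f \<xi>" using s(2) by (rule isCont_tendsto_compose)
    moreover have "(\<lambda>n. f (((\<lambda>n. z (n + N)) \<circ> s) n)) = (\<lambda>n. q (n + N)) \<circ> s"
      using z(2) by (auto simp: o_def)
    moreover have "((\<lambda>n. q (n + N)) \<circ> s) \<longlonglongrightarrow> p"
      using LIMSEQ_subseq_LIMSEQ[OF LIMSEQ_ignore_initial_segment[OF q(2)] s(1)] .
    ultimately have "f \<xi> = p" using LIMSEQ_unique by metis
    then show "p \<in> f ` unit_disk" using \<xi>D by blast
  qed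
  moreover have "open (f ` unit_disk)"
    using open_mapping_thm3[OF f(1) _ f(3)] by simp
  then have "openin (top_of_set unit_disk) (f ` unit_disk)"
    using f(2) by (simp add: open_subset)
  moreover have "connected unit_disk" by simp
  ultimately show ?thesis unfolding connected_clopen by (metis ball_eq_empty image_is_empty not_one_le_zero)
qed

section \<open>Change of variables for injective holomorphic maps\<close>

text \<open>
  Cartesian coordinates, in which the Jacobian of a complex map is a determinant.
\<close>

definition to_plane :: "complex \<Rightarrow> real^2" where "to_plane z = vector [Re z, Im z]"
definition of_plane :: "real^2 \<Rightarrow> complex" where "of_plane v = Complex (v $ 1) (v $ 2)"

lemma of_to_plane [simp]: "of_plane (to_plane z) = z" by (simp add: to_plane_def of_plane_def)
lemma to_of_plane [simp]: "to_plane (of_plane v) = v"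
  by (simp add: to_plane_def of_plane_def vec_eq_iff forall_2)

lemma linear_to_plane: "linear to_plane"
  by (rule linearI) (simp_all add: to_plane_def vec_eq_iff forall_2)
lemma linear_of_plane: "linear of_plane"
  by (rule linearI) (simp_all add: of_plane_def complex_eq_iff)

lemma measurable_to_plane [measurable]: "to_plane \<in> borel_measurable borel"
  by (intro borel_measurable_continuous_onI linear_continuous_on linear_conv_bounded_linear[THEN iffD1] linear_to_plane)
lemma measurable_of_plane [measurable]: "of_plane \<in> borel_measurable borel"
  by (intro borel_measurable_continuous_onI linear_continuous_on linear_conv_bounded_linear[THEN iffD1] linear_of_plane)

lemma lborel_to_plane: "distr lborel borel to_plane = lborel"
proof (rule lborel_eqI[symmetric])
  have B: "(Basis :: (real^2) set) = {axis 1 1, axis 2 1}"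
    by (auto simp: Basis_vec_def UNIV_2)
  have ne: "axis 1 1 \<noteq> (axis 2 1 :: real^2)" by (simp add: axis_eq_axis)
  fix l u :: "real^2" assume le: "\<And>b. b \<in> Basis \<Longrightarrow> l \<bullet> b \<le> u \<bullet> b"
  have le': "l $ 1 \<le> u $ 1" "l $ 2 \<le> u $ 2"
    using le[of "axis 1 1"] le[of "axis 2 1"] by (auto simp: B inner_axis)
  have "to_plane -` box l u = box (of_plane l) (of_plane u)"
    by (auto simp: mem_box_cart mem_box Basis_complex_def forall_2 to_plane_def of_plane_def)
  then have "emeasure (distr lborel borel to_plane) (box l u) = emeasure lborel (box (of_plane l) (of_plane u))"
    by (subst emeasure_distr) auto
  also have "\<dots> = (\<Prod>b\<in>Basis. (of_plane u - of_plane l) \<bullet> b)"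
    by (rule emeasure_lborel_box) (use le' in \<open>auto simp: Basis_complex_def of_plane_def\<close>)
  also have "(\<Prod>b\<in>Basis. (of_plane u - of_plane l) \<bullet> b) = (\<Prod>b\<in>Basis. (u - l) \<bullet> b)"
    using ne by (simp add: B Basis_complex_def of_plane_def inner_axis)
  finally show "emeasure (distr lborel borel to_plane) (box l u) = (\<Prod>b\<in>Basis. (u - l) \<bullet> b)" .
qed simp

lemma emeasure_to_plane_image:
  assumes "B \<in> sets borel"
  shows "to_plane ` B \<in> sets borel" "emeasure lborel (to_plane ` B) = emeasure lborel B"
proof -
  have im: "to_plane ` B = of_plane -` B"
    by (auto simp: image_iff intro!: bexI[of _ "of_plane _"])
  show s: "to_plane ` B \<in> sets borel"
    unfolding im using measurable_sets[OF measurable_of_plane assms] by simp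
  have "emeasure lborel (to_plane ` B) = emeasure (distr lborel borel to_plane) (to_plane ` B)"
    by (simp add: lborel_to_plane)
  also have "\<dots> = emeasure lborel (to_plane -` (to_plane ` B))"
    using s by (subst emeasure_distr) auto
  also have "to_plane -` (to_plane ` B) = B"
    by (metis inj_on_inverseI inj_vimage_image_eq of_to_plane)
  finally show "emeasure lborel (to_plane ` B) = emeasure lborel B" .
qed

text \<open>
  The image of a Borel set is its preimage under the continuous inverse map.
\<close>

lemma borel_image_holomorphic_injective:
  assumes V: "open V" and f: "f holomorphic_on V" "inj_on f V" and A: "A \<in> sets borel" "A \<subseteq> V"
  shows "f ` A \<in> sets borel"
proof -
  obtain g where g: "g holomorphic_on f ` V" "\<And>z. z \<in> V \<Longrightarrow> g (f z) = z"
    using holomorphic_has_inverse[OF f(1) V f(2)] by metis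
  have o: "open (f ` V)" using open_mapping_thm3[OF f(1) V f(2)] .
  have "continuous_on (f ` V) g" using g(1) holomorphic_on_imp_continuous_on by blast
  then have "(\<lambda>w. if w \<in> f ` V then g w else 0) \<in> borel_measurable borel"
    using o by (intro borel_measurable_continuous_on_if) auto
  then have "(\<lambda>w. if w \<in> f ` V then g w else 0) -` A \<inter> space borel \<in> sets borel"
    using A by (rule_tac measurable_sets) auto
  moreover have "f ` A = ((\<lambda>w. if w \<in> f ` V then g w else 0) -` A \<inter> space borel) \<inter> f ` V"
    using A g(2) by (auto split: if_splits)
  ultimately show ?thesis using o by (metis borel_open sets.Int)
qed

text \<open>
  The Jacobian determinant of a holomorphic map is \<open>(cmod (deriv f z))\<^sup>2\<close>.
\<close>

lemma emeasure_holomorphic_image: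
  assumes V: "open V" and f: "f holomorphic_on V" "inj_on f V"
    and A: "A \<in> sets borel" "A \<subseteq> V" "bounded A" and K: "\<And>z. z \<in> A \<Longrightarrow> cmod (deriv f z) \<le> K"
  shows "emeasure lborel (f ` A) = (\<integral>\<^sup>+z. indicator A z * ennreal ((cmod (deriv f z))\<^sup>2) \<partial>lborel)"
proof -
  let ?F = "\<lambda>v. to_plane (f (of_plane v))"
  let ?F' = "\<lambda>v h. to_plane (deriv f (of_plane v) * of_plane h)"
  define J where "J = (\<lambda>z. if z \<in> V then (cmod (deriv f z))\<^sup>2 else 0)"
  define G where "G = (\<lambda>v. indicator A (of_plane v) * J (of_plane v))"
  have "continuous_on V (\<lambda>z. (cmod (deriv f z))\<^sup>2)"
    by (intro continuous_intros holomorphic_on_imp_continuous_on holomorphic_deriv f V)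
  then have J [measurable]: "J \<in> borel_measurable borel"
    unfolding J_def using V by (intro borel_measurable_continuous_on_if) auto
  have G [measurable]: "G \<in> borel_measurable borel" unfolding G_def using A(1) by measurable
  have G0: "0 \<le> G v" for v by (simp add: G_def J_def)
  have Gint: "(\<integral>\<^sup>+v. ennreal (G v) \<partial>lborel) = (\<integral>\<^sup>+z. indicator A z * ennreal ((cmod (deriv f z))\<^sup>2) \<partial>lborel)"
  proof -
    have "(\<integral>\<^sup>+v. ennreal (G v) \<partial>lborel) = (\<integral>\<^sup>+v. ennreal (G v) \<partial>distr lborel borel to_plane)"
      by (simp add: lborel_to_plane)
    also have "\<dots> = (\<integral>\<^sup>+z. ennreal (G (to_plane z)) \<partial>lborel)"
      by (subst nn_integral_distr) auto
    also have "\<dots> = (\<integral>\<^sup>+z. indicator A z * ennreal ((cmod (deriv f z))\<^sup>2) \<partial>lborel)"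
      using A(2) by (intro nn_integral_cong) (auto simp: G_def J_def indicator_def)
    finally show ?thesis .
  qed
  have "(\<integral>\<^sup>+z. indicator A z * ennreal ((cmod (deriv f z))\<^sup>2) \<partial>lborel) \<le> (\<integral>\<^sup>+z. ennreal (K\<^sup>2) * indicator A z \<partial>lborel)"
    using K by (intro nn_integral_mono) (auto simp: indicator_def intro!: power_mono)
  also have "\<dots> = ennreal (K\<^sup>2) * emeasure lborel A" using A(1) by (subst nn_integral_cmult_indicator) auto
  also have "\<dots> < \<infinity>" using emeasure_bounded_finite[OF A(3)] by (simp add: ennreal_mult_less_top)
  finally have fin: "(\<integral>\<^sup>+v. ennreal (G v) \<partial>lborel) < \<infinity>" unfolding Gint .
  define r where "r = enn2real (\<integral>\<^sup>+v. ennreal (G v) \<partial>lborel)"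
  have r: "(\<integral>\<^sup>+v. ennreal (G v) \<partial>lborel) = ennreal r" "0 \<le> r" using fin by (auto simp: r_def)
  have "(G has_integral r) UNIV"
    by (rule nn_integral_has_integral[OF G G0 r(1,2)])
  then have "((\<lambda>v. if v \<in> to_plane ` A then (cmod (deriv f (of_plane v)))\<^sup>2 else 0) has_integral r) UNIV"
  proof (rule has_integral_eq[rotated])
    fix v
    have "v \<in> to_plane ` A \<longleftrightarrow> of_plane v \<in> A" by (metis image_iff of_to_plane to_of_plane)
    then show "G v = (if v \<in> to_plane ` A then (cmod (deriv f (of_plane v)))\<^sup>2 else 0)"
      using A(2) by (auto simp: G_def J_def)
  qed
  then have int: "((\<lambda>v. (cmod (deriv f (of_plane v)))\<^sup>2) has_integral r) (to_plane ` A)"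
    by (simp only: has_integral_restrict_UNIV)
  have det: "\<bar>det (matrix (?F' v))\<bar> = (cmod (deriv f (of_plane v)))\<^sup>2" for v
    unfolding cmod_power2
    by (simp add: power2_eq_square det_2 matrix_def to_plane_def of_plane_def axis_def)
  have S: "to_plane ` A \<in> sets lebesgue" using emeasure_to_plane_image(1)[OF A(1)] by simp
  have der: "(?F has_derivative ?F' v) (at v within to_plane ` A)" if "v \<in> to_plane ` A" for v
  proof -
    have "of_plane v \<in> V" using that A(2) by auto
    then have "(f has_field_derivative deriv f (of_plane v)) (at (of_plane v))"
      using holomorphic_derivI[OF f(1) V] by blast
    then have "(f has_derivative (*) (deriv f (of_plane v))) (at (of_plane v))"
      by (simp add: has_field_derivative_def)
    then have "(f has_derivative (*) (deriv f (of_plane v))) (at (of_plane v) within of_plane ` (to_plane ` A))"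
      by (rule has_derivative_at_withinI)
    then have "((\<lambda>v. f (of_plane v)) has_derivative (\<lambda>h. deriv f (of_plane v) * of_plane h)) (at v within to_plane ` A)"
      using has_derivative_in_compose[OF linear_imp_has_derivative[OF linear_of_plane]] by blast
    from bounded_linear.has_derivative[OF linear_conv_bounded_linear[THEN iffD1, OF linear_to_plane] this]
    show ?thesis .
  qed
  have inj: "inj_on ?F (to_plane ` A)"
    using inj_on_subset[OF f(2) A(2)] by (intro inj_onI) (metis image_iff inj_on_def of_to_plane)
  have "?F ` (to_plane ` A) \<in> lmeasurable \<and> measure lebesgue (?F ` (to_plane ` A)) = r"
    using has_measure_differentiable_image[OF S der inj] int unfolding det by blast
  moreover have "?F ` (to_plane ` A) = to_plane ` (f ` A)" by (auto simp: image_image)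
  ultimately have m: "to_plane ` (f ` A) \<in> lmeasurable" "measure lebesgue (to_plane ` (f ` A)) = r" by auto
  have bf: "f ` A \<in> sets borel" by (rule borel_image_holomorphic_injective[OF V f A(1,2)])
  have "emeasure lborel (f ` A) = emeasure lebesgue (to_plane ` (f ` A))"
    using emeasure_to_plane_image[OF bf] by simp
  also have "\<dots> = ennreal r" using m
    by (metis emeasure_eq_ennreal_measure fmeasurableD2 infinity_ennreal_def)
  also have "\<dots> = (\<integral>\<^sup>+z. indicator A z * ennreal ((cmod (deriv f z))\<^sup>2) \<partial>lborel)"
    using r(1) Gint by simp
  finally show ?thesis .
qed

text \<open>
  By \<open>emeasure_holomorphic_image\<close> the area on \<open>f ` E\<close> and the image under \<open>f\<close> of the area on \<open>E\<close> with
  density \<open>(cmod (deriv f z))\<^sup>2\<close> are the same measure. The function \<open>f\<close> is replaced by \<open>0\<close> off \<open>V\<close> to make it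
  measurable on the plane.
\<close>

lemma nn_integral_holomorphic_image:
  assumes V: "open V" and f: "f holomorphic_on V" "inj_on f V"
    and E: "E \<in> sets borel" "E \<subseteq> V" "bounded E" and K: "\<And>z. z \<in> E \<Longrightarrow> cmod (deriv f z) \<le> K"
    and G: "G \<in> borel_measurable borel"
  shows "(\<integral>\<^sup>+w. indicator (f ` E) w * G w \<partial>lborel)
       = (\<integral>\<^sup>+z. indicator E z * (ennreal ((cmod (deriv f z))\<^sup>2) * G (f z)) \<partial>lborel)"
proof -
  define F where "F = (\<lambda>z. if z \<in> V then f z else 0)"
  define J where "J = (\<lambda>z. if z \<in> V then (cmod (deriv f z))\<^sup>2 else 0)"
  have "continuous_on V (\<lambda>z. (cmod (deriv f z))\<^sup>2)"
    by (intro continuous_intros holomorphic_on_imp_continuous_on holomorphic_deriv f V)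
  then have J [measurable]: "J \<in> borel_measurable borel"
    unfolding J_def using V by (intro borel_measurable_continuous_on_if) auto
  have F [measurable]: "F \<in> borel_measurable borel"
    unfolding F_def using V f by (intro borel_measurable_continuous_on_if holomorphic_on_imp_continuous_on) auto
  note [measurable] = G E(1) borel_image_holomorphic_injective[OF V f E(1,2)]
  let ?M = "density lborel (\<lambda>z. indicator E z * ennreal (J z))"
  have "density lborel (indicator (f ` E)) = distr ?M borel F"
  proof (rule measure_eqI)
    fix B :: "complex set" assume "B \<in> sets (density lborel (indicator (f ` E)))"
    then have B [measurable]: "B \<in> sets borel" by simp
    define A where "A = E \<inter> (F -` B \<inter> space borel)"
    have A: "A \<in> sets borel" unfolding A_def by (intro sets.Int E measurable_sets[OF F B])
    have AE: "A \<subseteq> E" by (auto simp: A_def)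
    have fA: "f ` A = f ` E \<inter> B" using E(2) by (auto simp: A_def F_def)
    have "emeasure (density lborel (indicator (f ` E))) B = emeasure lborel (f ` A)"
      unfolding fA by (subst emeasure_density) (auto simp: indicator_inter_arith[symmetric])
    also have "\<dots> = (\<integral>\<^sup>+z. indicator A z * ennreal ((cmod (deriv f z))\<^sup>2) \<partial>lborel)"
      by (rule emeasure_holomorphic_image[OF V f A _ _ K]) (use AE E bounded_subset in auto)
    also have "\<dots> = (\<integral>\<^sup>+z. indicator E z * ennreal (J z) * indicator (F -` B \<inter> space ?M) z \<partial>lborel)"
      using E(2) by (intro nn_integral_cong) (auto simp: A_def J_def indicator_def)
    also have "\<dots> = emeasure (distr ?M borel F) B"
      using measurable_sets[OF F B] by (subst emeasure_distr, simp, simp, subst emeasure_density) auto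
    finally show "emeasure (density lborel (indicator (f ` E))) B = emeasure (distr ?M borel F) B" .
  qed simp
  then have "(\<integral>\<^sup>+w. G w \<partial>density lborel (indicator (f ` E))) = (\<integral>\<^sup>+w. G w \<partial>distr ?M borel F)" by simp
  moreover have "(\<integral>\<^sup>+w. G w \<partial>density lborel (indicator (f ` E))) = (\<integral>\<^sup>+w. indicator (f ` E) w * G w \<partial>lborel)"
    by (subst nn_integral_density) auto
  moreover have "(\<integral>\<^sup>+w. G w \<partial>distr ?M borel F) = (\<integral>\<^sup>+z. indicator E z * ennreal (J z) * G (F z) \<partial>lborel)"
    by (subst nn_integral_distr, simp, simp, subst nn_integral_density) auto
  moreover have "\<dots> = (\<integral>\<^sup>+z. indicator E z * (ennreal ((cmod (deriv f z))\<^sup>2) * G (f z)) \<partial>lborel)"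
    using E(2) by (intro nn_integral_cong) (auto simp: J_def F_def indicator_def)
  ultimately show ?thesis by simp
qed

section \<open>Integration over the disk\<close>

lemma sets_disk_area: "sets disk_area = sets (restrict_space borel unit_disk)"
  by (simp add: disk_area_def cong: sets_restrict_space_cong)

lemma space_disk_area: "space disk_area = unit_disk"
  by (simp add: disk_area_def space_restrict_space)

lemma measurable_disk_area_iff:
  fixes G :: "complex \<Rightarrow> ennreal"
  shows "G \<in> borel_measurable disk_area \<longleftrightarrow> (\<lambda>z. G z * indicator unit_disk z) \<in> borel_measurable borel"
proof -
  have "G \<in> borel_measurable disk_area \<longleftrightarrow> G \<in> borel_measurable (restrict_space borel unit_disk)"
    by (simp only: measurable_cong_sets[OF sets_disk_area refl])
  then show ?thesis by (subst (asm) borel_measurable_restrict_space_iff_ennreal) auto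
qed

lemma measurable_disk_area_borel:
  fixes G :: "complex \<Rightarrow> 'a::topological_space"
  assumes "G \<in> borel_measurable borel" shows "G \<in> borel_measurable disk_area"
proof -
  have "G \<in> borel_measurable (restrict_space borel unit_disk)"
    using assms by (rule measurable_restrict_space1)
  then show ?thesis by (simp cong: measurable_cong_sets add: sets_disk_area)
qed

lemma measurable_disk_area_continuous:
  fixes G :: "complex \<Rightarrow> 'a::topological_space"
  assumes "continuous_on unit_disk G"
  shows "G \<in> borel_measurable disk_area"
proof -
  have "G \<in> borel_measurable (restrict_space borel unit_disk)"
    by (rule borel_measurable_continuous_on_restrict[OF assms])
  then show ?thesis by (simp cong: measurable_cong_sets add: sets_disk_area)
qed

lemma nn_integral_disk_area:
  assumes G: "G \<in> borel_measurable disk_area"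
  shows "(\<integral>\<^sup>+z. G z \<partial>disk_area) = ennreal (1 / pi) * (\<integral>\<^sup>+z. indicator unit_disk z * G z \<partial>lborel)"
proof -
  have G': "(\<lambda>z. G z * indicator unit_disk z) \<in> borel_measurable borel"
    using G measurable_disk_area_iff by blast
  have G'': "G \<in> borel_measurable (restrict_space lborel unit_disk)"
    using G by (simp add: disk_area_def)
  have "(\<integral>\<^sup>+z. G z \<partial>disk_area) = (\<integral>\<^sup>+z. ennreal (1 / pi) * G z \<partial>restrict_space lborel unit_disk)"
    unfolding disk_area_def by (rule nn_integral_density) (use G'' in auto)
  also have "\<dots> = ennreal (1 / pi) * (\<integral>\<^sup>+z. G z \<partial>restrict_space lborel unit_disk)"
    by (rule nn_integral_cmult[OF G''])
  also have "(\<integral>\<^sup>+z. G z \<partial>restrict_space lborel unit_disk) = (\<integral>\<^sup>+z. G z * indicator unit_disk z \<partial>lborel)"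
    by (subst nn_integral_restrict_space) auto
  finally show ?thesis by (simp add: mult.commute)
qed

definition disk_weight :: "real \<Rightarrow> complex \<Rightarrow> real" where
  "disk_weight \<alpha> z = (1 - (cmod z)\<^sup>2) powr \<alpha>"

lemma disk_weight_nonneg [simp]: "0 \<le> disk_weight \<alpha> z" by (simp add: disk_weight_def)

lemma measurable_disk_weight [measurable]: "disk_weight \<alpha> \<in> borel_measurable borel"
  unfolding disk_weight_def by measurable

lemma weighted_area_density:
  "weighted_area \<alpha> = density disk_area (\<lambda>z. ennreal ((1 + \<alpha>) * disk_weight \<alpha> z))"
  by (simp add: weighted_area_def disk_weight_def)

lemma measurable_weighted_area_iff:
  "G \<in> borel_measurable (weighted_area \<alpha>) \<longleftrightarrow> G \<in> borel_measurable disk_area"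
  by (simp add: weighted_area_def)

lemma nn_integral_weighted_area:
  assumes G: "G \<in> borel_measurable disk_area" and \<alpha>: "-1 < \<alpha>"
  shows "(\<integral>\<^sup>+z. G z \<partial>weighted_area \<alpha>)
    = ennreal (1 + \<alpha>) * (\<integral>\<^sup>+z. ennreal (disk_weight \<alpha> z) * G z \<partial>disk_area)"
proof -
  have w: "(\<lambda>z. ennreal (disk_weight \<alpha> z)) \<in> borel_measurable disk_area"
    by (intro measurable_disk_area_borel) measurable
  have "(\<integral>\<^sup>+z. G z \<partial>weighted_area \<alpha>) = (\<integral>\<^sup>+z. ennreal ((1 + \<alpha>) * disk_weight \<alpha> z) * G z \<partial>disk_area)"
    unfolding weighted_area_density
    by (rule nn_integral_density) (use G in \<open>auto intro!: measurable_disk_area_borel\<close>)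
  also have "\<dots> = (\<integral>\<^sup>+z. ennreal (1 + \<alpha>) * (ennreal (disk_weight \<alpha> z) * G z) \<partial>disk_area)"
    using \<alpha> by (intro nn_integral_cong) (simp add: ennreal_mult mult.assoc)
  also have "\<dots> = ennreal (1 + \<alpha>) * (\<integral>\<^sup>+z. ennreal (disk_weight \<alpha> z) * G z \<partial>disk_area)"
    by (rule nn_integral_cmult) (use w G in measurable)
  finally show ?thesis .
qed

lemma emeasure_disk_area_ball:
  assumes "0 \<le> r" "r \<le> 1"
  shows "emeasure disk_area (ball 0 r) = ennreal (r\<^sup>2)"
proof -
  have s: "ball 0 r \<in> sets disk_area"
    unfolding sets_disk_area using assms by (subst sets_restrict_space_iff) auto
  have "emeasure disk_area (ball 0 r) = (\<integral>\<^sup>+z. indicator (ball 0 r) z \<partial>disk_area)"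
    using s by simp
  also have "\<dots> = ennreal (1 / pi) * (\<integral>\<^sup>+z. indicator unit_disk z * indicator (ball 0 r) z \<partial>lborel)"
    by (rule nn_integral_disk_area) (use s in auto)
  also have "(\<integral>\<^sup>+z. indicator unit_disk z * indicator (ball 0 r) z \<partial>lborel) = (\<integral>\<^sup>+z. indicator (ball 0 r) z \<partial>(lborel::complex measure))"
    using assms by (intro nn_integral_cong) (auto simp: indicator_def)
  also have "\<dots> = ennreal (pi * r\<^sup>2)"
    using assms by (simp add: emeasure_ball unit_ball_vol_2)
  finally show ?thesis by (simp add: ennreal_mult[symmetric])
qed

lemma emeasure_space_disk_area: "emeasure disk_area unit_disk = 1"
  using emeasure_disk_area_ball[of 1] by simp

lemma finite_measure_disk_area: "finite_measure disk_area"
  by (rule finite_measureI) (simp add: space_disk_area emeasure_space_disk_area)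

text \<open>
  A disk of radius \<open>r\<close> about \<open>0\<close> has normalized area \<open>r\<^sup>2\<close>, so \<open>1 - (cmod z)\<^sup>2\<close> is uniformly distributed. This
  serves as polar coordinates for radial integrands.
\<close>

lemma distr_radial: "distr disk_area borel (\<lambda>z. 1 - (cmod z)\<^sup>2) = density lborel (indicator {0..1})"
proof (rule measure_eqI_lessThan)
  have m: "(\<lambda>z. 1 - (cmod z)\<^sup>2) \<in> borel_measurable disk_area"
    by (intro measurable_disk_area_borel) measurable
  have L: "emeasure (distr disk_area borel (\<lambda>z. 1 - (cmod z)\<^sup>2)) {x<..} = ennreal (min 1 (max 0 (1 - x)))" for x
  proof -
    have "emeasure (distr disk_area borel (\<lambda>z. 1 - (cmod z)\<^sup>2)) {x<..}
       = emeasure disk_area ((\<lambda>z. 1 - (cmod z)\<^sup>2) -` {x<..} \<inter> unit_disk)"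
      by (subst emeasure_distr[OF m]) (auto simp: space_disk_area)
    also have "(\<lambda>z. 1 - (cmod z)\<^sup>2) -` {x<..} \<inter> unit_disk = ball 0 (sqrt (min 1 (max 0 (1 - x))))" (is "?l = ?r")
    proof (rule set_eqI)
      fix z :: complex
      have "z \<in> ?r \<longleftrightarrow> sqrt ((cmod z)\<^sup>2) < sqrt (min 1 (max 0 (1 - x)))" by simp
      then have "z \<in> ?r \<longleftrightarrow> (cmod z)\<^sup>2 < min 1 (max 0 (1 - x))" by (simp only: real_sqrt_less_iff)
      moreover have "z \<in> ?l \<longleftrightarrow> x < 1 - (cmod z)\<^sup>2 \<and> (cmod z)\<^sup>2 < 1"
        by (simp add: abs_square_less_1)
      moreover have "x < 1 - t \<and> t < 1 \<longleftrightarrow> t < min 1 (max 0 (1 - x))" if "0 \<le> t" for t :: real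
        using that by (auto simp: min_def max_def)
      ultimately show "z \<in> ?l \<longleftrightarrow> z \<in> ?r" by (metis zero_le_power2)
    qed
    also have "emeasure disk_area \<dots> = ennreal (min 1 (max 0 (1 - x)))"
      by (subst emeasure_disk_area_ball) auto
    finally show ?thesis .
  qed
  show "emeasure (distr disk_area borel (\<lambda>z. 1 - (cmod z)\<^sup>2)) {x<..} < \<infinity>" for x
    unfolding L by simp
  show "emeasure (distr disk_area borel (\<lambda>z. 1 - (cmod z)\<^sup>2)) {x<..} = emeasure (density lborel (indicator {0..1})) {x<..}" for x
  proof -
    have "emeasure (density lborel (indicator {0..1})) {x<..} = (\<integral>\<^sup>+t. indicator {0..1} t * indicator {x<..} t \<partial>lborel)"
      by (subst emeasure_density) auto
    also have "\<dots> = (\<integral>\<^sup>+t. indicator ({0..1} \<inter> {x<..}) t \<partial>lborel)"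
      by (simp add: indicator_inter_arith)
    also have "{0..1} \<inter> {x<..} = (if x < 0 then {0..1} else {x<..1})" by auto
    also have "(\<integral>\<^sup>+t. indicator \<dots> t \<partial>lborel) = ennreal (min 1 (max 0 (1 - x)))"
      by (cases "x < 0"; cases "x \<le> 1") (auto simp: max_def min_def)
    finally show ?thesis using L by simp
  qed
qed simp_all

lemma nn_integral_disk_area_radial:
  assumes F: "F \<in> borel_measurable borel"
  shows "(\<integral>\<^sup>+z. F (1 - (cmod z)\<^sup>2) \<partial>disk_area) = (\<integral>\<^sup>+s. indicator {0..1} s * F s \<partial>lborel)"
proof -
  have m: "(\<lambda>z. 1 - (cmod z)\<^sup>2) \<in> borel_measurable disk_area"
    by (intro measurable_disk_area_borel) measurable
  have "(\<integral>\<^sup>+z. F (1 - (cmod z)\<^sup>2) \<partial>disk_area) = (\<integral>\<^sup>+s. F s \<partial>distr disk_area borel (\<lambda>z. 1 - (cmod z)\<^sup>2))"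
    by (subst nn_integral_distr) (use m F in auto)
  also have "\<dots> = (\<integral>\<^sup>+s. indicator {0..1} s * F s \<partial>lborel)"
    unfolding distr_radial by (rule nn_integral_density) (use F in auto)
  finally show ?thesis .
qed

lemma emeasure_weighted_area_disk:
  assumes "-1 < \<alpha>"
  shows "emeasure (weighted_area \<alpha>) unit_disk = 1"
proof -
  have s: "unit_disk \<in> sets (weighted_area \<alpha>)" using sets.top[of "weighted_area \<alpha>"] by (simp add: space_weighted_area)
  have "emeasure (weighted_area \<alpha>) unit_disk = (\<integral>\<^sup>+z. indicator unit_disk z \<partial>weighted_area \<alpha>)"
    using s by simp
  also have "\<dots> = (\<integral>\<^sup>+z. 1 \<partial>weighted_area \<alpha>)"
    by (intro nn_integral_cong) (auto simp: space_weighted_area indicator_def)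
  also have "\<dots> = ennreal (1 + \<alpha>) * (\<integral>\<^sup>+z. ennreal (disk_weight \<alpha> z) * 1 \<partial>disk_area)"
    by (rule nn_integral_weighted_area) (use assms in auto)
  also have "(\<integral>\<^sup>+z. ennreal (disk_weight \<alpha> z) * 1 \<partial>disk_area) = (\<integral>\<^sup>+s. indicator {0..1} s * ennreal (s powr \<alpha>) \<partial>lborel)"
    unfolding disk_weight_def mult_1_right
    by (rule nn_integral_disk_area_radial[of "\<lambda>s. ennreal (s powr \<alpha>)"]) measurable
  also have "\<dots> = (\<integral>\<^sup>+s. ennreal (indicator {0..1} s * (s powr \<alpha>)) \<partial>lborel)"
    by (intro nn_integral_cong) (auto simp: indicator_def)
  also have "\<dots> = ennreal (1 / (\<alpha> + 1))"
    using nn_integral_has_integral_lebesgue[OF _ has_integral_powr_from_0[OF assms, of 1]] by simp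
  finally show ?thesis using assms by (simp add: ennreal_mult[symmetric] add.commute)
qed

lemma nn_integral_disk_area_rotate:
  assumes c: "cmod c = 1" and G: "G \<in> borel_measurable borel"
  shows "(\<integral>\<^sup>+z. G (c * z) \<partial>disk_area) = (\<integral>\<^sup>+z. G z \<partial>disk_area)"
proof -
  have inj: "inj_on ((*) c) unit_disk" using c by (auto intro!: inj_onI)
  have im: "(*) c ` unit_disk = unit_disk"
  proof
    show "unit_disk \<subseteq> (*) c ` unit_disk"
    proof
      fix z assume "z \<in> unit_disk"
      then have "z / c \<in> unit_disk" "z = c * (z / c)" using c by (auto simp: norm_divide)
      then show "z \<in> (*) c ` unit_disk" by blast
    qed
  qed (use c in \<open>auto simp: norm_mult\<close>)
  have "(\<integral>\<^sup>+w. indicator ((*) c ` unit_disk) w * G w \<partial>lborel)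
     = (\<integral>\<^sup>+z. indicator unit_disk z * (ennreal ((cmod (deriv ((*) c) z))\<^sup>2) * G (c * z)) \<partial>lborel)"
    by (rule nn_integral_holomorphic_image[where V = unit_disk and K = 1])
      (use c inj G in \<open>auto intro!: holomorphic_intros\<close>)
  then have "(\<integral>\<^sup>+w. indicator unit_disk w * G w \<partial>lborel) = (\<integral>\<^sup>+z. indicator unit_disk z * G (c * z) \<partial>lborel)"
    using c by (simp only: im) simp
  moreover have "(\<lambda>z. G (c * z)) \<in> borel_measurable borel" using G by measurable
  ultimately show ?thesis using G by (simp add: nn_integral_disk_area measurable_disk_area_borel)
qed

definition circle_integral :: "(complex \<Rightarrow> ennreal) \<Rightarrow> complex \<Rightarrow> ennreal" where
  "circle_integral G z = (\<integral>\<^sup>+\<theta>. indicator {0..2*pi} \<theta> * G (cis \<theta> * z) \<partial>lborel)"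

text \<open>
  Averaging over rotations does not change an integral over the disk. With the mean value property this gives
  area estimates for holomorphic functions without polar coordinates.
\<close>

lemma nn_integral_circle_integral:
  assumes G: "G \<in> borel_measurable borel"
  shows "(\<integral>\<^sup>+z. circle_integral G z \<partial>disk_area) = ennreal (2 * pi) * (\<integral>\<^sup>+z. G z \<partial>disk_area)"
proof -
  interpret fm: finite_measure disk_area by (rule finite_measure_disk_area)
  interpret pair_sigma_finite "lborel :: real measure" disk_area ..
  have [measurable]: "(\<lambda>z. z) \<in> measurable disk_area borel"
    by (rule measurable_disk_area_borel) simp
  have [measurable]: "cis \<in> borel_measurable borel"
    by (intro borel_measurable_continuous_onI continuous_intros)
  note [measurable] = G
  have "(\<lambda>p. indicator {0..2*pi} (fst p) * G (cis (fst p) * snd p)) \<in> borel_measurable (lborel \<Otimes>\<^sub>M disk_area)"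
  proof -
    have [measurable]: "(\<lambda>p. snd p) \<in> measurable ((lborel::real measure) \<Otimes>\<^sub>M disk_area) borel"
      using measurable_comp[OF measurable_snd[of "lborel::real measure" disk_area] \<open>(\<lambda>z. z) \<in> measurable disk_area borel\<close>]
      by (simp add: o_def)
    show ?thesis by measurable
  qed
  then have "(\<integral>\<^sup>+z. circle_integral G z \<partial>disk_area)
     = (\<integral>\<^sup>+\<theta>. (\<integral>\<^sup>+z. indicator {0..2*pi} \<theta> * G (cis \<theta> * z) \<partial>disk_area) \<partial>lborel)"
    unfolding circle_integral_def by (intro Fubini') (simp add: case_prod_beta)
  also have "\<dots> = (\<integral>\<^sup>+\<theta>. (\<integral>\<^sup>+z. G z \<partial>disk_area) * indicator {0..2*pi} (\<theta>::real) \<partial>lborel)"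
  proof (rule nn_integral_cong)
    fix \<theta> :: real
    have "(\<lambda>z. G (cis \<theta> * z)) \<in> borel_measurable disk_area"
      by (rule measurable_disk_area_borel) measurable
    then have "(\<integral>\<^sup>+z. indicator {0..2*pi} \<theta> * G (cis \<theta> * z) \<partial>disk_area)
      = indicator {0..2*pi} \<theta> * (\<integral>\<^sup>+z. G (cis \<theta> * z) \<partial>disk_area)"
      by (rule nn_integral_cmult)
    then show "(\<integral>\<^sup>+z. indicator {0..2*pi} \<theta> * G (cis \<theta> * z) \<partial>disk_area)
      = (\<integral>\<^sup>+z. G z \<partial>disk_area) * indicator {0..2*pi} \<theta>"
      using nn_integral_disk_area_rotate[OF norm_cis G] by (simp add: mult.commute)
  qed
  also have "\<dots> = (\<integral>\<^sup>+z. G z \<partial>disk_area) * ennreal (2 * pi)"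
    by (subst nn_integral_cmult_indicator) auto
  finally show ?thesis by (simp add: mult.commute)
qed

text \<open>
  Cauchy's integral formula for \<open>h (\<xi> * z)\<close> on the unit circle. The radius \<open>R\<close> in the proof lies beyond \<open>1\<close>,
  so that this function of \<open>\<xi>\<close> is continuous on the closed disk.
\<close>

lemma circle_mean_value:
  assumes h: "h holomorphic_on unit_disk" and z: "z \<in> unit_disk"
  shows "((\<lambda>\<theta>. h (cis \<theta> * z)) has_integral of_real (2 * pi) * h 0) {0..2*pi}"
proof -
  define R where "R = (if z = 0 then 2 else 1 / cmod z)"
  have R: "1 < R" and zR: "cmod (\<xi> * z) < 1" if "cmod \<xi> < R" for \<xi>
    using z that by (auto simp: R_def norm_mult field_simps split: if_splits)
  have R1: "1 < R" using z by (auto simp: R_def)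
  define g where "g = (\<lambda>\<xi>. h (\<xi> * z))"
  have "(h \<circ> (\<lambda>\<xi>. \<xi> * z)) holomorphic_on ball 0 R"
    by (rule holomorphic_on_compose_gen[OF _ h]) (use zR in \<open>auto intro!: holomorphic_intros\<close>)
  then have g: "g holomorphic_on ball 0 R" by (simp add: g_def o_def)
  have "((\<lambda>u. g u / (u - 0)) has_contour_integral (2 * of_real pi * \<i>) * g 0) (circlepath 0 1)"
  proof (rule Cauchy_integral_circlepath)
    show "continuous_on (cball 0 1) g"
      using g R1 by (intro holomorphic_on_imp_continuous_on holomorphic_on_subset[OF g]) auto
    show "g holomorphic_on ball 0 1" using R1 by (intro holomorphic_on_subset[OF g]) auto
  qed simp
  then have "((\<lambda>t. g (0 + 1 * cis t) / (0 + 1 * cis t) * 1 * \<i> * cis t) has_integral (2 * of_real pi * \<i>) * g 0) {0..2*pi}"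
    unfolding circlepath_def by (subst (asm) has_contour_integral_part_circlepath_iff) auto
  then have "((\<lambda>t. \<i> * g (cis t)) has_integral \<i> * (of_real (2 * pi) * g 0)) {0..2*pi}"
    by (simp add: mult_ac)
  then have "((\<lambda>t. (- \<i>) * (\<i> * g (cis t))) has_integral (- \<i>) * (\<i> * (of_real (2 * pi) * g 0))) {0..2*pi}"
    by (rule has_integral_mult_right)
  then show ?thesis by (simp add: g_def mult.assoc[symmetric])
qed

lemma circle_integral_real_part:
  assumes h: "h holomorphic_on unit_disk" and z: "z \<in> unit_disk" and pos: "\<And>z. z \<in> unit_disk \<Longrightarrow> 0 \<le> Re (h z)"
  shows "circle_integral (\<lambda>u. ennreal (Re (h u))) z = ennreal (2 * pi * Re (h 0))"
proof -
  have D: "cis \<theta> * z \<in> unit_disk" for \<theta> using z by (simp add: norm_mult)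
  have "((\<lambda>\<theta>. Re (h (cis \<theta> * z))) has_integral Re (of_real (2 * pi) * h 0)) {0..2*pi}"
    using has_integral_Re[OF circle_mean_value[OF h z]] by simp
  then have "(\<integral>\<^sup>+\<theta>. indicator {0..2*pi} \<theta> * ennreal (Re (h (cis \<theta> * z))) \<partial>lborel) = ennreal (Re (of_real (2 * pi) * h 0))"
    using nn_integral_has_integral_lebesgue[of "{0..2*pi}" "\<lambda>\<theta>. Re (h (cis \<theta> * z))"] pos D
    by (simp add: ennreal_mult'' ennreal_indicator)
  then show ?thesis by (simp add: circle_integral_def)
qed

lemma circle_integral_square_ge:
  assumes h: "h holomorphic_on unit_disk" and z: "z \<in> unit_disk"
  shows "ennreal (2 * pi * (cmod (h 0))\<^sup>2) \<le> circle_integral (\<lambda>u. ennreal ((cmod (h u))\<^sup>2)) z"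
proof -
  have D: "cis \<theta> * z \<in> unit_disk" for \<theta> using z by (simp add: norm_mult)
  have h2: "(\<lambda>u. (h u)\<^sup>2) holomorphic_on unit_disk" by (intro holomorphic_intros h)
  have c: "continuous_on {0..2*pi} (\<lambda>\<theta>. h (cis \<theta> * z))"
    by (intro continuous_on_compose2[OF holomorphic_on_imp_continuous_on[OF h]] continuous_intros) (use D in auto)
  then have "(\<lambda>\<theta>. (cmod (h (cis \<theta> * z)))\<^sup>2) integrable_on {0..2*pi}"
    by (intro integrable_continuous_interval continuous_intros)
  then obtain I where I: "((\<lambda>\<theta>. (cmod (h (cis \<theta> * z)))\<^sup>2) has_integral I) {0..2*pi}" by auto
  have "cmod (integral {0..2*pi} (\<lambda>\<theta>. (h (cis \<theta> * z))\<^sup>2)) \<le> integral {0..2*pi} (\<lambda>\<theta>. (cmod (h (cis \<theta> * z)))\<^sup>2)"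
    by (rule Henstock_Kurzweil_Integration.integral_norm_bound_integral)
      (use circle_mean_value[OF h2 z] I in \<open>auto simp: norm_power\<close>)
  then have "cmod (of_real (2 * pi) * (h 0)\<^sup>2) \<le> I"
    by (simp only: integral_unique[OF circle_mean_value[OF h2 z]] integral_unique[OF I])
  then have "2 * pi * (cmod (h 0))\<^sup>2 \<le> I" by (simp add: norm_mult norm_power)
  moreover have "(\<integral>\<^sup>+\<theta>. indicator {0..2*pi} \<theta> * ennreal ((cmod (h (cis \<theta> * z)))\<^sup>2) \<partial>lborel) = ennreal I"
    using nn_integral_has_integral_lebesgue[OF _ I] by (simp add: ennreal_mult'' ennreal_indicator)
  ultimately show ?thesis by (simp add: circle_integral_def ennreal_leI)
qed

lemma circle_integral_cong:
  assumes "\<And>u. u \<in> unit_disk \<Longrightarrow> cmod u = cmod z \<Longrightarrow> G u = H u" and "z \<in> unit_disk"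
  shows "circle_integral G z = circle_integral H z"
  unfolding circle_integral_def using assms by (intro nn_integral_cong) (auto simp: norm_mult)

text \<open>
  The integral of \<open>(cmod (g w))\<^sup>2\<close> over a circle about \<open>c\<close> is at least \<open>2 * pi * (cmod (g c))\<^sup>2\<close>, because
  \<open>(g w)\<^sup>2\<close> has the mean value property; averaging over rotations of the disk turns this into an estimate of area
  integrals.
\<close>

lemma area_submean:
  assumes g: "g holomorphic_on ball c s" and s: "0 < s"
  shows "ennreal (pi * s\<^sup>2 * (cmod (g c))\<^sup>2)
    \<le> (\<integral>\<^sup>+w. indicator (ball c s) w * ennreal ((cmod (g w))\<^sup>2) \<partial>lborel)"
proof -
  define f where "f u = c + of_real s * u" for u
  have fim: "f ` unit_disk = ball c s"
  proof
    show "f ` unit_disk \<subseteq> ball c s" using s by (auto simp: f_def dist_norm norm_mult)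
    show "ball c s \<subseteq> f ` unit_disk"
    proof
      fix w assume "w \<in> ball c s"
      then have "(w - c) / of_real s \<in> unit_disk" "w = f ((w - c) / of_real s)"
        using s by (auto simp: f_def dist_norm norm_divide norm_minus_commute)
      then show "w \<in> f ` unit_disk" by blast
    qed
  qed
  have f: "f holomorphic_on unit_disk" unfolding f_def by (intro holomorphic_intros)
  have finj: "inj_on f unit_disk" using s by (auto intro!: inj_onI simp: f_def)
  have df: "deriv f u = of_real s" for u
    unfolding f_def by (rule DERIV_imp_deriv) (auto intro!: derivative_eq_intros)
  have "(g \<circ> f) holomorphic_on unit_disk"
    by (rule holomorphic_on_compose_gen[OF f g]) (simp add: fim)
  then have h: "(\<lambda>u. g (f u)) holomorphic_on unit_disk" by (simp add: o_def)
  define H :: "complex \<Rightarrow> ennreal" where "H u = (if u \<in> unit_disk then ennreal ((cmod (g (f u)))\<^sup>2) else 0)" for u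
  define G :: "complex \<Rightarrow> ennreal" where "G w = (if w \<in> ball c s then ennreal ((cmod (g w))\<^sup>2) else 0)" for w
  have H: "H \<in> borel_measurable borel"
    unfolding H_def
    by (intro borel_measurable_continuous_on_if continuous_on_ennreal continuous_intros
        holomorphic_on_imp_continuous_on[OF h]) auto
  have G: "G \<in> borel_measurable borel"
    unfolding G_def
    by (intro borel_measurable_continuous_on_if continuous_on_ennreal continuous_intros
        holomorphic_on_imp_continuous_on[OF g]) auto
  have "ennreal (2 * pi * (cmod (g c))\<^sup>2) = (\<integral>\<^sup>+z. ennreal (2 * pi * (cmod (g c))\<^sup>2) \<partial>disk_area)"
    by (simp add: space_disk_area emeasure_space_disk_area)
  also have "\<dots> \<le> (\<integral>\<^sup>+z. circle_integral H z \<partial>disk_area)"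
  proof (rule nn_integral_mono)
    fix z assume "z \<in> space disk_area"
    then have z: "z \<in> unit_disk" by (simp add: space_disk_area)
    have "circle_integral H z = circle_integral (\<lambda>u. ennreal ((cmod (g (f u)))\<^sup>2)) z"
      by (rule circle_integral_cong[OF _ z]) (simp add: H_def)
    then show "ennreal (2 * pi * (cmod (g c))\<^sup>2) \<le> circle_integral H z"
      using circle_integral_square_ge[OF h z] by (simp add: f_def)
  qed
  also have "\<dots> = ennreal (2 * pi) * (\<integral>\<^sup>+z. H z \<partial>disk_area)"
    by (rule nn_integral_circle_integral[OF H])
  also have "(\<integral>\<^sup>+z. H z \<partial>disk_area) = ennreal (1 / pi) * (\<integral>\<^sup>+z. indicator unit_disk z * H z \<partial>lborel)"
    by (rule nn_integral_disk_area[OF measurable_disk_area_borel[OF H]])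
  finally have 1: "ennreal (2 * pi * (cmod (g c))\<^sup>2) \<le> ennreal 2 * (\<integral>\<^sup>+z. indicator unit_disk z * H z \<partial>lborel)"
    by (simp add: mult.assoc[symmetric] ennreal_mult[symmetric])
  have "(\<integral>\<^sup>+w. indicator (f ` unit_disk) w * G w \<partial>lborel)
     = (\<integral>\<^sup>+z. indicator unit_disk z * (ennreal ((cmod (deriv f z))\<^sup>2) * G (f z)) \<partial>lborel)"
    by (rule nn_integral_holomorphic_image[where V = unit_disk and K = s])
      (use s f finj G df in auto)
  also have "\<dots> = (\<integral>\<^sup>+z. ennreal (s\<^sup>2) * (indicator unit_disk z * H z) \<partial>lborel)"
  proof (rule nn_integral_cong)
    fix z
    have "z \<in> unit_disk \<Longrightarrow> f z \<in> ball c s" using fim by blast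
    then show "indicator unit_disk z * (ennreal ((cmod (deriv f z))\<^sup>2) * G (f z)) = ennreal (s\<^sup>2) * (indicator unit_disk z * H z)"
      using s by (auto simp: df G_def H_def indicator_def)
  qed
  also have "\<dots> = ennreal (s\<^sup>2) * (\<integral>\<^sup>+z. indicator unit_disk z * H z \<partial>lborel)"
    by (rule nn_integral_cmult) (use H in \<open>auto intro!: borel_measurable_times_ennreal borel_measurable_indicator\<close>)
  finally have 2: "(\<integral>\<^sup>+w. indicator (ball c s) w * ennreal ((cmod (g w))\<^sup>2) \<partial>lborel)
     = ennreal (s\<^sup>2) * (\<integral>\<^sup>+z. indicator unit_disk z * H z \<partial>lborel)"
    unfolding fim
    by (subst nn_integral_cong[where v = "\<lambda>w. indicator (ball c s) w * G w"]) (auto simp: G_def indicator_def)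
  have "ennreal (pi * s\<^sup>2 * (cmod (g c))\<^sup>2) = ennreal (s\<^sup>2 / 2) * ennreal (2 * pi * (cmod (g c))\<^sup>2)"
    by (simp add: ennreal_mult[symmetric] mult_ac)
  also have "\<dots> \<le> ennreal (s\<^sup>2 / 2) * (ennreal 2 * (\<integral>\<^sup>+z. indicator unit_disk z * H z \<partial>lborel))"
    by (rule mult_left_mono[OF 1]) simp
  also have "\<dots> = ennreal (s\<^sup>2) * (\<integral>\<^sup>+z. indicator unit_disk z * H z \<partial>lborel)"
    by (simp add: mult.assoc[symmetric] ennreal_mult[symmetric] del: ennreal_numeral)
  finally show ?thesis unfolding 2 .
qed

text \<open>
  The denominator is at least \<open>d\<close> and at least \<open>s\<close>; the first bound is used for \<open>s \<le> d\<close>, the second for \<open>s \<ge> d\<close>.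
  Convergence at \<open>0\<close> needs \<open>-1 < \<alpha>\<close>, and \<open>\<alpha> < 0\<close> makes the second piece of order \<open>d powr \<alpha>\<close>.
\<close>

lemma powr_max_integral_bound:
  assumes \<alpha>: "-1 < \<alpha>" "\<alpha> < 0" and d: "0 < d" "d \<le> (1::real)"
  shows "(\<integral>\<^sup>+s. indicator {0..1} s * ennreal (s powr \<alpha> / (d + (1 - d) * s)) \<partial>lborel)
    \<le> ennreal ((1 / (1 + \<alpha>) + 1 / (- \<alpha>)) * d powr \<alpha>)"
proof -
  have i1: "((\<lambda>s. s powr \<alpha> / d) has_integral (d powr (\<alpha> + 1) / (\<alpha> + 1)) / d) {0..d}"
    by (rule has_integral_divide[OF has_integral_powr_from_0]) (use \<alpha> d in auto)
  \<comment> \<open>The primitive \<open>s powr \<alpha> / \<alpha>\<close> is negative; its value at \<open>d\<close> dominates.\<close>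
  have i2: "((\<lambda>s. s powr (\<alpha> - 1)) has_integral (1 powr \<alpha> / \<alpha> - d powr \<alpha> / \<alpha>)) {d..1}"
  proof (rule fundamental_theorem_of_calculus[OF d(2)])
    fix s assume "s \<in> {d..1}"
    then have "0 < s" using d by auto
    then have "((\<lambda>s. s powr \<alpha> / \<alpha>) has_real_derivative (\<alpha> * s powr (\<alpha> - 1)) / \<alpha>) (at s within {d..1})"
      by (intro DERIV_subset[OF DERIV_cdivide[OF has_real_derivative_powr]]) auto
    then show "((\<lambda>s. s powr \<alpha> / \<alpha>) has_vector_derivative s powr (\<alpha> - 1)) (at s within {d..1})"
      using \<alpha> by (simp add: has_real_derivative_iff_has_vector_derivative)
  qed
  have "(\<integral>\<^sup>+s. indicator {0..1} s * ennreal (s powr \<alpha> / (d + (1 - d) * s)) \<partial>lborel)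
     \<le> (\<integral>\<^sup>+s. ennreal (indicator {0..d} s * (s powr \<alpha> / d)) + ennreal (indicator {d..1} s * s powr (\<alpha> - 1)) \<partial>lborel)"
  proof (rule nn_integral_mono)
    fix s :: real
    have a: "s powr \<alpha> / (d + (1 - d) * s) \<le> s powr \<alpha> / d" if "0 \<le> s"
      using d that by (intro divide_left_mono mult_pos_pos add_pos_nonneg) auto
    have b: "s powr \<alpha> / (d + (1 - d) * s) \<le> s powr (\<alpha> - 1)" if "d \<le> s" "s \<le> 1"
    proof -
      have "0 \<le> d * (1 - s)" using d that by simp
      then have "s \<le> d + (1 - d) * s" by (simp add: algebra_simps)
      then have "s powr \<alpha> / (d + (1 - d) * s) \<le> s powr \<alpha> / s"
        using d that by (intro divide_left_mono mult_pos_pos) auto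
      also have "\<dots> = s powr (\<alpha> - 1)" using d that by (simp add: powr_diff)
      finally show ?thesis .
    qed
    show "indicator {0..1} s * ennreal (s powr \<alpha> / (d + (1 - d) * s))
      \<le> ennreal (indicator {0..d} s * (s powr \<alpha> / d)) + ennreal (indicator {d..1} s * s powr (\<alpha> - 1))"
    proof (cases "0 \<le> s \<and> s \<le> 1")
      case True
      show ?thesis
      proof (cases "s \<le> d")
        case le: True
        then have "ennreal (s powr \<alpha> / (d + (1 - d) * s)) \<le> ennreal (indicator {0..d} s * (s powr \<alpha> / d)) + 0"
          using a True by (auto intro: ennreal_leI)
        also have "\<dots> \<le> ennreal (indicator {0..d} s * (s powr \<alpha> / d)) + ennreal (indicator {d..1} s * s powr (\<alpha> - 1))"
          by (rule add_left_mono) simp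
        finally show ?thesis using True by simp
      next
        case False
        then show ?thesis using b True by (auto simp: indicator_def intro: ennreal_leI)
      qed
    qed (auto simp: indicator_def)
  qed
  also have "\<dots> = (\<integral>\<^sup>+s. ennreal (indicator {0..d} s * (s powr \<alpha> / d)) \<partial>lborel)
      + (\<integral>\<^sup>+s. ennreal (indicator {d..1} s * s powr (\<alpha> - 1)) \<partial>lborel)"
    by (rule nn_integral_add) measurable
  also have "(\<integral>\<^sup>+s. ennreal (indicator {0..d} s * (s powr \<alpha> / d)) \<partial>lborel) = ennreal ((d powr (\<alpha> + 1) / (\<alpha> + 1)) / d)"
    using nn_integral_has_integral_lebesgue[OF _ i1] d by simp
  also have "(\<integral>\<^sup>+s. ennreal (indicator {d..1} s * s powr (\<alpha> - 1)) \<partial>lborel) = ennreal (1 powr \<alpha> / \<alpha> - d powr \<alpha> / \<alpha>)"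
    using nn_integral_has_integral_lebesgue[OF _ i2] by simp
  also have "(d powr (\<alpha> + 1) / (\<alpha> + 1)) / d = d powr \<alpha> / (1 + \<alpha>)"
    using d by (simp add: powr_add add.commute)
  also have "ennreal (d powr \<alpha> / (1 + \<alpha>)) + ennreal (1 powr \<alpha> / \<alpha> - d powr \<alpha> / \<alpha>)
     \<le> ennreal (d powr \<alpha> / (1 + \<alpha>)) + ennreal (- (d powr \<alpha>) / \<alpha>)"
    using \<alpha> by (intro add_left_mono ennreal_leI) (simp add: divide_nonneg_neg divide_le_0_iff)
  also have "\<dots> = ennreal (d powr \<alpha> / (1 + \<alpha>) + (- (d powr \<alpha>) / \<alpha>))"
    using \<alpha> by (subst ennreal_plus) (auto simp: divide_le_0_iff)
  also have "d powr \<alpha> / (1 + \<alpha>) + (- (d powr \<alpha>) / \<alpha>) = (1 / (1 + \<alpha>) + 1 / (- \<alpha>)) * d powr \<alpha>"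
    by (simp add: algebra_simps)
  finally show ?thesis .
qed

text \<open>
  On the circle through \<open>u\<close> the kernel \<open>1 / (cmod (1 - cnj w * u))\<^sup>2\<close> is a multiple of the Poisson kernel, and its
  mean is \<open>1 / (1 - (cmod w)\<^sup>2 * (cmod u)\<^sup>2)\<close>. What remains is a radial integral.
\<close>

lemma kernel_integral_bound:
  assumes \<alpha>: "-1 < \<alpha>" "\<alpha> < 0" and w: "w \<in> unit_disk"
  shows "(\<integral>\<^sup>+u. ennreal (1 / (cmod (1 - cnj w * u))\<^sup>2) \<partial>weighted_area \<alpha>)
    \<le> ennreal ((1 + \<alpha>) * (1 / (1 + \<alpha>) + 1 / (- \<alpha>)) * (1 - (cmod w)\<^sup>2) powr \<alpha>)"
proof -
  define d where "d = 1 - (cmod w)\<^sup>2"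
  have d: "0 < d" "d \<le> 1" using w one_minus_norm_sq_pos[of w] by (auto simp: d_def)
  have nz: "1 - cnj w * u \<noteq> 0" if "u \<in> unit_disk" for u
    using moebius_denominator_nonzero[of u w] that w by auto
  \<comment> \<open>The holomorphic function with the Poisson kernel as its real part; \<open>h 0 = 1\<close>.\<close>
  define h where "h u = (1 + cnj w * u) / (1 - cnj w * u)" for u
  have h: "h holomorphic_on unit_disk" unfolding h_def by (intro holomorphic_intros) (use nz in auto)
  define q where "q u = 1 - (cmod w)\<^sup>2 * (cmod u)\<^sup>2" for u
  have q: "0 < q u" if "u \<in> unit_disk" for u
  proof -
    have "(cmod w)\<^sup>2 * (cmod u)\<^sup>2 \<le> 1 * (cmod u)\<^sup>2" using w by (intro mult_right_mono) (auto simp: abs_square_le_1)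
    also have "\<dots> < 1" using that by (simp add: abs_square_less_1)
    finally show ?thesis by (simp add: q_def)
  qed
  have Reh: "Re (h u) = q u * (1 / (cmod (1 - cnj w * u))\<^sup>2)" for u
  proof -
    have "Re (h u) = Re ((1 + cnj w * u) * cnj (1 - cnj w * u)) / (cmod (1 - cnj w * u))\<^sup>2"
      unfolding h_def complex_div_cnj[of _ "1 - cnj w * u"]
      by (simp only: Re_divide_of_real of_real_power[symmetric])
    also have "Re ((1 + cnj w * u) * cnj (1 - cnj w * u)) = 1 - (cmod (cnj w * u))\<^sup>2"
      unfolding cmod_power2 by (simp add: power2_eq_square algebra_simps)
    finally show ?thesis by (simp add: q_def norm_mult power_mult_distrib)
  qed
  have wt: "(\<lambda>u. ennreal (disk_weight \<alpha> u)) \<in> borel_measurable borel" by measurable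
  define G where "G u = ennreal (disk_weight \<alpha> u) * ennreal (1 / (cmod (1 - cnj w * u))\<^sup>2)" for u
  have km: "(\<lambda>u. ennreal (1 / (cmod (1 - cnj w * u))\<^sup>2)) \<in> borel_measurable borel" by measurable
  have G: "G \<in> borel_measurable borel" unfolding G_def using wt km by measurable
  have "ennreal (2 * pi) * (\<integral>\<^sup>+u. G u \<partial>disk_area) = (\<integral>\<^sup>+z. circle_integral G z \<partial>disk_area)"
    by (rule nn_integral_circle_integral[OF G, symmetric])
  also have "\<dots> = (\<integral>\<^sup>+z. ennreal (2 * pi) * ennreal (disk_weight \<alpha> z / q z) \<partial>disk_area)"
  proof (rule nn_integral_cong)
    fix z assume "z \<in> space disk_area"
    then have z: "z \<in> unit_disk" by (simp add: space_disk_area)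
    have qz: "0 < q z" by (rule q[OF z])
    have "circle_integral G z = circle_integral (\<lambda>u. ennreal (disk_weight \<alpha> z / q z) * ennreal (Re (h u))) z"
    proof (rule circle_integral_cong[OF _ z])
      fix u assume u: "u \<in> unit_disk" "cmod u = cmod z"
      have "q u = q z" "disk_weight \<alpha> u = disk_weight \<alpha> z" using u by (simp_all add: q_def disk_weight_def)
      then show "G u = ennreal (disk_weight \<alpha> z / q z) * ennreal (Re (h u))"
        using qz by (simp add: G_def Reh ennreal_mult[symmetric])
    qed
    also have "\<dots> = ennreal (disk_weight \<alpha> z / q z) * circle_integral (\<lambda>u. ennreal (Re (h u))) z"
    proof -
      have "continuous_on UNIV (\<lambda>\<theta>. h (cis \<theta> * z))"
        by (intro continuous_on_compose2[OF holomorphic_on_imp_continuous_on[OF h]] continuous_intros)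
          (use z in \<open>auto simp: norm_mult\<close>)
      then have "(\<lambda>\<theta>. h (cis \<theta> * z)) \<in> borel_measurable borel" by (rule borel_measurable_continuous_onI)
      then have "(\<lambda>\<theta>. indicator {0..2*pi} \<theta> * ennreal (Re (h (cis \<theta> * z)))) \<in> borel_measurable lborel" by measurable
      then show ?thesis unfolding circle_integral_def
        by (subst nn_integral_cmult[symmetric]) (auto simp: mult_ac)
    qed
    also have "circle_integral (\<lambda>u. ennreal (Re (h u))) z = ennreal (2 * pi * Re (h 0))"
      by (rule circle_integral_real_part[OF h z]) (use q in \<open>force simp: Reh\<close>)
    finally show "circle_integral G z = ennreal (2 * pi) * ennreal (disk_weight \<alpha> z / q z)"
      by (simp add: h_def mult.commute)
  qed
  also have "\<dots> = ennreal (2 * pi) * (\<integral>\<^sup>+z. ennreal (disk_weight \<alpha> z / q z) \<partial>disk_area)"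
    by (rule nn_integral_cmult) (rule measurable_disk_area_borel, simp add: q_def)
  finally have "(\<integral>\<^sup>+u. G u \<partial>disk_area) = (\<integral>\<^sup>+z. ennreal (disk_weight \<alpha> z / q z) \<partial>disk_area)"
    by (simp add: ennreal_mult_cancel_left)
  also have "\<dots> = (\<integral>\<^sup>+z. ennreal ((1 - (cmod z)\<^sup>2) powr \<alpha> / (d + (1 - d) * (1 - (cmod z)\<^sup>2))) \<partial>disk_area)"
    by (intro nn_integral_cong) (simp add: d_def q_def disk_weight_def algebra_simps)
  also have "\<dots> = (\<integral>\<^sup>+s. indicator {0..1} s * ennreal (s powr \<alpha> / (d + (1 - d) * s)) \<partial>lborel)"
    by (rule nn_integral_disk_area_radial[of "\<lambda>s. ennreal (s powr \<alpha> / (d + (1 - d) * s))"]) measurable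
  also have "\<dots> \<le> ennreal ((1 / (1 + \<alpha>) + 1 / (- \<alpha>)) * d powr \<alpha>)"
    by (rule powr_max_integral_bound[OF \<alpha> d])
  finally have "(\<integral>\<^sup>+u. G u \<partial>disk_area) \<le> ennreal ((1 / (1 + \<alpha>) + 1 / (- \<alpha>)) * d powr \<alpha>)" .
  moreover have "(\<integral>\<^sup>+u. ennreal (1 / (cmod (1 - cnj w * u))\<^sup>2) \<partial>weighted_area \<alpha>) = ennreal (1 + \<alpha>) * (\<integral>\<^sup>+u. G u \<partial>disk_area)"
    unfolding G_def by (rule nn_integral_weighted_area[OF measurable_disk_area_borel[OF km] \<alpha>(1)])
  ultimately have "(\<integral>\<^sup>+u. ennreal (1 / (cmod (1 - cnj w * u))\<^sup>2) \<partial>weighted_area \<alpha>)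
     \<le> ennreal (1 + \<alpha>) * ennreal ((1 / (1 + \<alpha>) + 1 / (- \<alpha>)) * d powr \<alpha>)"
    by (simp add: mult_left_mono)
  also have "\<dots> = ennreal ((1 + \<alpha>) * ((1 / (1 + \<alpha>) + 1 / (- \<alpha>)) * d powr \<alpha>))"
    by (rule ennreal_mult[symmetric])
      (use \<alpha> in \<open>auto intro!: mult_nonneg_nonneg simp del: divide_minus_right intro: add_nonneg_nonneg\<close>)
  finally show ?thesis by (simp only: d_def mult.assoc)
qed

section \<open>The counting function and its measure\<close>

lemma deriv_nonconstant:
  assumes \<phi>: "\<phi> holomorphic_on unit_disk" and nc: "\<not> \<phi> constant_on unit_disk"
  shows "\<exists>z\<in>unit_disk. deriv \<phi> z \<noteq> 0"
proof (rule ccontr)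
  assume "\<not> (\<exists>z\<in>unit_disk. deriv \<phi> z \<noteq> 0)"
  then have d0: "deriv \<phi> z = 0" if "z \<in> unit_disk" for z using that by blast
  have "\<exists>c. \<forall>z\<in>unit_disk. \<phi> z = c"
  proof (rule has_field_derivative_zero_constant)
    fix z assume z: "z \<in> unit_disk"
    then have "(\<phi> has_field_derivative deriv \<phi> z) (at z within unit_disk)"
      using holomorphic_derivI[OF \<phi>] by blast
    then show "(\<phi> has_field_derivative 0) (at z within unit_disk)" using d0[OF z] by simp
  qed simp
  then show False using nc unfolding constant_on_def by blast
qed

text \<open>
  Critical values therefore form a null set, and off them all multiplicities are \<open>1\<close>.
\<close>

lemma countable_critical_points:
  assumes \<phi>: "\<phi> holomorphic_on unit_disk" and nc: "\<not> \<phi> constant_on unit_disk"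
  shows "countable {z \<in> unit_disk. deriv \<phi> z = 0}"
proof (cases "deriv \<phi> constant_on unit_disk")
  case True
  then have "{z \<in> unit_disk. deriv \<phi> z = 0} = {}"
    using deriv_nonconstant[OF \<phi> nc] unfolding constant_on_def by force
  then show ?thesis by (simp only: countable_empty)
next
  case False
  have "unit_disk = (\<Union>n. cball (0::complex) (1 - inverse (real (Suc n))))"
  proof
    show "unit_disk \<subseteq> (\<Union>n. cball (0::complex) (1 - inverse (real (Suc n))))"
    proof
      fix z :: complex assume "z \<in> unit_disk"
      then obtain n where "inverse (real (Suc n)) < 1 - cmod z"
        using reals_Archimedean[of "1 - cmod z"] by auto
      then show "z \<in> (\<Union>n. cball (0::complex) (1 - inverse (real (Suc n))))" by (auto intro!: exI[of _ n])
    qed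
    have "x < 1" if "x \<le> 1 - inverse (real (Suc n))" for x n
      using that inverse_positive_iff_positive[of "real (Suc n)"] by linarith
    then show "(\<Union>n. cball (0::complex) (1 - inverse (real (Suc n)))) \<subseteq> unit_disk"
      by (auto simp del: of_nat_Suc)
  qed
  moreover have "fsigma (\<Union>n. cball (0::complex) (1 - inverse (real (Suc n))))"
    by (rule fsigma.intros) simp
  ultimately have "fsigma (unit_disk :: complex set)" by simp
  then show ?thesis
    by (intro holomorphic_countable_zeros holomorphic_deriv \<phi>) (use False in auto)
qed

lemma zorder_preimage:
  assumes \<phi>: "\<phi> holomorphic_on unit_disk" and nc: "\<not> \<phi> constant_on unit_disk" and z: "z \<in> unit_disk" "\<phi> z = w"
  shows "1 \<le> nat (zorder (\<lambda>\<zeta>. \<phi> \<zeta> - w) z)"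
    and "deriv \<phi> z \<noteq> 0 \<Longrightarrow> nat (zorder (\<lambda>\<zeta>. \<phi> \<zeta> - w) z) = 1"
proof -
  have h: "(\<lambda>\<zeta>. \<phi> \<zeta> - w) holomorphic_on unit_disk" by (intro holomorphic_intros \<phi>)
  have "\<exists>u\<in>unit_disk. \<phi> u - w \<noteq> 0" using nc unfolding constant_on_def by auto
  then have "0 < zorder (\<lambda>\<zeta>. \<phi> \<zeta> - w) z"
    using zorder_exist_zero[OF h _ _ z(1)] z(2) by auto
  then show "1 \<le> nat (zorder (\<lambda>\<zeta>. \<phi> \<zeta> - w) z)" by simp
  assume d: "deriv \<phi> z \<noteq> 0"
  have "deriv (\<lambda>\<zeta>. \<phi> \<zeta> - w) z = deriv \<phi> z"
    using \<phi> z by (subst deriv_diff) (auto intro: holomorphic_on_imp_differentiable_at)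
  then have "zorder (\<lambda>\<zeta>. \<phi> \<zeta> - w) z = 1"
    using d z by (intro zorder_zero_eqI[OF h]) auto
  then show "nat (zorder (\<lambda>\<zeta>. \<phi> \<zeta> - w) z) = 1" by simp
qed

lemma counting_fun_outside: "w \<notin> \<phi> ` unit_disk \<Longrightarrow> counting_fun \<phi> \<alpha> w = 0"
proof -
  assume "w \<notin> \<phi> ` unit_disk"
  then have "{z \<in> unit_disk. \<phi> z = w} = {}" by blast
  then show ?thesis unfolding counting_fun_def by (simp only: infsum_empty)
qed

lemma Schwarz_self_map:
  assumes "\<phi> holomorphic_on unit_disk" "\<phi> ` unit_disk \<subseteq> unit_disk" "\<phi> 0 = 0" "z \<in> unit_disk"
  shows "cmod (\<phi> z) \<le> cmod z"
  using Schwarz_Lemma(1)[of \<phi> z] assms by (auto simp: image_subset_iff)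

lemma disk_weight_antimono:
  assumes "cmod w \<le> cmod z" "cmod z < 1" "\<alpha> < 0"
  shows "disk_weight \<alpha> w \<le> disk_weight \<alpha> z"
proof -
  have "(cmod w)\<^sup>2 \<le> (cmod z)\<^sup>2" using assms by (intro power_mono) auto
  then show ?thesis unfolding disk_weight_def
    using assms one_minus_norm_sq_pos[of z] by (intro powr_mono2') auto
qed

text \<open>
  One preimage \<open>z\<close> of \<open>w\<close> suffices: \<open>cmod w \<le> cmod z\<close> by the Schwarz lemma, and \<open>t powr \<alpha>\<close> decreases in \<open>t\<close>.
\<close>

lemma counting_fun_ge_weight:
  assumes \<phi>: "\<phi> holomorphic_on unit_disk" "\<phi> ` unit_disk \<subseteq> unit_disk" "\<phi> 0 = 0"
    and nc: "\<not> \<phi> constant_on unit_disk" and \<alpha>: "\<alpha> < 0" and w: "w \<in> \<phi> ` unit_disk"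
  shows "ennreal (disk_weight \<alpha> w) \<le> counting_fun \<phi> \<alpha> w"
proof -
  obtain z where z: "z \<in> unit_disk" "\<phi> z = w" using w by blast
  let ?t = "\<lambda>z. of_nat (nat (zorder (\<lambda>\<zeta>. \<phi> \<zeta> - w) z)) * ennreal ((1 - (cmod z)\<^sup>2) powr \<alpha>)"
  have "disk_weight \<alpha> w \<le> disk_weight \<alpha> z"
    using Schwarz_self_map[OF \<phi> z(1)] z \<alpha> by (intro disk_weight_antimono) auto
  then have "ennreal (disk_weight \<alpha> w) \<le> 1 * ennreal ((1 - (cmod z)\<^sup>2) powr \<alpha>)"
    by (simp add: disk_weight_def ennreal_leI)
  also have "\<dots> \<le> ?t z"
    using of_nat_mono[OF zorder_preimage(1)[OF \<phi>(1) nc z], where 'a = ennreal]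
    by (intro mult_right_mono) simp_all
  also have "\<dots> = infsum ?t {z}" by simp
  also have "\<dots> \<le> counting_fun \<phi> \<alpha> w"
    unfolding counting_fun_def
    by (rule infsum_mono_neutral) (use z in \<open>auto intro: nonneg_summable_on_complete\<close>)
  finally show ?thesis .
qed

text \<open>
  Away from the critical points \<open>\<phi>\<close> is locally injective with locally bounded derivative. Countably many such
  balls \<open>V k\<close> cover (Lindeloef), and \<open>E k\<close> is what \<open>V k\<close> adds to its predecessors.
\<close>

lemma injective_pieces:
  assumes \<phi>: "\<phi> holomorphic_on unit_disk" and nc: "\<not> \<phi> constant_on unit_disk"
  obtains V E K where
    "\<And>k::nat. open (V k)" "\<And>k. V k \<subseteq> unit_disk" "\<And>k. inj_on \<phi> (V k)"
    "\<And>k. E k \<in> sets borel" "\<And>k. E k \<subseteq> V k" "disjoint_family E"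
    "(\<Union>k. E k) = {z \<in> unit_disk. deriv \<phi> z \<noteq> 0}" "\<And>k z. z \<in> E k \<Longrightarrow> cmod (deriv \<phi> z) \<le> K k"
proof -
  define D where "D = {z \<in> unit_disk. deriv \<phi> z \<noteq> 0}"
  have cd: "continuous_on unit_disk (deriv \<phi>)"
    by (intro holomorphic_on_imp_continuous_on holomorphic_deriv \<phi>) simp
  define F where "F = {B. open B \<and> B \<subseteq> D \<and> inj_on \<phi> B \<and> (\<exists>K. \<forall>z\<in>B. cmod (deriv \<phi> z) \<le> K)}"
  have "D = unit_disk \<inter> deriv \<phi> -` (- {0})" by (auto simp: D_def)
  then have oD: "open D" using continuous_open_preimage[OF cd, of "- {0}"] by auto
  have cov: "\<exists>B\<in>F. z \<in> B" if z: "z \<in> D" for z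
  proof -
    obtain r where r: "0 < r" "ball z r \<subseteq> unit_disk" "inj_on \<phi> (ball z r)"
      using has_complex_derivative_locally_injective[OF \<phi>, of z] z by (auto simp: D_def)
    obtain s where s: "0 < s" "cball z s \<subseteq> D" using oD z open_contains_cball by blast
    define t where "t = min r s"
    have "compact (deriv \<phi> ` cball z s)"
      using s by (intro compact_continuous_image continuous_on_subset[OF cd]) (auto simp: D_def)
    then obtain K where K: "\<forall>y\<in>deriv \<phi> ` cball z s. norm y \<le> K"
      using compact_imp_bounded bounded_iff by metis
    have "ball z t \<in> F"
      unfolding F_def
    proof (intro CollectI conjI)
      show "ball z t \<subseteq> D" using s by (auto simp: t_def subset_iff)
      show "inj_on \<phi> (ball z t)" by (rule inj_on_subset[OF r(3)]) (auto simp: t_def)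
      show "\<exists>K. \<forall>z\<in>ball z t. cmod (deriv \<phi> z) \<le> K" using K by (intro exI[of _ K]) (auto simp: t_def)
    qed simp
    moreover have "z \<in> ball z t" using r s by (simp add: t_def)
    ultimately show ?thesis by blast
  qed
  obtain F' where F': "F' \<subseteq> F" "countable F'" "\<Union>F' = \<Union>F"
    using Lindelof[of F] unfolding F_def by blast
  have "{} \<in> F" by (simp add: F_def)
  define V where "V = from_nat_into (insert {} F')"
  have VF: "V k \<in> F" for k
  proof -
    have "V k \<in> insert {} F'" unfolding V_def by (rule from_nat_into) simp
    then show ?thesis using F'(1) \<open>{} \<in> F\<close> by (metis insertE subsetD)
  qed
  have "range V = insert {} F'"
    unfolding V_def by (rule range_from_nat_into) (use F' in auto)
  then have UV: "(\<Union>k. V k) = D" using F'(3) cov unfolding F_def by auto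
  define K where "K k = (SOME c. \<forall>z\<in>V k. cmod (deriv \<phi> z) \<le> c)" for k
  have K: "cmod (deriv \<phi> z) \<le> K k" if "z \<in> V k" for k z
  proof -
    have "\<exists>c. \<forall>z\<in>V k. cmod (deriv \<phi> z) \<le> c" using VF[of k] unfolding F_def by simp
    from someI_ex[OF this] show ?thesis using that unfolding K_def by blast
  qed
  show thesis
  proof (rule that[of V "disjointed V" K])
    show "open (V k)" "inj_on \<phi> (V k)" for k using VF[of k] by (auto simp: F_def)
    show "V k \<subseteq> unit_disk" for k using VF[of k] by (auto simp: F_def D_def)
    have "range V \<subseteq> sets borel" using VF by (auto simp: F_def)
    then show "disjointed V k \<in> sets borel" for k
      using sets.range_disjointed_sets[of V borel] by blast
    show "disjointed V k \<subseteq> V k" for k by (rule disjointed_subset)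
    show "disjoint_family (disjointed V)" by (rule disjoint_family_disjointed)
    show "(\<Union>k. disjointed V k) = {z \<in> unit_disk. deriv \<phi> z \<noteq> 0}"
      using UV by (simp add: UN_disjointed_eq D_def)
    show "cmod (deriv \<phi> z) \<le> K k" if "z \<in> disjointed V k" for k z
      by (rule K[OF subsetD[OF disjointed_subset that]])
  qed
qed

lemma infsum_nat_ennreal: "infsum (f :: nat \<Rightarrow> ennreal) UNIV = (\<Sum>k. f k)"
proof -
  have "(f has_sum infsum f UNIV) UNIV" by (intro has_sum_infsum nonneg_summable_on_complete) simp
  then show ?thesis by (rule sums_unique[OF has_sum_imp_sums])
qed

text \<open>
  The part \<open>n k\<close> counts the preimages in the piece \<open>E k\<close>, of which there is at most one, so it is a weight
  composed with a local inverse of \<open>\<phi>\<close>. The exceptional set \<open>C\<close> consists of the critical values. The lemma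
  hands on the pieces with their properties, because measurability and the change of variables both rest on
  them.
\<close>

lemma counting_fun_expansion:
  assumes \<phi>: "\<phi> holomorphic_on unit_disk" and nc: "\<not> \<phi> constant_on unit_disk"
  obtains V E K n C where
    "\<And>k::nat. open (V k)" "\<And>k. V k \<subseteq> unit_disk" "\<And>k. inj_on \<phi> (V k)"
    "\<And>k. E k \<in> sets borel" "\<And>k. E k \<subseteq> V k" "disjoint_family E"
    "(\<Union>k. E k) = {z \<in> unit_disk. deriv \<phi> z \<noteq> 0}" "\<And>k z. z \<in> E k \<Longrightarrow> cmod (deriv \<phi> z) \<le> K k"
    "\<And>k. (n k :: complex \<Rightarrow> ennreal) \<in> borel_measurable borel"
    "\<And>k z. z \<in> E k \<Longrightarrow> n k (\<phi> z) = ennreal (disk_weight \<alpha> z)" "\<And>k w. w \<notin> \<phi> ` E k \<Longrightarrow> n k w = 0"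
    "countable C" "\<And>w. w \<notin> C \<Longrightarrow> counting_fun \<phi> \<alpha> w = (\<Sum>k. n k w)"
proof -
  obtain V E K where V: "\<And>k::nat. open (V k)" "\<And>k. V k \<subseteq> unit_disk" "\<And>k. inj_on \<phi> (V k)"
    and E: "\<And>k. E k \<in> sets borel" "\<And>k. E k \<subseteq> V k" "disjoint_family E"
      "(\<Union>k. E k) = {z \<in> unit_disk. deriv \<phi> z \<noteq> 0}" and K: "\<And>k z. z \<in> E k \<Longrightarrow> cmod (deriv \<phi> z) \<le> K k"
    by (rule injective_pieces[OF \<phi> nc]) (rule that)
  have hol: "\<phi> holomorphic_on V k" for k by (rule holomorphic_on_subset[OF \<phi> V(2)])
  have "\<exists>g. g holomorphic_on \<phi> ` V k \<and> (\<forall>z\<in>V k. g (\<phi> z) = z)" for k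
    using holomorphic_has_inverse[OF hol V(1) V(3)] by metis
  then obtain g where g: "\<And>k. g k holomorphic_on \<phi> ` V k" "\<And>k z. z \<in> V k \<Longrightarrow> g k (\<phi> z) = z" by metis
  have oV: "open (\<phi> ` V k)" for k using open_mapping_thm3[OF hol V(1) V(3)] .
  have bE: "\<phi> ` E k \<in> sets borel" for k
    by (rule borel_image_holomorphic_injective[OF V(1) hol V(3) E(1,2)])
  define n :: "nat \<Rightarrow> complex \<Rightarrow> ennreal"
    where "n k w = indicator (\<phi> ` E k) w * ennreal (disk_weight \<alpha> (if w \<in> \<phi> ` V k then g k w else 0))" for k w
  have n1: "n k \<in> borel_measurable borel" for k
  proof -
    have "(\<lambda>w. if w \<in> \<phi> ` V k then g k w else 0) \<in> borel_measurable borel"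
      using oV g(1) by (intro borel_measurable_continuous_on_if holomorphic_on_imp_continuous_on) auto
    then have "(\<lambda>w. ennreal (disk_weight \<alpha> (if w \<in> \<phi> ` V k then g k w else 0))) \<in> borel_measurable borel"
      by (intro measurable_compose[OF _ measurable_ennreal] measurable_compose[OF _ measurable_disk_weight])
    then show ?thesis unfolding n_def
      by (intro borel_measurable_times_ennreal borel_measurable_indicator bE)
  qed
  have n2: "n k (\<phi> z) = ennreal (disk_weight \<alpha> z)" if "z \<in> E k" for k z
  proof -
    have "z \<in> V k" using that E(2) by blast
    then show ?thesis using that g(2) by (simp add: n_def)
  qed
  have n3: "n k w = 0" if "w \<notin> \<phi> ` E k" for k w using that by (simp add: n_def)
  define C where "C = \<phi> ` {z \<in> unit_disk. deriv \<phi> z = 0}"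
  have C1: "countable C" unfolding C_def by (intro countable_image countable_critical_points \<phi> nc)
  have C2: "counting_fun \<phi> \<alpha> w = (\<Sum>k. n k w)" if w: "w \<notin> C" for w
  proof -
    define P where "P = {z \<in> unit_disk. \<phi> z = w}"
    have P: "\<exists>k. z \<in> E k" if "z \<in> P" for z
      using that w E(4) unfolding P_def C_def by blast
    \<comment> \<open>Each preimage \<open>z\<close> of \<open>w\<close> lies in one piece, and each piece contains at most one preimage.\<close>
    define j where "j z = (SOME k. z \<in> E k)" for z
    have j: "z \<in> E (j z)" if "z \<in> P" for z using someI_ex[OF P[OF that]] by (simp add: j_def)
    have ju: "j z = k" if "z \<in> P" "z \<in> E k" for z k
      using E(3) j[OF that(1)] that(2) unfolding disjoint_family_on_def by blast
    have inj: "inj_on j P"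
    proof
      fix x y assume xy: "x \<in> P" "y \<in> P" "j x = j y"
      then have "x \<in> V (j x)" "y \<in> V (j x)" using j E(2) by fastforce+
      then show "x = y" using V(3) xy unfolding P_def by (auto dest: inj_onD)
    qed
    have "counting_fun \<phi> \<alpha> w = infsum (\<lambda>z. n (j z) w) P"
      unfolding counting_fun_def P_def[symmetric]
    proof (rule infsum_cong)
      fix z assume z: "z \<in> P"
      then have zz: "z \<in> unit_disk" "\<phi> z = w" by (auto simp: P_def)
      have "deriv \<phi> z \<noteq> 0" using w zz unfolding C_def by blast
      then show "of_nat (nat (zorder (\<lambda>\<zeta>. \<phi> \<zeta> - w) z)) * ennreal ((1 - (cmod z)\<^sup>2) powr \<alpha>) = n (j z) w"
        using zorder_preimage(2)[OF \<phi> nc zz] n2[OF j[OF z]] zz(2) by (simp add: disk_weight_def)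
    qed
    also have "\<dots> = infsum (\<lambda>k. n k w) (j ` P)" by (subst infsum_reindex[OF inj]) (simp add: o_def)
    also have "\<dots> = infsum (\<lambda>k. n k w) UNIV"
    proof (rule infsum_cong_neutral)
      fix k assume "k \<in> UNIV - j ` P"
      then have "k \<notin> j ` P" by simp
      have "w \<notin> \<phi> ` E k"
      proof
        assume "w \<in> \<phi> ` E k"
        then obtain z where z: "z \<in> E k" "\<phi> z = w" by blast
        then have "z \<in> P" using E(2) V(2) unfolding P_def by blast
        then show False using ju[OF _ z(1)] \<open>k \<notin> j ` P\<close> by blast
      qed
      then show "n k w = 0" by (rule n3)
    qed auto
    also have "\<dots> = (\<Sum>k. n k w)" by (rule infsum_nat_ennreal)
    finally show ?thesis .
  qed
  show thesis
    by (rule that[of V E K n C]) (rule V E K n1 n2 n3 C1 C2, assumption?)+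
qed

lemma measurable_counting_fun:
  assumes \<phi>: "\<phi> holomorphic_on unit_disk" and nc: "\<not> \<phi> constant_on unit_disk"
  shows "counting_fun \<phi> \<alpha> \<in> borel_measurable borel"
proof -
  obtain V E K n C where V: "\<And>k::nat. open (V k)" "\<And>k. V k \<subseteq> unit_disk" "\<And>k. inj_on \<phi> (V k)"
    and E: "\<And>k. E k \<in> sets borel" "\<And>k. E k \<subseteq> V k" "disjoint_family E"
      "(\<Union>k. E k) = {z \<in> unit_disk. deriv \<phi> z \<noteq> 0}" and K: "\<And>k z. z \<in> E k \<Longrightarrow> cmod (deriv \<phi> z) \<le> K k"
    and n: "\<And>k. (n k :: complex \<Rightarrow> ennreal) \<in> borel_measurable borel"
      "\<And>k z. z \<in> E k \<Longrightarrow> n k (\<phi> z) = ennreal (disk_weight \<alpha> z)" "\<And>k w. w \<notin> \<phi> ` E k \<Longrightarrow> n k w = 0"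
    and C: "countable C" "\<And>w. w \<notin> C \<Longrightarrow> counting_fun \<phi> \<alpha> w = (\<Sum>k. n k w)"
    by (rule counting_fun_expansion[OF \<phi> nc, where \<alpha> = \<alpha>]) (rule that)
  have "(\<lambda>w. \<Sum>k. n k w) \<in> borel_measurable borel" using n(1) by measurable
  then show ?thesis by (rule measurable_discrete_difference[OF _ C(1)]) (use C(2) in auto)
qed

text \<open>
  Change of variables on each piece \<open>E k\<close>, then summation. Critical values form a null set, and at critical points
  the factor \<open>(cmod (deriv \<phi> z))\<^sup>2\<close> vanishes.
\<close>

lemma nn_integral_counting_measure:
  assumes \<phi>: "\<phi> holomorphic_on unit_disk" "\<phi> ` unit_disk \<subseteq> unit_disk" and nc: "\<not> \<phi> constant_on unit_disk"
    and G: "G \<in> borel_measurable borel"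
  shows "(\<integral>\<^sup>+w. G w \<partial>counting_measure \<phi> \<alpha>)
     = (\<integral>\<^sup>+z. ennreal (disk_weight \<alpha> z) * (ennreal ((cmod (deriv \<phi> z))\<^sup>2) * G (\<phi> z)) \<partial>disk_area)"
proof -
  obtain V E K n C where V: "\<And>k::nat. open (V k)" "\<And>k. V k \<subseteq> unit_disk" "\<And>k. inj_on \<phi> (V k)"
    and E: "\<And>k. E k \<in> sets borel" "\<And>k. E k \<subseteq> V k" "disjoint_family E"
      "(\<Union>k. E k) = {z \<in> unit_disk. deriv \<phi> z \<noteq> 0}" and K: "\<And>k z. z \<in> E k \<Longrightarrow> cmod (deriv \<phi> z) \<le> K k"
    and n: "\<And>k. (n k :: complex \<Rightarrow> ennreal) \<in> borel_measurable borel"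
      "\<And>k z. z \<in> E k \<Longrightarrow> n k (\<phi> z) = ennreal (disk_weight \<alpha> z)" "\<And>k w. w \<notin> \<phi> ` E k \<Longrightarrow> n k w = 0"
    and C: "countable C" "\<And>w. w \<notin> C \<Longrightarrow> counting_fun \<phi> \<alpha> w = (\<Sum>k. n k w)"
    by (rule counting_fun_expansion[OF \<phi>(1) nc, where \<alpha> = \<alpha>]) (rule that)
  have hol: "\<phi> holomorphic_on V k" for k by (rule holomorphic_on_subset[OF \<phi>(1) V(2)])
  note N = measurable_counting_fun[OF \<phi>(1) nc, of \<alpha>]
  have aeC: "AE w in lborel. w \<notin> C" using countable_imp_null_set_lborel[OF C(1)] by (rule AE_not_in)
  define H where "H z = ennreal (disk_weight \<alpha> z) * (ennreal ((cmod (deriv \<phi> z))\<^sup>2) * G (\<phi> z))" for z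
  have H: "H \<in> borel_measurable disk_area"
  proof -
    have "\<phi> \<in> borel_measurable disk_area"
      by (intro measurable_disk_area_continuous holomorphic_on_imp_continuous_on \<phi>)
    then have "(\<lambda>z. G (\<phi> z)) \<in> borel_measurable disk_area" using G by (rule measurable_compose)
    moreover have "(\<lambda>z. ennreal ((cmod (deriv \<phi> z))\<^sup>2)) \<in> borel_measurable disk_area"
      by (intro measurable_disk_area_continuous continuous_on_ennreal continuous_intros
          holomorphic_on_imp_continuous_on holomorphic_deriv \<phi>) simp
    moreover have "(\<lambda>z. ennreal (disk_weight \<alpha> z)) \<in> borel_measurable disk_area"
      by (intro measurable_disk_area_borel) measurable
    ultimately show ?thesis unfolding H_def by (intro borel_measurable_times_ennreal)
  qed
  have Hk: "(\<lambda>z. indicator (E k) z * H z) \<in> borel_measurable borel" for k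
  proof -
    have "(\<lambda>z. H z * indicator unit_disk z) \<in> borel_measurable borel"
      using H measurable_disk_area_iff by blast
    then have "(\<lambda>z. indicator (E k) z * (H z * indicator unit_disk z)) \<in> borel_measurable borel"
      by (rule borel_measurable_times_ennreal[OF borel_measurable_indicator[OF E(1)]])
    moreover have "indicator (E k) z * (H z * indicator unit_disk z) = indicator (E k) z * H z" for z
      using order_trans[OF E(2) V(2), of k] by (auto simp: indicator_def)
    ultimately show ?thesis by simp
  qed
  have "(\<integral>\<^sup>+w. G w \<partial>counting_measure \<phi> \<alpha>) = (\<integral>\<^sup>+w. counting_fun \<phi> \<alpha> w * G w \<partial>disk_area)"
    unfolding counting_measure_def
    by (rule nn_integral_density) (use N G in \<open>auto intro: measurable_disk_area_borel\<close>)
  also have "\<dots> = ennreal (1 / pi) * (\<integral>\<^sup>+w. indicator unit_disk w * (counting_fun \<phi> \<alpha> w * G w) \<partial>lborel)"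
    by (rule nn_integral_disk_area[OF measurable_disk_area_borel]) (use N G in \<open>auto intro: borel_measurable_times_ennreal\<close>)
  also have "(\<integral>\<^sup>+w. indicator unit_disk w * (counting_fun \<phi> \<alpha> w * G w) \<partial>lborel)
     = (\<integral>\<^sup>+w. (\<Sum>k. n k w * G w) \<partial>lborel)"
  proof (rule nn_integral_cong_AE, use aeC in eventually_elim)
    fix w assume w: "w \<notin> C"
    have "indicator unit_disk w * counting_fun \<phi> \<alpha> w = counting_fun \<phi> \<alpha> w"
    proof (cases "w \<in> unit_disk")
      case False
      then have "w \<notin> \<phi> ` unit_disk" using \<phi>(2) by blast
      then show ?thesis using counting_fun_outside[of w \<phi> \<alpha>] by simp
    qed simp
    then show "indicator unit_disk w * (counting_fun \<phi> \<alpha> w * G w) = (\<Sum>k. n k w * G w)"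
      using C(2)[OF w] by (simp add: mult.assoc[symmetric])
  qed
  also have "\<dots> = (\<Sum>k. \<integral>\<^sup>+w. n k w * G w \<partial>lborel)"
    by (rule nn_integral_suminf) (use n(1) G in \<open>auto intro!: borel_measurable_times_ennreal\<close>)
  also have "(\<lambda>k. \<integral>\<^sup>+w. n k w * G w \<partial>lborel) = (\<lambda>k. \<integral>\<^sup>+z. indicator (E k) z * H z \<partial>lborel)"
  proof
    fix k
    have "(\<integral>\<^sup>+w. n k w * G w \<partial>lborel) = (\<integral>\<^sup>+w. indicator (\<phi> ` E k) w * (n k w * G w) \<partial>lborel)"
      using n(3) by (intro nn_integral_cong) (auto simp: indicator_def)
    also have "\<dots> = (\<integral>\<^sup>+z. indicator (E k) z * (ennreal ((cmod (deriv \<phi> z))\<^sup>2) * (n k (\<phi> z) * G (\<phi> z))) \<partial>lborel)"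
      by (rule nn_integral_holomorphic_image[OF V(1) hol V(3) E(1,2) _ K])
        (use n(1) G bounded_subset[OF bounded_ball order_trans[OF E(2) V(2)]] in
          \<open>auto intro!: borel_measurable_times_ennreal\<close>)
    also have "\<dots> = (\<integral>\<^sup>+z. indicator (E k) z * H z \<partial>lborel)"
      using n(2) by (intro nn_integral_cong) (auto simp: indicator_def H_def mult_ac)
    finally show "(\<integral>\<^sup>+w. n k w * G w \<partial>lborel) = (\<integral>\<^sup>+z. indicator (E k) z * H z \<partial>lborel)" .
  qed
  also have "(\<Sum>k. \<integral>\<^sup>+z. indicator (E k) z * H z \<partial>lborel) = (\<integral>\<^sup>+z. (\<Sum>k. indicator (E k) z * H z) \<partial>lborel)"
    by (rule nn_integral_suminf[symmetric]) (use Hk in auto)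
  also have "\<dots> = (\<integral>\<^sup>+z. indicator unit_disk z * H z \<partial>lborel)"
  proof (rule nn_integral_cong)
    fix z
    have "(\<Sum>k. indicator (E k) z * H z) = (\<Sum>k. indicator (E k) z) * H z" by simp
    also have "(\<Sum>k. indicator (E k) z) = (indicator (\<Union>k. E k) z :: ennreal)"
      by (rule suminf_indicator[OF E(3)])
    also have "indicator (\<Union>k. E k) z * H z = indicator unit_disk z * H z"
      unfolding E(4) by (auto simp: H_def indicator_def)
    finally show "(\<Sum>k. indicator (E k) z * H z) = indicator unit_disk z * H z" .
  qed
  also have "ennreal (1 / pi) * \<dots> = (\<integral>\<^sup>+z. H z \<partial>disk_area)"
    by (rule nn_integral_disk_area[OF H, symmetric])
  finally show ?thesis by (simp add: H_def)
qed

section \<open>Estimates in the Dirichlet space\<close>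

lemma nn_integral_deriv_dirichlet:
  assumes "f \<in> dirichlet_space \<alpha>"
  shows "(\<integral>\<^sup>+z. ennreal ((cmod (deriv f z))\<^sup>2) \<partial>weighted_area \<alpha>)
     = ennreal (\<integral>z. (cmod (deriv f z))\<^sup>2 \<partial>weighted_area \<alpha>)"
  using assms by (intro nn_integral_eq_integral) (auto simp: dirichlet_space_def)

lemma dirichlet_spaceI:
  assumes f: "f \<in> disk_analytic" and le: "(\<integral>\<^sup>+z. ennreal ((cmod (deriv f z))\<^sup>2) \<partial>weighted_area \<alpha>) \<le> ennreal c"
  shows "f \<in> dirichlet_space \<alpha>"
proof -
  have "integrable (weighted_area \<alpha>) (\<lambda>z. (cmod (deriv f z))\<^sup>2)"
    by (rule integrableI_bounded) (use measurable_deriv[OF f] le in \<open>auto intro: le_less_trans\<close>)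
  then show ?thesis using f by (simp add: dirichlet_space_def)
qed

lemma dirichlet_norm_sq_le:
  assumes f: "f \<in> disk_analytic" and le: "(\<integral>\<^sup>+z. ennreal ((cmod (deriv f z))\<^sup>2) \<partial>weighted_area \<alpha>) \<le> ennreal c"
    and c: "0 \<le> c"
  shows "(dirichlet_norm \<alpha> f)\<^sup>2 \<le> (cmod (f 0))\<^sup>2 + c"
proof -
  have "f \<in> dirichlet_space \<alpha>" by (rule dirichlet_spaceI[OF f le])
  then have "ennreal (\<integral>z. (cmod (deriv f z))\<^sup>2 \<partial>weighted_area \<alpha>) \<le> ennreal c"
    using le nn_integral_deriv_dirichlet by metis
  then show ?thesis using c by (simp add: dirichlet_norm_sq)
qed

lemma nn_integral_deriv_le_norm:
  assumes "f \<in> dirichlet_space \<alpha>"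
  shows "(\<integral>\<^sup>+z. ennreal ((cmod (deriv f z))\<^sup>2) \<partial>weighted_area \<alpha>) \<le> ennreal ((dirichlet_norm \<alpha> f)\<^sup>2)"
  unfolding nn_integral_deriv_dirichlet[OF assms] dirichlet_norm_sq by (intro ennreal_leI) simp

lemma measurable_cmod_sq_holomorphic:
  assumes "g holomorphic_on unit_disk"
  shows "(\<lambda>z. ennreal ((cmod (g z))\<^sup>2)) \<in> borel_measurable disk_area"
  by (intro measurable_disk_area_continuous continuous_on_ennreal continuous_intros
      holomorphic_on_imp_continuous_on assms)

lemma ball_subset_unit_disk:
  assumes "z \<in> unit_disk" "w \<in> ball z ((1 - cmod z) / 2)"
  shows "w \<in> unit_disk" "(1 - cmod z) / 2 \<le> 1 - cmod w" "1 - cmod w \<le> 3 / 2 * (1 - cmod z)"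
proof -
  have "\<bar>cmod w - cmod z\<bar> \<le> cmod (w - z)" by (rule norm_triangle_ineq3)
  also have "\<dots> < (1 - cmod z) / 2" using assms(2) by (simp add: dist_norm norm_minus_commute)
  finally have *: "\<bar>cmod w - cmod z\<bar> < (1 - cmod z) / 2" .
  show "(1 - cmod z) / 2 \<le> 1 - cmod w" using * by (simp add: abs_if field_simps split: if_splits)
  then show "w \<in> unit_disk" using assms(1) by simp
  show "1 - cmod w \<le> 3 / 2 * (1 - cmod z)" using * by (simp add: abs_if field_simps split: if_splits)
qed

text \<open>
  The sub-mean value property on the ball about \<open>z\<close> of radius \<open>(1 - cmod z) / 2\<close>. On it \<open>1 - (cmod w)\<^sup>2\<close> is at
  most \<open>3 * (1 - cmod z)\<close>, so for \<open>\<alpha> < 0\<close> the weight is at least \<open>(3 * (1 - cmod z)) powr \<alpha>\<close>.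
\<close>

lemma weighted_pointwise_bound:
  assumes \<alpha>: "-1 < \<alpha>" "\<alpha> < 0" and g: "g holomorphic_on unit_disk" and z: "z \<in> unit_disk"
    and le: "(\<integral>\<^sup>+u. ennreal ((cmod (g u))\<^sup>2) \<partial>weighted_area \<alpha>) \<le> ennreal (c\<^sup>2)" and c: "0 \<le> c"
  shows "cmod (g z) \<le> 2 * 3 powr (- \<alpha> / 2) / sqrt (1 + \<alpha>) * c * (1 - cmod z) powr (- \<alpha> / 2 - 1)"
proof -
  define \<delta> where "\<delta> = 1 - cmod z"
  have \<delta>: "0 < \<delta>" using z by (simp add: \<delta>_def)
  define s where "s = \<delta> / 2"
  have s: "0 < s" using \<delta> by (simp add: s_def)
  have B: "w \<in> unit_disk" "1 - cmod w \<le> 3 / 2 * \<delta>" if "w \<in> ball z s" for w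
    using ball_subset_unit_disk[OF z, of w] that by (auto simp: s_def \<delta>_def)
  define Q where "Q = (3 * \<delta>) powr (- \<alpha>)"
  have Q: "0 < Q" using \<delta> by (simp add: Q_def)
  \<comment> \<open>The factor \<open>Q\<close> compensates the weight on the ball.\<close>
  have wt: "1 \<le> Q * disk_weight \<alpha> w" if w: "w \<in> ball z s" for w
  proof -
    have w1: "cmod w < 1" using B(1)[OF w] by simp
    have "1 - (cmod w)\<^sup>2 = (1 - cmod w) * (1 + cmod w)" by (simp add: power2_eq_square algebra_simps)
    also have "\<dots> \<le> (3 / 2 * \<delta>) * 2" using B(2)[OF w] w1 \<delta> by (intro mult_mono) auto
    finally have "1 - (cmod w)\<^sup>2 \<le> 3 * \<delta>" by simp
    then have "(3 * \<delta>) powr \<alpha> \<le> disk_weight \<alpha> w"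
      unfolding disk_weight_def using \<alpha> one_minus_norm_sq_pos[OF w1] by (intro powr_mono2') auto
    then have "Q * (3 * \<delta>) powr \<alpha> \<le> Q * disk_weight \<alpha> w" using Q by (intro mult_left_mono) auto
    moreover have "Q * (3 * \<delta>) powr \<alpha> = 1" using \<delta> by (simp add: Q_def powr_add[symmetric])
    ultimately show ?thesis by simp
  qed
  have m: "(\<lambda>z. ennreal ((cmod (g z))\<^sup>2)) \<in> borel_measurable disk_area" by (rule measurable_cmod_sq_holomorphic[OF g])
  have mw: "(\<lambda>z. ennreal (disk_weight \<alpha> z)) \<in> borel_measurable disk_area"
    by (intro measurable_disk_area_borel) measurable
  have mm: "(\<lambda>z. ennreal (disk_weight \<alpha> z) * ennreal ((cmod (g z))\<^sup>2)) \<in> borel_measurable disk_area"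
    by (rule borel_measurable_times_ennreal[OF mw m])
  have mm': "(\<lambda>z. indicator unit_disk z * (ennreal (disk_weight \<alpha> z) * ennreal ((cmod (g z))\<^sup>2))) \<in> borel_measurable lborel"
    using mm[unfolded measurable_disk_area_iff] by (simp add: mult.commute)
  have "ennreal (pi * s\<^sup>2 * (cmod (g z))\<^sup>2) \<le> (\<integral>\<^sup>+w. indicator (ball z s) w * ennreal ((cmod (g w))\<^sup>2) \<partial>lborel)"
    by (rule area_submean[OF _ s]) (use B(1) in \<open>auto intro: holomorphic_on_subset[OF g]\<close>)
  also have "\<dots> \<le> (\<integral>\<^sup>+w. ennreal Q * (indicator unit_disk w * (ennreal (disk_weight \<alpha> w) * ennreal ((cmod (g w))\<^sup>2))) \<partial>lborel)"
  proof (rule nn_integral_mono)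
    fix w
    show "indicator (ball z s) w * ennreal ((cmod (g w))\<^sup>2)
      \<le> ennreal Q * (indicator unit_disk w * (ennreal (disk_weight \<alpha> w) * ennreal ((cmod (g w))\<^sup>2)))"
    proof (cases "w \<in> ball z s")
      case True
      have "1 * (cmod (g w))\<^sup>2 \<le> (Q * disk_weight \<alpha> w) * (cmod (g w))\<^sup>2"
        by (intro mult_right_mono wt True) simp
      then show ?thesis using True B(1)[OF True] Q
        by (simp add: ennreal_mult[symmetric] mult.assoc)
    qed simp
  qed
  also have "\<dots> = ennreal Q * (\<integral>\<^sup>+w. indicator unit_disk w * (ennreal (disk_weight \<alpha> w) * ennreal ((cmod (g w))\<^sup>2)) \<partial>lborel)"
    by (rule nn_integral_cmult[OF mm'])
  also have "(\<integral>\<^sup>+w. indicator unit_disk w * (ennreal (disk_weight \<alpha> w) * ennreal ((cmod (g w))\<^sup>2)) \<partial>lborel)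
     = ennreal pi * (\<integral>\<^sup>+w. ennreal (disk_weight \<alpha> w) * ennreal ((cmod (g w))\<^sup>2) \<partial>disk_area)"
    unfolding nn_integral_disk_area[OF mm] mult.assoc[symmetric] by (simp add: ennreal_mult[symmetric])
  also have "(\<integral>\<^sup>+w. ennreal (disk_weight \<alpha> w) * ennreal ((cmod (g w))\<^sup>2) \<partial>disk_area)
     = ennreal (1 / (1 + \<alpha>)) * (\<integral>\<^sup>+u. ennreal ((cmod (g u))\<^sup>2) \<partial>weighted_area \<alpha>)"
    unfolding nn_integral_weighted_area[OF m \<alpha>(1)] mult.assoc[symmetric]
    using \<alpha> by (simp add: ennreal_mult[symmetric])
  also have "ennreal Q * (ennreal pi * (ennreal (1 / (1 + \<alpha>)) * (\<integral>\<^sup>+u. ennreal ((cmod (g u))\<^sup>2) \<partial>weighted_area \<alpha>)))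
     \<le> ennreal Q * (ennreal pi * (ennreal (1 / (1 + \<alpha>)) * ennreal (c\<^sup>2)))"
    by (intro mult_left_mono le) auto
  also have "\<dots> = ennreal (Q * (pi * (1 / (1 + \<alpha>) * c\<^sup>2)))"
    using \<alpha> Q by (simp add: ennreal_mult[symmetric])
  finally have "pi * s\<^sup>2 * (cmod (g z))\<^sup>2 \<le> Q * (pi * (1 / (1 + \<alpha>) * c\<^sup>2))"
    using \<alpha> Q by (subst (asm) ennreal_le_iff) auto
  then have "pi * (\<delta>\<^sup>2 * (cmod (g z))\<^sup>2) \<le> pi * (4 * Q * c\<^sup>2 / (1 + \<alpha>))"
    by (simp add: s_def power_divide field_simps)
  then have le1: "\<delta>\<^sup>2 * (cmod (g z))\<^sup>2 \<le> 4 * Q * c\<^sup>2 / (1 + \<alpha>)"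
    by (rule mult_left_le_imp_le) simp
  define M where "M = 2 * 3 powr (- \<alpha> / 2) / sqrt (1 + \<alpha>)"
  have "(cmod (g z))\<^sup>2 \<le> (4 * Q * c\<^sup>2 / (1 + \<alpha>)) / \<delta>\<^sup>2"
    using le1 \<delta> by (subst pos_le_divide_eq) (simp_all add: mult.commute[of "(cmod (g z))\<^sup>2"])
  also have "\<dots> = (M * c * \<delta> powr (- \<alpha> / 2 - 1))\<^sup>2"
  proof -
    have "(3 powr (- \<alpha> / 2))\<^sup>2 = 3 powr (- \<alpha>)" by (simp add: power2_eq_square powr_add[symmetric])
    moreover have "(\<delta> powr (- \<alpha> / 2 - 1))\<^sup>2 = \<delta> powr (- \<alpha>) / \<delta>\<^sup>2"
    proof -
      have "(\<delta> powr (- \<alpha> / 2 - 1))\<^sup>2 = \<delta> powr (- \<alpha> - 2)" unfolding power2_eq_square powr_add[symmetric] by simp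
      also have "\<dots> = \<delta> powr (- \<alpha>) / \<delta>\<^sup>2" using \<delta> by (simp add: powr_diff)
      finally show ?thesis .
    qed
    moreover have "(sqrt (1 + \<alpha>))\<^sup>2 = 1 + \<alpha>" using \<alpha> by simp
    moreover have "Q = 3 powr (- \<alpha>) * \<delta> powr (- \<alpha>)" unfolding Q_def by (rule powr_mult)
    ultimately show ?thesis unfolding M_def
      by (simp add: power_mult_distrib power_divide mult_ac del: divide_minus_left)
  qed
  finally have "cmod (g z) \<le> M * c * \<delta> powr (- \<alpha> / 2 - 1)"
    by (rule power2_le_imp_le) (use \<alpha> c in \<open>auto simp: M_def\<close>)
  then show ?thesis by (simp add: M_def \<delta>_def)
qed

text \<open>
  Integration of \<open>weighted_pointwise_bound\<close> for the derivative along the radius. Since \<open>\<alpha> < 0\<close>, the exponent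
  \<open>- \<alpha> / 2 - 1\<close> is integrable up to the boundary.
\<close>

lemma dirichlet_radial_bound:
  assumes \<alpha>: "-1 < \<alpha>" "\<alpha> < 0"
  obtains B where "0 < B" and
    "\<And>f z s. f \<in> dirichlet_space \<alpha> \<Longrightarrow> z \<in> unit_disk \<Longrightarrow> 0 \<le> s \<Longrightarrow> s \<le> 1 \<Longrightarrow>
       cmod (f z - f (of_real s * z)) \<le> B * dirichlet_norm \<alpha> f * (1 - s * cmod z) powr (- \<alpha> / 2)"
proof -
  define M where "M = 2 * 3 powr (- \<alpha> / 2) / sqrt (1 + \<alpha>)"
  have M: "0 < M" using \<alpha> by (simp add: M_def)
  show thesis
  proof (rule that[of "M / (- \<alpha> / 2)"])
    show "0 < M / (- \<alpha> / 2)" using M \<alpha> by (simp add: divide_pos_neg)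
    fix f z and s :: real
    assume f: "f \<in> dirichlet_space \<alpha>" and z: "z \<in> unit_disk" and s: "0 \<le> s" "s \<le> 1"
    define N where "N = dirichlet_norm \<alpha> f"
    have N: "0 \<le> N" by (simp add: N_def dirichlet_norm_nonneg)
    have hol: "f holomorphic_on unit_disk" using f by (simp add: dirichlet_space_def disk_analytic_def)
    have dhol: "deriv f holomorphic_on unit_disk" by (rule holomorphic_deriv[OF hol]) simp
    have df: "cmod (deriv f u) \<le> M * N * (1 - cmod u) powr (- \<alpha> / 2 - 1)" if "u \<in> unit_disk" for u
      unfolding M_def
      by (rule weighted_pointwise_bound[OF \<alpha> dhol that _ N])
        (use nn_integral_deriv_le_norm[OF f] in \<open>simp add: N_def\<close>)
    define r where "r = cmod z"
    have r: "0 \<le> r" "r < 1" using z by (auto simp: r_def)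
    define p where "p = - \<alpha> / 2"
    have p: "0 < p" using \<alpha> by (simp add: p_def)
    \<comment> \<open>A primitive of the bound for the derivative along the radius.\<close>
    define \<Phi> where "\<Phi> t = - (M * N / p) * (1 - t * r) powr p" for t
    have tr: "0 < 1 - t * r" if "t \<le> 1" for t
    proof -
      have "t * r \<le> 1 * r" using that r by (intro mult_right_mono) auto
      then show ?thesis using r by simp
    qed
    have tz: "of_real t * z \<in> unit_disk" if "0 \<le> t" "t \<le> 1" for t
      using tr[OF that(2)] that by (simp add: norm_mult r_def)
    have "cmod (f (of_real 1 * z) - f (of_real s * z)) \<le> \<Phi> 1 - \<Phi> s"
    proof (cases "s = 1")
      case False
      then have s1: "s < 1" using s by simp
      show ?thesis
      proof (rule differentiable_bound_general[OF s1, where f = "\<lambda>t. f (of_real t * z)" and f' = "\<lambda>t. deriv f (of_real t * z) * z"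
            and \<phi>' = "\<lambda>t. M * N * r * (1 - t * r) powr (p - 1)"])
        show "continuous_on {s..1} (\<lambda>t. f (of_real t * z))"
          by (intro continuous_on_compose2[OF holomorphic_on_imp_continuous_on[OF hol]] continuous_intros)
            (use tz s in auto)
        show "continuous_on {s..1} \<Phi>" unfolding \<Phi>_def
          by (intro continuous_intros) (use tr in force)
        fix t assume t: "s < t" "t < 1"
        have td: "of_real t * z \<in> unit_disk" using tz t s by auto
        show "((\<lambda>t. f (of_real t * z)) has_vector_derivative deriv f (of_real t * z) * z) (at t)"
        proof -
          have "(f has_field_derivative deriv f (of_real t * z)) (at (of_real t * z))"
            using holomorphic_derivI[OF hol _ td] by simp
          moreover have "((\<lambda>t. of_real t * z) has_vector_derivative z) (at t)"
            by (auto intro!: derivative_eq_intros)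
          ultimately have "(f \<circ> (\<lambda>t. of_real t * z) has_vector_derivative (z * deriv f (of_real t * z))) (at t)"
            by (rule field_vector_diff_chain_at[rotated])
          then show ?thesis by (simp only: o_def mult.commute[of z])
        qed
        show "(\<Phi> has_vector_derivative M * N * r * (1 - t * r) powr (p - 1)) (at t)"
          unfolding has_real_derivative_iff_has_vector_derivative[symmetric] \<Phi>_def
          using tr[of t] t p by (auto intro!: derivative_eq_intros)
        show "norm (deriv f (of_real t * z) * z) \<le> M * N * r * (1 - t * r) powr (p - 1)"
        proof -
          have "cmod (of_real t * z) = t * r" using t s by (simp add: norm_mult r_def)
          then have "cmod (deriv f (of_real t * z)) \<le> M * N * (1 - t * r) powr (p - 1)"
            using df[OF td] by (simp add: p_def diff_diff_eq2 algebra_simps)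
          then have "cmod (deriv f (of_real t * z)) * r \<le> M * N * (1 - t * r) powr (p - 1) * r"
            using r by (intro mult_right_mono) auto
          then show ?thesis by (simp add: norm_mult r_def mult_ac)
        qed
      qed
    qed simp
    also have "\<dots> \<le> (M * N / p) * (1 - s * r) powr p"
      using M N p by (simp add: \<Phi>_def)
    finally show "cmod (f z - f (of_real s * z)) \<le> M / (- \<alpha> / 2) * dirichlet_norm \<alpha> f * (1 - s * cmod z) powr (- \<alpha> / 2)"
      by (simp add: p_def N_def r_def mult_ac)
  qed
qed

lemma dirichlet_sup_bound:
  assumes \<alpha>: "-1 < \<alpha>" "\<alpha> < 0"
  obtains B where "0 < B" "\<And>f z. f \<in> dirichlet_space \<alpha> \<Longrightarrow> z \<in> unit_disk \<Longrightarrow> cmod (f z) \<le> B * dirichlet_norm \<alpha> f"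
proof -
  obtain B where B: "0 < B" "\<And>f z s. f \<in> dirichlet_space \<alpha> \<Longrightarrow> z \<in> unit_disk \<Longrightarrow> 0 \<le> s \<Longrightarrow> s \<le> 1 \<Longrightarrow>
       cmod (f z - f (of_real s * z)) \<le> B * dirichlet_norm \<alpha> f * (1 - s * cmod z) powr (- \<alpha> / 2)"
    by (rule dirichlet_radial_bound[OF \<alpha>]) (rule that)
  show thesis
  proof (rule that[of "B + 1"])
    fix f z assume f: "f \<in> dirichlet_space \<alpha>" and z: "z \<in> unit_disk"
    have "cmod (f z - f 0) \<le> B * dirichlet_norm \<alpha> f" using B(2)[OF f z, of 0] by simp
    moreover have "cmod (f 0) \<le> dirichlet_norm \<alpha> f"
      by (rule power2_le_imp_le) (auto simp: dirichlet_norm_sq dirichlet_norm_nonneg)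
    moreover have "cmod (f z) \<le> cmod (f z - f 0) + cmod (f 0)" using norm_triangle_ineq[of "f z - f 0" "f 0"] by simp
    ultimately show "cmod (f z) \<le> (B + 1) * dirichlet_norm \<alpha> f" by (simp add: algebra_simps)
  qed (use B in simp)
qed

text \<open>
  A primitive of \<open>cnj w / (1 - cnj w * u)\<close>. Between \<open>w\<close> and a point where \<open>cmod (1 - cnj w * u)\<close> is three times as
  large it changes by at least \<open>1\<close>, however close \<open>w\<close> is to the circle, while its norm is at most of order
  \<open>(1 - (cmod w)\<^sup>2) powr (\<alpha> / 2)\<close>.
\<close>

definition log_kernel :: "complex \<Rightarrow> complex \<Rightarrow> complex" where
  "log_kernel w = (\<lambda>u. if u \<in> unit_disk then - Ln (1 - cnj w * u) else 0)"

lemma kernel_constant_pos: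
  fixes \<alpha> :: real
  assumes "-1 < \<alpha>" "\<alpha> < 0"
  shows "0 < (1 + \<alpha>) * (1 / (1 + \<alpha>) + 1 / (- \<alpha>))"
proof -
  have "0 < 1 + \<alpha>" "0 < 1 / (1 + \<alpha>)" "0 < 1 / (- \<alpha>)" using assms by (auto simp: zero_less_divide_iff)
  then show ?thesis by (intro mult_pos_pos add_pos_pos[of "1 / (1 + \<alpha>)"])
qed

lemma log_kernel_in_dirichlet:
  assumes \<alpha>: "-1 < \<alpha>" "\<alpha> < 0" and w: "w \<in> unit_disk"
  shows "log_kernel w \<in> dirichlet_space \<alpha>"
    and "(dirichlet_norm \<alpha> (log_kernel w))\<^sup>2 \<le> (1 + \<alpha>) * (1 / (1 + \<alpha>) + 1 / (- \<alpha>)) * (1 - (cmod w)\<^sup>2) powr \<alpha>"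
proof -
  have wu: "cmod (cnj w * u) < 1" if "u \<in> unit_disk" for u
    using that w mult_strict_mono'[of "cmod w" 1 "cmod u" 1] by (simp add: norm_mult)
  have np: "1 - cnj w * u \<notin> \<real>\<^sub>\<le>\<^sub>0" if "u \<in> unit_disk" for u
  proof -
    have "Re (cnj w * u) < 1" using wu[OF that] complex_Re_le_cmod[of "cnj w * u"] by linarith
    then have "0 < Re (1 - cnj w * u)" by simp
    then show ?thesis using complex_nonpos_Reals_iff by force
  qed
  have der: "(log_kernel w has_field_derivative cnj w / (1 - cnj w * u)) (at u)" if u: "u \<in> unit_disk" for u
  proof (rule has_field_derivative_transform_within_open[OF _ open_ball u])
    have "1 - cnj w * u \<noteq> 0" using np[OF u] by auto
    then show "((\<lambda>u. - Ln (1 - cnj w * u)) has_field_derivative cnj w / (1 - cnj w * u)) (at u)"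
      using np[OF u] by (auto intro!: derivative_eq_intros simp: field_simps)
  qed (simp add: log_kernel_def)
  have "log_kernel w holomorphic_on unit_disk"
    unfolding holomorphic_on_open[OF open_ball] using der by blast
  then have an: "log_kernel w \<in> disk_analytic" by (simp add: disk_analytic_def log_kernel_def)
  have "(\<integral>\<^sup>+u. ennreal ((cmod (deriv (log_kernel w) u))\<^sup>2) \<partial>weighted_area \<alpha>)
     \<le> (\<integral>\<^sup>+u. ennreal (1 / (cmod (1 - cnj w * u))\<^sup>2) \<partial>weighted_area \<alpha>)"
  proof (intro nn_integral_mono ennreal_leI)
    fix u assume "u \<in> space (weighted_area \<alpha>)"
    then have u: "u \<in> unit_disk" by (simp add: space_weighted_area)
    have "(cmod w)\<^sup>2 \<le> 1" using w by (simp add: abs_square_le_1)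
    then show "(cmod (deriv (log_kernel w) u))\<^sup>2 \<le> 1 / (cmod (1 - cnj w * u))\<^sup>2"
      unfolding DERIV_imp_deriv[OF der[OF u]] by (simp add: norm_divide power_divide divide_right_mono)
  qed
  also have "\<dots> \<le> ennreal ((1 + \<alpha>) * (1 / (1 + \<alpha>) + 1 / (- \<alpha>)) * (1 - (cmod w)\<^sup>2) powr \<alpha>)"
    by (rule kernel_integral_bound[OF \<alpha> w])
  finally have le: "(\<integral>\<^sup>+u. ennreal ((cmod (deriv (log_kernel w) u))\<^sup>2) \<partial>weighted_area \<alpha>)
    \<le> ennreal ((1 + \<alpha>) * (1 / (1 + \<alpha>) + 1 / (- \<alpha>)) * (1 - (cmod w)\<^sup>2) powr \<alpha>)" .
  show "log_kernel w \<in> dirichlet_space \<alpha>" by (rule dirichlet_spaceI[OF an le])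
  have "0 \<le> (1 + \<alpha>) * (1 / (1 + \<alpha>) + 1 / (- \<alpha>)) * (1 - (cmod w)\<^sup>2) powr \<alpha>"
    using kernel_constant_pos[OF \<alpha>] by simp
  from dirichlet_norm_sq_le[OF an le this]
  show "(dirichlet_norm \<alpha> (log_kernel w))\<^sup>2 \<le> (1 + \<alpha>) * (1 / (1 + \<alpha>) + 1 / (- \<alpha>)) * (1 - (cmod w)\<^sup>2) powr \<alpha>"
    by (simp add: log_kernel_def)
qed

section \<open>Boundary contact of the range of a bounded composition operator\<close>

text \<open>
  Let \<open>w = \<phi> z\<close> and \<open>d = 1 - (cmod w)\<^sup>2\<close>. On the way from \<open>z\<close> to \<open>0\<close> along the radius, \<open>cmod (1 - cnj w * \<phi> z')\<close>
  grows from \<open>d\<close> to \<open>1\<close>; take \<open>z'\<close> where it equals \<open>3 * d\<close>. Between \<open>z\<close> and \<open>z'\<close> the function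
  \<open>log_kernel w \<circ> \<phi>\<close> changes by at least \<open>1\<close>, although its norm is at most of order \<open>d powr (\<alpha> / 2)\<close>. The
  radial estimate then leaves only \<open>d \<le> const * (1 - cmod z')\<close>.
\<close>

lemma bounded_comp_op_nontangential_point:
  assumes \<alpha>: "-1 < \<alpha>" "\<alpha> < 0" and \<phi>: "\<phi> holomorphic_on unit_disk" "\<phi> ` unit_disk \<subseteq> unit_disk" "\<phi> 0 = 0"
    and bdd: "bounded_comp_op \<alpha> \<phi>"
  obtains L where "0 < L" and
    "\<And>z. z \<in> unit_disk \<Longrightarrow> 3 * (1 - (cmod (\<phi> z))\<^sup>2) < 1 \<Longrightarrow>
       \<exists>z'\<in>unit_disk. 1 - (cmod (\<phi> z'))\<^sup>2 \<le> L * (1 - (cmod z')\<^sup>2) \<and> cmod (\<phi> z - \<phi> z') \<le> 4 * (1 - (cmod (\<phi> z))\<^sup>2)"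
proof -
  obtain B where B: "0 < B" "\<And>f z s. f \<in> dirichlet_space \<alpha> \<Longrightarrow> z \<in> unit_disk \<Longrightarrow> 0 \<le> s \<Longrightarrow> s \<le> 1 \<Longrightarrow>
       cmod (f z - f (of_real s * z)) \<le> B * dirichlet_norm \<alpha> f * (1 - s * cmod z) powr (- \<alpha> / 2)"
    by (rule dirichlet_radial_bound[OF \<alpha>]) (rule that)
  obtain C0 where C0: "\<And>f. f \<in> dirichlet_space \<alpha> \<Longrightarrow> comp_op \<phi> f \<in> dirichlet_space \<alpha>"
      "\<And>f. f \<in> dirichlet_space \<alpha> \<Longrightarrow> dirichlet_norm \<alpha> (comp_op \<phi> f) \<le> C0 * dirichlet_norm \<alpha> f"
    using bdd unfolding bounded_comp_op_def by blast
  define C where "C = max C0 1"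
  have C: "0 < C" "\<And>f. f \<in> dirichlet_space \<alpha> \<Longrightarrow> dirichlet_norm \<alpha> (comp_op \<phi> f) \<le> C * dirichlet_norm \<alpha> f"
  proof -
    show "0 < C" by (simp add: C_def)
    fix f assume f: "f \<in> dirichlet_space \<alpha>"
    have "C0 * dirichlet_norm \<alpha> f \<le> C * dirichlet_norm \<alpha> f"
      using dirichlet_norm_nonneg[of \<alpha> f] by (intro mult_right_mono) (auto simp: C_def)
    with C0(2)[OF f] show "dirichlet_norm \<alpha> (comp_op \<phi> f) \<le> C * dirichlet_norm \<alpha> f" by linarith
  qed
  define k where "k = (1 + \<alpha>) * (1 / (1 + \<alpha>) + 1 / (- \<alpha>))"
  have k: "0 < k" unfolding k_def by (rule kernel_constant_pos[OF \<alpha>])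
  define A where "A = B * C * sqrt k"
  have A: "0 < A" using B C k by (simp add: A_def)
  \<comment> \<open>The power that turns the exponent \<open>- \<alpha> / 2\<close> of the radial estimate into \<open>1\<close>.\<close>
  define p where "p = 2 / (- \<alpha>)"
  show thesis
  proof (rule that[of "6 * A powr p"])
    show "0 < 6 * A powr p" using A by simp
    fix z assume z: "z \<in> unit_disk" and small: "3 * (1 - (cmod (\<phi> z))\<^sup>2) < 1"
    define w where "w = \<phi> z"
    define d where "d = 1 - (cmod w)\<^sup>2"
    have w: "w \<in> unit_disk" using \<phi>(2) z unfolding w_def by blast
    have d: "0 < d" "3 * d < 1" using one_minus_norm_sq_pos[of w] w small by (auto simp: d_def w_def)
    have cw: "cnj w * w = of_real (1 - d)"
      by (simp add: d_def complex_norm_square mult.commute del: of_real_power)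
    have sz: "of_real s * z \<in> unit_disk" "cmod (of_real s * z) = s * cmod z" if "0 \<le> s" "s \<le> 1" for s
      using that z mult_left_le_one_le[of "cmod z" s] by (auto simp: norm_mult)
    have cont: "continuous_on {0..1} (\<lambda>s. cmod (1 - cnj w * \<phi> (of_real s * z)))"
      by (intro continuous_intros continuous_on_compose2[OF holomorphic_on_imp_continuous_on[OF \<phi>(1)]])
        (use sz in auto)
    have "\<exists>s\<ge>0. s \<le> 1 \<and> cmod (1 - cnj w * \<phi> (of_real s * z)) = 3 * d"
    proof (rule IVT2'[OF _ _ _ cont])
      have "1 - cnj w * w = of_real d" by (simp add: cw)
      then show "cmod (1 - cnj w * \<phi> (of_real 1 * z)) \<le> 3 * d" using d by (simp add: w_def[symmetric])
      show "3 * d \<le> cmod (1 - cnj w * \<phi> (of_real 0 * z))" using d \<phi>(3) by simp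
    qed simp
    then obtain s where s: "0 \<le> s" "s \<le> 1" "cmod (1 - cnj w * \<phi> (of_real s * z)) = 3 * d" by blast
    define z' where "z' = of_real s * z"
    have z': "z' \<in> unit_disk" "cmod z' = s * cmod z" using sz s by (auto simp: z'_def)
    define v where "v = \<phi> z'"
    have v: "v \<in> unit_disk" using \<phi>(2) z' unfolding v_def by blast
    have dv: "cmod (1 - cnj w * v) = 3 * d" using s by (simp add: v_def z'_def)
    have "1 \<le> cmod (log_kernel w w - log_kernel w v)"
    proof -
      \<comment> \<open>The factor \<open>3\<close> was chosen to make its logarithm at least \<open>1\<close>.\<close>
      have "exp 1 \<le> (3::real)" by (rule exp_le)
      then have "1 \<le> ln (3::real)" by (simp add: ln_ge_iff)
      also have "\<dots> = ln (3 * d) - ln d" using d by (simp add: ln_mult)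
      also have "\<dots> = Re (log_kernel w w - log_kernel w v)"
      proof -
        have "1 - cnj w * v \<noteq> 0" using dv d by auto
        then have "Re (Ln (1 - cnj w * v)) = ln (3 * d)" using dv by simp
        moreover have "1 - cnj w * w = of_real d" by (simp add: cw)
        then have "Re (Ln (1 - cnj w * w)) = ln d" using d by simp
        ultimately show ?thesis using v w by (simp add: log_kernel_def)
      qed
      also have "\<dots> \<le> cmod (log_kernel w w - log_kernel w v)" by (rule complex_Re_le_cmod)
      finally show ?thesis .
    qed
    also have "log_kernel w w - log_kernel w v = comp_op \<phi> (log_kernel w) z - comp_op \<phi> (log_kernel w) (of_real s * z)"
      using z z' by (simp add: comp_op_def w_def v_def z'_def)
    also have "cmod \<dots> \<le> B * dirichlet_norm \<alpha> (comp_op \<phi> (log_kernel w)) * (1 - s * cmod z) powr (- \<alpha> / 2)"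
      by (rule B(2)[OF C0(1)[OF log_kernel_in_dirichlet(1)[OF \<alpha> w]] z s(1,2)])
    also have "\<dots> \<le> B * (C * (sqrt k * d powr (\<alpha> / 2))) * (1 - s * cmod z) powr (- \<alpha> / 2)"
    proof (intro mult_right_mono mult_left_mono)
      have "(dirichlet_norm \<alpha> (log_kernel w))\<^sup>2 \<le> k * d powr \<alpha>"
        using log_kernel_in_dirichlet(2)[OF \<alpha> w] by (simp add: k_def d_def)
      also have "\<dots> = (sqrt k * d powr (\<alpha> / 2))\<^sup>2"
        using k by (simp add: power_mult_distrib) (simp add: power2_eq_square powr_add[symmetric])
      finally have "dirichlet_norm \<alpha> (log_kernel w) \<le> sqrt k * d powr (\<alpha> / 2)"
        by (rule power2_le_imp_le) (use k in simp)
      then have "C * dirichlet_norm \<alpha> (log_kernel w) \<le> C * (sqrt k * d powr (\<alpha> / 2))"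
        using C by (intro mult_left_mono) auto
      then show "dirichlet_norm \<alpha> (comp_op \<phi> (log_kernel w)) \<le> C * (sqrt k * d powr (\<alpha> / 2))"
        using C(2)[OF log_kernel_in_dirichlet(1)[OF \<alpha> w]] by linarith
    qed (use B in auto)
    finally have one: "1 \<le> A * d powr (\<alpha> / 2) * (1 - cmod z') powr (- \<alpha> / 2)"
      by (simp add: A_def z' mult_ac)
    have pz: "0 < 1 - cmod z'" using z' by simp
    have "d powr (- \<alpha> / 2) \<le> A * (1 - cmod z') powr (- \<alpha> / 2)"
    proof -
      have "d powr (- \<alpha> / 2) * 1 \<le> d powr (- \<alpha> / 2) * (A * d powr (\<alpha> / 2) * (1 - cmod z') powr (- \<alpha> / 2))"
        by (rule mult_left_mono[OF one]) simp
      also have "\<dots> = (d powr (- \<alpha> / 2) * d powr (\<alpha> / 2)) * (A * (1 - cmod z') powr (- \<alpha> / 2))" by simp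
      also have "d powr (- \<alpha> / 2) * d powr (\<alpha> / 2) = 1" using d by (simp add: powr_add[symmetric])
      finally show ?thesis by simp
    qed
    then have "(d powr (- \<alpha> / 2)) powr p \<le> (A * (1 - cmod z') powr (- \<alpha> / 2)) powr p"
      using \<alpha> by (intro powr_mono2) (auto simp: p_def divide_nonneg_neg)
    moreover have "(x powr (- \<alpha> / 2)) powr p = x" if "0 < x" for x
      using \<alpha> that by (simp add: powr_powr p_def)
    ultimately have dz: "d \<le> A powr p * (1 - cmod z')"
      using A pz d by (simp add: powr_mult)
    have v1: "cmod v < 1" using v by simp
    have "1 - (cmod v)\<^sup>2 \<le> 2 * (1 - cmod v)"
      using zero_le_power2[of "1 - cmod v"] by (simp add: power2_eq_square algebra_simps)
    also have "1 - cmod v \<le> cmod (1 - cnj w * v)"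
    proof -
      have "cmod (cnj w * v) \<le> 1 * cmod v" using w by (simp add: norm_mult mult_right_mono less_imp_le mult_left_le_one_le)
      then show ?thesis using norm_triangle_ineq2[of 1 "cnj w * v"] by simp
    qed
    also have "\<dots> = 3 * d" by (rule dv)
    finally have "1 - (cmod v)\<^sup>2 \<le> 6 * A powr p * (1 - cmod z')" using dz by simp
    also have "\<dots> \<le> 6 * A powr p * (1 - (cmod z')\<^sup>2)"
    proof -
      have "(cmod z')\<^sup>2 \<le> cmod z'" using z'(1) unfolding power2_eq_square by (intro mult_left_le) auto
      then show ?thesis using A by (intro mult_left_mono) auto
    qed
    finally have 1: "1 - (cmod (\<phi> z'))\<^sup>2 \<le> 6 * A powr p * (1 - (cmod z')\<^sup>2)" by (simp add: v_def)
    have "w - v = w * (1 - cnj w * v) - of_real d * v"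
    proof -
      have "w * cnj w = of_real (1 - d)" using cw by (simp only: mult.commute)
      then have "w * (cnj w * v) = of_real (1 - d) * v" by (simp only: mult.assoc[symmetric])
      then show ?thesis by (simp add: algebra_simps)
    qed
    then have "cmod (w - v) \<le> cmod (w * (1 - cnj w * v)) + cmod (of_real d * v)"
      by (metis norm_triangle_ineq4)
    also have "\<dots> \<le> 1 * (3 * d) + d * 1"
      unfolding norm_mult dv using w v1 d by (intro add_mono mult_mono) auto
    finally have "cmod (\<phi> z - \<phi> z') \<le> 4 * (1 - (cmod (\<phi> z))\<^sup>2)" by (simp add: w_def v_def d_def)
    with 1 z'(1) show "\<exists>z'\<in>unit_disk. 1 - (cmod (\<phi> z'))\<^sup>2 \<le> 6 * A powr p * (1 - (cmod z')\<^sup>2) \<and> cmod (\<phi> z - \<phi> z') \<le> 4 * (1 - (cmod (\<phi> z))\<^sup>2)"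
      by blast
  qed
qed

text \<open>
  The points of \<open>bounded_comp_op_nontangential_point\<close> for \<open>\<phi> z\<close> tending to \<open>\<zeta>\<close>: the values at \<open>z\<close> and
  \<open>z'\<close> have the same limit.
\<close>

lemma bounded_comp_op_nontangential_sequence:
  assumes \<alpha>: "-1 < \<alpha>" "\<alpha> < 0" and \<phi>: "\<phi> holomorphic_on unit_disk" "\<phi> ` unit_disk \<subseteq> unit_disk" "\<phi> 0 = 0"
    and bdd: "bounded_comp_op \<alpha> \<phi>"
  obtains L where "0 < L" and
    "\<And>\<zeta>. cmod \<zeta> = 1 \<Longrightarrow> \<zeta> \<in> closure (\<phi> ` unit_disk) \<Longrightarrow>
       \<exists>w. (\<forall>n::nat. w n \<in> unit_disk \<and> 1 - (cmod (\<phi> (w n)))\<^sup>2 \<le> L * (1 - (cmod (w n))\<^sup>2)) \<and> (\<lambda>n. \<phi> (w n)) \<longlonglongrightarrow> \<zeta>"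
proof -
  obtain L where L: "0 < L" and
    pt: "\<And>z. z \<in> unit_disk \<Longrightarrow> 3 * (1 - (cmod (\<phi> z))\<^sup>2) < 1 \<Longrightarrow>
       \<exists>z'\<in>unit_disk. 1 - (cmod (\<phi> z'))\<^sup>2 \<le> L * (1 - (cmod z')\<^sup>2) \<and> cmod (\<phi> z - \<phi> z') \<le> 4 * (1 - (cmod (\<phi> z))\<^sup>2)"
    by (rule bounded_comp_op_nontangential_point[OF \<alpha> \<phi> bdd]) (rule that)
  have "\<exists>w. (\<forall>n::nat. w n \<in> unit_disk \<and> 1 - (cmod (\<phi> (w n)))\<^sup>2 \<le> L * (1 - (cmod (w n))\<^sup>2)) \<and> (\<lambda>n. \<phi> (w n)) \<longlonglongrightarrow> \<zeta>"
    if \<zeta>: "cmod \<zeta> = 1" "\<zeta> \<in> closure (\<phi> ` unit_disk)" for \<zeta>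
  proof -
    obtain q where q: "\<forall>n::nat. q n \<in> \<phi> ` unit_disk" "q \<longlonglongrightarrow> \<zeta>"
      using \<zeta>(2) unfolding closure_sequential by blast
    have lim: "(\<lambda>n. 1 - (cmod (q n))\<^sup>2) \<longlonglongrightarrow> 0"
      using tendsto_diff[OF tendsto_const tendsto_power[OF tendsto_norm[OF q(2)], of 2], of 1] \<zeta>(1) by simp
    then have "eventually (\<lambda>n. 1 - (cmod (q n))\<^sup>2 < 1 / 3) sequentially"
      by (rule order_tendstoD) simp
    then obtain N where "\<And>n. n \<ge> N \<Longrightarrow> 1 - (cmod (q n))\<^sup>2 < 1 / 3"
      unfolding eventually_sequentially by blast
    then have N: "3 * (1 - (cmod (q n))\<^sup>2) < 1" if "n \<ge> N" for n using that by fastforce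
    have "\<forall>n. \<exists>z'\<in>unit_disk. 1 - (cmod (\<phi> z'))\<^sup>2 \<le> L * (1 - (cmod z')\<^sup>2) \<and> cmod (q (n + N) - \<phi> z') \<le> 4 * (1 - (cmod (q (n + N)))\<^sup>2)"
    proof
      fix n
      obtain z where z: "z \<in> unit_disk" "q (n + N) = \<phi> z" using q(1) by blast
      then show "\<exists>z'\<in>unit_disk. 1 - (cmod (\<phi> z'))\<^sup>2 \<le> L * (1 - (cmod z')\<^sup>2) \<and> cmod (q (n + N) - \<phi> z') \<le> 4 * (1 - (cmod (q (n + N)))\<^sup>2)"
        using pt[OF z(1)] N[of "n + N"] by simp
    qed
    then obtain w where w: "\<And>n. w n \<in> unit_disk" "\<And>n. 1 - (cmod (\<phi> (w n)))\<^sup>2 \<le> L * (1 - (cmod (w n))\<^sup>2)"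
      "\<And>n. cmod (q (n + N) - \<phi> (w n)) \<le> 4 * (1 - (cmod (q (n + N)))\<^sup>2)"
      by metis
    have "(\<lambda>n. 4 * (1 - (cmod (q (n + N)))\<^sup>2)) \<longlonglongrightarrow> 0"
      using tendsto_mult_left[OF LIMSEQ_ignore_initial_segment[OF lim, of N], of 4] by simp
    then have "(\<lambda>n. q (n + N) - \<phi> (w n)) \<longlonglongrightarrow> 0"
      by (rule Lim_null_comparison[rotated]) (rule always_eventually[OF allI[OF w(3)]])
    then have "(\<lambda>n. q (n + N) - (q (n + N) - \<phi> (w n))) \<longlonglongrightarrow> \<zeta> - 0"
      by (intro tendsto_diff LIMSEQ_ignore_initial_segment[OF q(2)])
    then have "(\<lambda>n. \<phi> (w n)) \<longlonglongrightarrow> \<zeta>" by simp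
    then show ?thesis using w by blast
  qed
  then show thesis using that[OF L] by blast
qed

text \<open>
  A Riemann map \<open>g\<close> of the disk onto \<open>U\<close> and \<open>h = f \<circ> \<phi>\<close> with \<open>f\<close> its inverse give \<open>\<phi> = g \<circ> h\<close>. Since \<open>h\<close> maps
  the disk to itself, \<open>1 - (cmod (h z))\<^sup>2\<close> is at least a multiple of \<open>1 - (cmod z)\<^sup>2\<close>, so the points \<open>h (w n)\<close>
  do for \<open>g\<close> what the points \<open>w n\<close> do for \<open>\<phi>\<close>, and \<open>conformal_self_map_onto\<close> applies to \<open>g\<close>.
\<close>

theorem simply_connected_hull_full:
  assumes \<alpha>: "-1 < \<alpha>" "\<alpha> < 0" and \<phi>: "\<phi> holomorphic_on unit_disk" "\<phi> ` unit_disk \<subseteq> unit_disk" "\<phi> 0 = 0"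
    and bdd: "bounded_comp_op \<alpha> \<phi>"
    and U: "open U" "simply_connected U" "U \<subseteq> unit_disk" "\<phi> ` unit_disk \<subseteq> U"
    and bdry: "sphere 0 1 \<subseteq> closure (\<phi> ` unit_disk)"
  shows "U = unit_disk"
proof -
  obtain L where L: "0 < L" and
    sq: "\<And>\<zeta>. cmod \<zeta> = 1 \<Longrightarrow> \<zeta> \<in> closure (\<phi> ` unit_disk) \<Longrightarrow>
       \<exists>w. (\<forall>n::nat. w n \<in> unit_disk \<and> 1 - (cmod (\<phi> (w n)))\<^sup>2 \<le> L * (1 - (cmod (w n))\<^sup>2)) \<and> (\<lambda>n. \<phi> (w n)) \<longlonglongrightarrow> \<zeta>"
    by (rule bounded_comp_op_nontangential_sequence[OF \<alpha> \<phi> bdd]) (rule that)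
  have "U \<noteq> {}" using U(4) by auto
  moreover have "U \<noteq> UNIV"
  proof
    assume "U = UNIV"
    then have "(1::complex) \<in> unit_disk" using U(3) by blast
    then show False by simp
  qed
  ultimately obtain f g where f: "f holomorphic_on U" and g: "g holomorphic_on unit_disk"
    and fg: "\<forall>z\<in>U. f z \<in> unit_disk \<and> g (f z) = z" "\<forall>z\<in>unit_disk. g z \<in> U \<and> f (g z) = z"
    using Riemann_mapping_theorem[of U] U(1,2) by metis
  define h where "h = f \<circ> \<phi>"
  have h: "h holomorphic_on unit_disk" unfolding h_def by (rule holomorphic_on_compose_gen[OF \<phi>(1) f U(4)])
  have hD: "h z \<in> unit_disk" "g (h z) = \<phi> z" if "z \<in> unit_disk" for z
  proof -
    have "\<phi> z \<in> U" using U(4) that by blast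
    then show "h z \<in> unit_disk" "g (h z) = \<phi> z" using fg(1) by (simp_all add: h_def)
  qed
  have him: "h ` unit_disk \<subseteq> unit_disk" using hD by blast
  define a where "a = cmod (h 0)"
  have a: "0 \<le> a" "a < 1" using hD(1)[of 0] by (auto simp: a_def)
  have hz: "(1 - a)\<^sup>2 * (1 - (cmod z)\<^sup>2) \<le> 1 - (cmod (h z))\<^sup>2" if z: "z \<in> unit_disk" for z
  proof -
    have hz1: "cmod (h z) < 1" using hD(1)[OF z] by simp
    have "cmod (cnj (h 0) * h z) \<le> a * 1" unfolding norm_mult using hz1 by (intro mult_mono) (auto simp: a_def)
    then have "1 - a \<le> cmod (1 - cnj (h 0) * h z)"
      using norm_triangle_ineq2[of 1 "cnj (h 0) * h z"] by simp
    then have "(1 - a)\<^sup>2 * (1 - (cmod z)\<^sup>2) \<le> (cmod (1 - cnj (h 0) * h z))\<^sup>2 * (1 - (cmod z)\<^sup>2)"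
      using a z one_minus_norm_sq_pos[of z] by (intro mult_right_mono power_mono) auto
    also have "\<dots> \<le> (1 - (cmod (h z))\<^sup>2) * (1 - (cmod (h 0))\<^sup>2)"
      using Schwarz_Pick_disk[OF h him z, of 0] by simp
    also have "\<dots> \<le> (1 - (cmod (h z))\<^sup>2) * 1"
      using one_minus_norm_sq_pos[OF hz1] by (intro mult_left_mono) auto
    finally show ?thesis by simp
  qed
  have "g ` unit_disk = unit_disk"
  proof (rule conformal_self_map_onto[OF g _ _ _])
    show "g ` unit_disk \<subseteq> unit_disk" using fg(2) U(3) by blast
    show "inj_on g unit_disk" using fg(2) by (metis inj_on_inverseI)
    show "0 < L / (1 - a)\<^sup>2" using L a by simp
    fix \<zeta> :: complex assume \<zeta>: "cmod \<zeta> = 1"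
    then have "\<zeta> \<in> closure (\<phi> ` unit_disk)" using bdry by auto
    then obtain w where w: "\<And>n::nat. w n \<in> unit_disk" "\<And>n. 1 - (cmod (\<phi> (w n)))\<^sup>2 \<le> L * (1 - (cmod (w n))\<^sup>2)"
      "(\<lambda>n. \<phi> (w n)) \<longlonglongrightarrow> \<zeta>" using sq[OF \<zeta>] by auto
    show "\<exists>v. (\<forall>n. v n \<in> unit_disk \<and> 1 - (cmod (g (v n)))\<^sup>2 \<le> L / (1 - a)\<^sup>2 * (1 - (cmod (v n))\<^sup>2)) \<and> (\<lambda>n. g (v n)) \<longlonglongrightarrow> \<zeta>"
    proof (intro exI[of _ "\<lambda>n. h (w n)"] conjI allI)
      fix n
      show "h (w n) \<in> unit_disk" by (rule hD(1)[OF w(1)])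
      have "1 - (cmod (w n))\<^sup>2 \<le> (1 - (cmod (h (w n)))\<^sup>2) / (1 - a)\<^sup>2"
        using hz[OF w(1)] a by (simp add: pos_le_divide_eq mult.commute)
      then have "L * (1 - (cmod (w n))\<^sup>2) \<le> L * ((1 - (cmod (h (w n)))\<^sup>2) / (1 - a)\<^sup>2)"
        using L by (intro mult_left_mono) auto
      then show "1 - (cmod (g (h (w n))))\<^sup>2 \<le> L / (1 - a)\<^sup>2 * (1 - (cmod (h (w n)))\<^sup>2)"
        using w(2)[of n] hD(2)[OF w(1)] by simp
    next
      show "(\<lambda>n. g (h (w n))) \<longlonglongrightarrow> \<zeta>" using w(3) hD(2)[OF w(1)] by simp
    qed
  qed
  moreover have "g ` unit_disk \<subseteq> U" using fg(2) by blast
  ultimately show ?thesis using U(3) by blast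
qed

lemma annulus_subset_of_boundary:
  assumes \<alpha>: "-1 < \<alpha>" "\<alpha> < 0" and \<phi>: "\<phi> holomorphic_on unit_disk" "\<phi> ` unit_disk \<subseteq> unit_disk" "\<phi> 0 = 0"
    and bdd: "bounded_comp_op \<alpha> \<phi>" and hole: "compact_hole_condition (\<phi> ` unit_disk)"
    and bdry: "sphere 0 1 \<subseteq> closure (\<phi> ` unit_disk)"
  shows "\<exists>r0::real. 0 < r0 \<and> r0 < 1 \<and> unit_disk - closure (ball 0 r0) \<subseteq> \<phi> ` unit_disk"
proof -
  obtain U K where U: "is_domain U" "simply_connected U" "U \<subseteq> unit_disk" and K: "compact K" "K \<subseteq> U"
    and eq: "\<phi> ` unit_disk = U - K"
    using hole unfolding compact_hole_condition_def by blast
  have UD: "U = unit_disk"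
    by (rule simply_connected_hull_full[OF \<alpha> \<phi> bdd _ U(2,3) _ bdry]) (use U eq in \<open>auto simp: is_domain_def\<close>)
  obtain r where r: "r < 1" "K \<subseteq> cball 0 r"
  proof (cases "K = {}")
    case True then show thesis using that[of 0] by simp
  next
    case False
    have "compact (cmod ` K)" using K(1) by (intro compact_continuous_image continuous_intros)
    then obtain m where m: "m \<in> cmod ` K" "\<forall>t\<in>cmod ` K. t \<le> m"
      using compact_attains_sup[of "cmod ` K"] False by auto
    have "m < 1" using m(1) K(2) UD by auto
    moreover have "K \<subseteq> cball 0 m" using m(2) by auto
    ultimately show thesis by (rule that)
  qed
  define r0 where "r0 = max r (1/2)"
  have r0: "0 < r0" "r0 < 1" using r by (auto simp: r0_def)
  have "unit_disk - closure (ball 0 r0) \<subseteq> unit_disk - K"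
    using r r0 by (auto simp: r0_def)
  then show ?thesis using r0 eq UD by (intro exI[of _ r0]) blast
qed

section \<open>Area in Bergman disks\<close>

lemma tanh_artanh_real:
  fixes x :: real
  assumes "0 \<le> x" "x < 1"
  shows "tanh (artanh x) = x"
proof -
  have "exp (- 2 * artanh x) = (1 - x) / (1 + x)"
  proof -
    have "- 2 * artanh x = - ln ((1 + x) / (1 - x))" by (simp add: artanh_def)
    also have "exp \<dots> = inverse ((1 + x) / (1 - x))" using assms by (simp add: exp_minus)
    finally show ?thesis by simp
  qed
  then have "tanh (artanh x) = (1 - (1 - x) / (1 + x)) / (1 + (1 - x) / (1 + x))"
    by (simp add: tanh_real_altdef)
  also have "\<dots> = x" using assms by (simp add: field_simps)
  finally show ?thesis .
qed

lemma bergman_disk_eq: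
  assumes z: "z \<in> unit_disk"
  shows "bergman_disk z r = {w \<in> unit_disk. cmod (z - w) < tanh r * cmod (1 - cnj z * w)}"
proof -
  have "bergman_dist z w < r \<longleftrightarrow> cmod (z - w) < tanh r * cmod (1 - cnj z * w)" if w: "w \<in> unit_disk" for w
  proof -
    have "1 - cnj z * w \<noteq> 0" using moebius_denominator_nonzero[of w z] z w by auto
    then have p: "0 < cmod (1 - cnj z * w)" by simp
    have "0 < (1 - (cmod w)\<^sup>2) * (1 - (cmod z)\<^sup>2)"
      using one_minus_norm_sq_pos[of w] one_minus_norm_sq_pos[of z] z w by simp
    then have "(cmod (w - z))\<^sup>2 < (cmod (1 - cnj z * w))\<^sup>2" using moebius_identity[of z w] by linarith
    then have "cmod (z - w) < cmod (1 - cnj z * w)"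
      by (simp add: norm_minus_commute power2_less_imp_less)
    then have "artanh (pseudo_hyperbolic z w) < r \<longleftrightarrow> pseudo_hyperbolic z w < tanh r"
      using p tanh_artanh_real[of "pseudo_hyperbolic z w"]
      by (subst tanh_real_less_iff[symmetric]) (simp add: pseudo_hyperbolic_def norm_divide)
    then show ?thesis using p by (simp add: bergman_dist_def pseudo_hyperbolic_def norm_divide pos_divide_less_eq)
  qed
  then show ?thesis unfolding bergman_disk_def by blast
qed

lemma open_bergman_disk:
  assumes "z \<in> unit_disk"
  shows "open (bergman_disk z r)"
proof -
  have "bergman_disk z r = unit_disk \<inter> {w. cmod (z - w) < tanh r * cmod (1 - cnj z * w)}"
    unfolding bergman_disk_eq[OF assms] by auto
  then show ?thesis by (auto intro!: open_Int open_Collect_less continuous_intros)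
qed

lemma bergman_disk_subset_unit_disk: "bergman_disk z r \<subseteq> unit_disk"
  by (auto simp: bergman_disk_def)

lemma bergman_disk_euclidean_size:
  assumes z: "z \<in> unit_disk" and r: "0 < r" and w: "w \<in> bergman_disk z r"
  shows "cmod (w - z) \<le> 2 * tanh r / (1 - tanh r) * (1 - cmod z)"
proof -
  define t where "t = tanh r"
  have t: "0 < t" "t < 1" using r tanh_real_lt_1 by (auto simp: t_def)
  have z1: "cmod z < 1" using z by simp
  have lt: "cmod (z - w) < t * cmod (1 - cnj z * w)" using w bergman_disk_eq[OF z] by (auto simp: t_def)
  have "1 - cnj z * w = of_real (1 - (cmod z)\<^sup>2) + cnj z * (z - w)"
    unfolding of_real_diff of_real_1 complex_norm_square by (simp add: algebra_simps)
  then have "cmod (1 - cnj z * w) \<le> \<bar>1 - (cmod z)\<^sup>2\<bar> + cmod z * cmod (z - w)"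
    by (metis norm_triangle_ineq norm_of_real norm_mult complex_mod_cnj)
  also have "\<bar>1 - (cmod z)\<^sup>2\<bar> = (1 - cmod z) * (1 + cmod z)"
    using one_minus_norm_sq_pos[OF z1] by (simp add: power2_eq_square algebra_simps)
  also have "\<dots> \<le> (1 - cmod z) * 2" using z1 by (intro mult_left_mono) auto
  also have "cmod z * cmod (z - w) \<le> 1 * cmod (z - w)" using z1 by (intro mult_right_mono) auto
  finally have "cmod (1 - cnj z * w) \<le> 2 * (1 - cmod z) + cmod (z - w)" by simp
  then have "t * cmod (1 - cnj z * w) \<le> t * (2 * (1 - cmod z) + cmod (z - w))"
    using t by (intro mult_left_mono) auto
  then have "cmod (z - w) * (1 - t) \<le> 2 * t * (1 - cmod z)" using lt by (simp add: algebra_simps)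
  then have "cmod (z - w) \<le> 2 * t * (1 - cmod z) / (1 - t)" using t by (simp add: pos_le_divide_eq)
  then show ?thesis by (simp add: t_def norm_minus_commute)
qed

lemma sets_weighted_area_open:
  assumes "open S" "S \<subseteq> unit_disk"
  shows "S \<in> sets (weighted_area \<alpha>)"
  unfolding sets_weighted_area using assms by (subst sets_restrict_space_iff) auto

lemma sets_disk_area_open:
  assumes "open S" "S \<subseteq> unit_disk"
  shows "S \<in> sets disk_area"
  unfolding sets_disk_area using assms by (subst sets_restrict_space_iff) auto

lemma emeasure_weighted_area:
  assumes \<alpha>: "-1 < \<alpha>" and S: "S \<in> sets disk_area"
  shows "emeasure (weighted_area \<alpha>) S = ennreal (1 + \<alpha>) * (\<integral>\<^sup>+z. ennreal (disk_weight \<alpha> z) * indicator S z \<partial>disk_area)"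
proof -
  have "emeasure (weighted_area \<alpha>) S = (\<integral>\<^sup>+z. indicator S z \<partial>weighted_area \<alpha>)"
    using S by (subst nn_integral_indicator) (auto simp: weighted_area_def)
  then show ?thesis using nn_integral_weighted_area[OF _ \<alpha>, of "indicator S"] S by simp
qed

lemma emeasure_weighted_area_ball_ge:
  assumes \<alpha>: "-1 < \<alpha>" "\<alpha> < 0" and e: "0 < e" "ball p e \<subseteq> unit_disk"
  shows "ennreal ((1 + \<alpha>) * e\<^sup>2) \<le> emeasure (weighted_area \<alpha>) (ball p e)"
proof -
  have S: "ball p e \<in> sets disk_area" by (rule sets_disk_area_open) (use e in auto)
  have "ennreal (e\<^sup>2) = ennreal (1 / pi) * (\<integral>\<^sup>+z. indicator unit_disk z * indicator (ball p e) z \<partial>lborel)"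
  proof -
    have "(\<integral>\<^sup>+z. indicator unit_disk z * indicator (ball p e) z \<partial>lborel) = (\<integral>\<^sup>+z. indicator (ball p e) z \<partial>(lborel :: complex measure))"
      using e(2) by (intro nn_integral_cong) (auto simp: indicator_def)
    also have "\<dots> = ennreal (pi * e\<^sup>2)" using e by (simp add: emeasure_ball unit_ball_vol_2)
    finally show ?thesis by (simp add: ennreal_mult[symmetric])
  qed
  also have "\<dots> = (\<integral>\<^sup>+z. indicator (ball p e) z \<partial>disk_area)"
    by (rule nn_integral_disk_area[symmetric]) (use S in auto)
  also have "\<dots> \<le> (\<integral>\<^sup>+z. ennreal (disk_weight \<alpha> z) * indicator (ball p e) z \<partial>disk_area)"
  proof (rule nn_integral_mono)
    fix z assume "z \<in> space disk_area"
    then have "cmod z < 1" by (simp add: space_disk_area)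
    then have "disk_weight \<alpha> 0 \<le> disk_weight \<alpha> z" using \<alpha> by (intro disk_weight_antimono) auto
    then have "1 \<le> ennreal (disk_weight \<alpha> z)" by (simp add: disk_weight_def)
    then have "1 * indicator (ball p e) z \<le> ennreal (disk_weight \<alpha> z) * (indicator (ball p e) z :: ennreal)"
      by (rule mult_right_mono) simp
    then show "(indicator (ball p e) z :: ennreal) \<le> ennreal (disk_weight \<alpha> z) * indicator (ball p e) z" by simp
  qed
  finally have "ennreal (e\<^sup>2) \<le> (\<integral>\<^sup>+z. ennreal (disk_weight \<alpha> z) * indicator (ball p e) z \<partial>disk_area)" .
  then have "ennreal (1 + \<alpha>) * ennreal (e\<^sup>2) \<le> emeasure (weighted_area \<alpha>) (ball p e)"
    unfolding emeasure_weighted_area[OF \<alpha>(1) S] by (rule mult_left_mono) simp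
  then show ?thesis using \<alpha> by (simp add: ennreal_mult)
qed

lemma emeasure_weighted_area_le_1:
  assumes "-1 < \<alpha>" shows "emeasure (weighted_area \<alpha>) S \<le> 1"
  using emeasure_space[of "weighted_area \<alpha>" S] emeasure_weighted_area_disk[OF assms]
  by (simp add: space_weighted_area)

lemma emeasure_bergman_disk_pos:
  assumes \<alpha>: "-1 < \<alpha>" "\<alpha> < 0" and z: "z \<in> unit_disk" and r: "0 < r"
  shows "0 < emeasure (weighted_area \<alpha>) (bergman_disk z r)"
proof -
  have "0 < tanh r * cmod (1 - cnj z * z)"
    using r moebius_denominator_nonzero[of z z] z by simp
  then have "z \<in> bergman_disk z r" using z by (simp add: bergman_disk_eq)
  then obtain e where e: "0 < e" "ball z e \<subseteq> bergman_disk z r"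
    using open_bergman_disk[OF z, of r] open_contains_ball by blast
  have "0 < ennreal ((1 + \<alpha>) * e\<^sup>2)" using \<alpha> e by simp
  also have "\<dots> \<le> emeasure (weighted_area \<alpha>) (ball z e)"
    by (rule emeasure_weighted_area_ball_ge[OF \<alpha> e(1)]) (use e(2) bergman_disk_subset_unit_disk in blast)
  also have "\<dots> \<le> emeasure (weighted_area \<alpha>) (bergman_disk z r)"
    by (rule emeasure_mono[OF e(2)]) (intro sets_weighted_area_open open_bergman_disk z bergman_disk_subset_unit_disk)
  finally show ?thesis .
qed

text \<open>
  Choose the pseudohyperbolic radius \<open>t\<close> with \<open>r0 < q < t < 1\<close>. For \<open>z\<close> close to the circle the whole Bergman disk
  lies beyond \<open>r0\<close>. Otherwise move outward on the ray through \<open>z\<close> to modulus \<open>q\<close>, if \<open>z\<close> is not beyond it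
  already: this reaches a point \<open>p\<close> at pseudohyperbolic distance at most \<open>q\<close>, and the slack \<open>t - q\<close> leaves room
  for a ball about \<open>p\<close> of a radius independent of \<open>z\<close>.
\<close>

lemma annulus_meets_bergman_disks:
  assumes r0: "0 < r0" "r0 < (1::real)"
  obtains r R e where "0 < r" "R < 1" "0 < e"
    "\<And>z. z \<in> unit_disk \<Longrightarrow> R \<le> cmod z \<Longrightarrow> bergman_disk z r \<subseteq> {w. r0 < cmod w}"
    "\<And>z. z \<in> unit_disk \<Longrightarrow> cmod z \<le> R \<Longrightarrow> \<exists>p. ball p e \<subseteq> bergman_disk z r \<inter> {w. r0 < cmod w}"
proof -
  define t where "t = (2 + r0) / 3"
  define q where "q = (1 + 2 * r0) / 3"
  have tq: "r0 < q" "q < t" "t < 1" "0 < q" using r0 by (auto simp: t_def q_def)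
  define r where "r = artanh t"
  have tr: "tanh r = t" using tanh_artanh_real[of t] tq by (simp add: r_def)
  have r: "0 < r" using tr tq tanh_real_pos_iff[of r] by simp
  define c where "c = 2 * t / (1 - t)"
  have c: "0 < c" using tq by (simp add: c_def)
  define R where "R = max q (1 - (1 - r0) / (2 * (1 + c)))"
  have R: "q \<le> R" "R < 1" using tq c r0 by (auto simp: R_def)
  define e where "e = min (min (q - r0) (1 - R)) ((t - q) * (1 - R) / 4)"
  have e: "0 < e" using tq R by (simp add: e_def)
  show thesis
  proof (rule that[OF r R(2) e])
    fix z assume z: "z \<in> unit_disk" and zR: "R \<le> cmod z"
    show "bergman_disk z r \<subseteq> {w. r0 < cmod w}"
    proof
      fix w assume "w \<in> bergman_disk z r"
      then have "cmod (w - z) \<le> c * (1 - cmod z)"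
        using bergman_disk_euclidean_size[OF z r] tr by (simp add: c_def)
      moreover have "cmod z - cmod w \<le> cmod (w - z)" by (metis norm_minus_commute norm_triangle_ineq2)
      ultimately have "1 - cmod w \<le> (1 + c) * (1 - cmod z)" by (simp add: algebra_simps)
      also have "\<dots> \<le> (1 + c) * ((1 - r0) / (2 * (1 + c)))"
        using zR c by (intro mult_left_mono) (auto simp: R_def)
      also have "\<dots> = (1 - r0) / 2" using c by (simp add: field_simps)
      finally show "w \<in> {w. r0 < cmod w}" using r0 by simp
    qed
  next
    fix z assume z: "z \<in> unit_disk" and zR: "cmod z \<le> R"
    obtain u where u: "cmod u = 1" "z = of_real (cmod z) * u"
    proof (cases "z = 0")
      case True then show ?thesis using that[of 1] by simp
    next
      case False then show ?thesis using that[of "z / of_real (cmod z)"] by (simp add: norm_divide)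
    qed
    define x where "x = cmod z"
    define y where "y = max q x"
    define p where "p = of_real y * u"
    have x: "0 \<le> x" "x \<le> R" "x < 1" using zR R by (auto simp: x_def)
    have y: "q \<le> y" "x \<le> y" "y \<le> R" "0 < y" using x R tq by (auto simp: y_def)
    have cp: "cmod p = y" using u y by (simp add: p_def norm_mult)
    have uu: "cnj u * u = 1" using u(1) by (metis complex_norm_square mult.commute of_real_1 one_power2)
    have zp: "cnj z * p = of_real (x * y)"
    proof -
      have "cnj z = of_real x * cnj u" using u(2) by (metis complex_cnj_complex_of_real complex_cnj_mult x_def)
      then have "cnj z * p = of_real x * of_real y * (cnj u * u)" by (simp add: p_def mult_ac)
      then show ?thesis by (simp add: uu)
    qed
    have xy: "x * y \<le> R"
    proof -
      have "x * y \<le> x * 1" using x y R by (intro mult_left_mono) auto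
      then show ?thesis using x by simp
    qed
    have dp: "cmod (z - p) \<le> q * (1 - x * y)"
    proof -
      have "z - p = of_real (x - y) * u" using u(2) by (simp add: p_def x_def algebra_simps)
      then have "cmod (z - p) = y - x" using u(1) y by (simp add: norm_mult del: of_real_diff)
      also have "\<dots> \<le> q * (1 - x * y)"
      proof (cases "q \<le> x")
        case True then show ?thesis using xy R tq by (simp add: y_def)
      next
        case False
        then have "y = q" by (simp add: y_def)
        moreover have "q * (x * q) \<le> 1 * (x * 1)" using tq x by (intro mult_mono) auto
        ultimately show ?thesis by (simp add: algebra_simps)
      qed
      finally show ?thesis .
    qed
    have "ball p e \<subseteq> bergman_disk z r \<inter> {w. r0 < cmod w}"
    proof
      fix w assume "w \<in> ball p e"
      then have wp: "cmod (w - p) < e" by (simp add: dist_norm norm_minus_commute)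
      have "cmod p - cmod w \<le> cmod (w - p)" "cmod w - cmod p \<le> cmod (w - p)"
        by (metis norm_minus_commute norm_triangle_ineq2)+
      then have w: "r0 < cmod w" "cmod w < 1"
        using wp cp y by (auto simp: e_def)
      have "cmod (z - w) \<le> cmod (z - p) + cmod (w - p)"
        using norm_triangle_ineq4[of "z - p" "w - p"] by simp
      also have "\<dots> < q * (1 - x * y) + e" using dp wp by linarith
      also have "\<dots> \<le> t * ((1 - x * y) - e)"
      proof -
        have "(t - q) * (1 - R) \<le> (t - q) * (1 - x * y)" using xy tq by (intro mult_left_mono) auto
        moreover have "e \<le> (t - q) * (1 - R) / 4" unfolding e_def by (rule min.cobounded2)
        moreover have "t * e \<le> 1 * e" using tq e by (intro mult_right_mono) auto
        ultimately have "e + t * e \<le> (t - q) * (1 - x * y)" using e by linarith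
        then show ?thesis by (simp add: algebra_simps)
      qed
      also have "\<dots> \<le> t * cmod (1 - cnj z * w)"
      proof (rule mult_left_mono)
        have "1 - cnj z * w = of_real (1 - x * y) - cnj z * (w - p)" using zp by (simp add: algebra_simps)
        then have "\<bar>1 - x * y\<bar> - cmod z * cmod (w - p) \<le> cmod (1 - cnj z * w)"
          by (metis norm_triangle_ineq2 norm_of_real norm_mult complex_mod_cnj)
        moreover have "cmod z * cmod (w - p) \<le> 1 * e" using z wp by (intro mult_mono) auto
        ultimately show "1 - x * y - e \<le> cmod (1 - cnj z * w)" by linarith
      qed (use tq in simp)
      finally show "w \<in> bergman_disk z r \<inter> {w. r0 < cmod w}"
        using w by (simp add: bergman_disk_eq[OF z] tr)
    qed
    then show "\<exists>p. ball p e \<subseteq> bergman_disk z r \<inter> {w. r0 < cmod w}" by blast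
  qed
qed

lemma annulus_imp_area_bound:
  assumes \<alpha>: "-1 < \<alpha>" "\<alpha> < 0" and Om: "open \<Omega>" "\<Omega> \<subseteq> unit_disk"
    and r0: "0 < r0" "r0 < (1::real)" and ann: "unit_disk - closure (ball 0 r0) \<subseteq> \<Omega>"
  shows "\<exists>\<delta>>0. \<exists>r>0. \<forall>z\<in>unit_disk. emeasure (weighted_area \<alpha>) (\<Omega> \<inter> bergman_disk z r)
             \<ge> ennreal \<delta> * emeasure (weighted_area \<alpha>) (bergman_disk z r)"
proof -
  obtain r R e where r: "0 < r" and e: "0 < e"
    and far: "\<And>z. z \<in> unit_disk \<Longrightarrow> R \<le> cmod z \<Longrightarrow> bergman_disk z r \<subseteq> {w. r0 < cmod w}"
    and near: "\<And>z. z \<in> unit_disk \<Longrightarrow> cmod z \<le> R \<Longrightarrow> \<exists>p. ball p e \<subseteq> bergman_disk z r \<inter> {w. r0 < cmod w}"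
    using annulus_meets_bergman_disks[OF r0] by metis
  have A: "S \<subseteq> \<Omega>" if "S \<subseteq> unit_disk" "S \<subseteq> {w. r0 < cmod w}" for S
    using that ann r0 by force
  \<comment> \<open>The first entry serves disks inside the annulus; the second is a lower bound for the area of the small balls.\<close>
  define \<delta> where "\<delta> = min 1 ((1 + \<alpha>) * e\<^sup>2)"
  have "ennreal \<delta> * emeasure (weighted_area \<alpha>) (bergman_disk z r) \<le> emeasure (weighted_area \<alpha>) (\<Omega> \<inter> bergman_disk z r)"
    if z: "z \<in> unit_disk" for z
  proof (cases "R \<le> cmod z")
    case True
    then have "bergman_disk z r \<subseteq> \<Omega>"
      using A[OF bergman_disk_subset_unit_disk far[OF z True]] by blast
    then have "\<Omega> \<inter> bergman_disk z r = bergman_disk z r" by blast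
    moreover have "ennreal \<delta> * emeasure (weighted_area \<alpha>) (bergman_disk z r) \<le> 1 * emeasure (weighted_area \<alpha>) (bergman_disk z r)"
      by (intro mult_right_mono) (auto simp: \<delta>_def)
    ultimately show ?thesis by simp
  next
    case False
    then obtain p where p: "ball p e \<subseteq> bergman_disk z r \<inter> {w. r0 < cmod w}" using near[OF z] by auto
    then have pb: "ball p e \<subseteq> unit_disk" using bergman_disk_subset_unit_disk by blast
    then have pO: "ball p e \<subseteq> \<Omega> \<inter> bergman_disk z r" using A[of "ball p e"] p by blast
    have "ennreal \<delta> * emeasure (weighted_area \<alpha>) (bergman_disk z r) \<le> ennreal \<delta> * 1"
      by (intro mult_left_mono emeasure_weighted_area_le_1 \<alpha>) simp
    also have "\<dots> \<le> ennreal ((1 + \<alpha>) * e\<^sup>2)" by (simp add: \<delta>_def ennreal_leI)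
    also have "\<dots> \<le> emeasure (weighted_area \<alpha>) (ball p e)" by (rule emeasure_weighted_area_ball_ge[OF \<alpha> e pb])
    also have "\<dots> \<le> emeasure (weighted_area \<alpha>) (\<Omega> \<inter> bergman_disk z r)"
      by (rule emeasure_mono[OF pO]) (intro sets_weighted_area_open open_Int Om open_bergman_disk z, use Om in blast)
    finally show ?thesis .
  qed
  moreover have "0 < \<delta>" using \<alpha> e by (simp add: \<delta>_def)
  ultimately show ?thesis using r by blast
qed

lemma weighted_area_range_le_counting_measure:
  assumes \<alpha>: "-1 < \<alpha>" "\<alpha> < 0" and \<phi>: "\<phi> holomorphic_on unit_disk" "\<phi> ` unit_disk \<subseteq> unit_disk" "\<phi> 0 = 0"
    and nc: "\<not> \<phi> constant_on unit_disk" and S: "S \<in> sets disk_area" and Om: "\<phi> ` unit_disk \<inter> S \<in> sets disk_area"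
  shows "emeasure (weighted_area \<alpha>) (\<phi> ` unit_disk \<inter> S) \<le> ennreal (1 + \<alpha>) * emeasure (counting_measure \<phi> \<alpha>) S"
proof -
  have "emeasure (counting_measure \<phi> \<alpha>) S = (\<integral>\<^sup>+z. counting_fun \<phi> \<alpha> z * indicator S z \<partial>disk_area)"
    unfolding counting_measure_def
    by (rule emeasure_density[OF measurable_disk_area_borel[OF measurable_counting_fun[OF \<phi>(1) nc]] S])
  moreover have "(\<integral>\<^sup>+z. ennreal (disk_weight \<alpha> z) * indicator (\<phi> ` unit_disk \<inter> S) z \<partial>disk_area)
     \<le> (\<integral>\<^sup>+z. counting_fun \<phi> \<alpha> z * indicator S z \<partial>disk_area)"
    by (intro nn_integral_mono) (auto simp: indicator_def intro!: counting_fun_ge_weight[OF \<phi> nc \<alpha>(2)])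
  ultimately show ?thesis unfolding emeasure_weighted_area[OF \<alpha>(1) Om] by (simp add: mult_left_mono)
qed

text \<open>
  Bergman disks of a fixed radius shrink towards \<open>\<zeta>\<close> when their centres approach \<open>\<zeta>\<close>. If no points of the range
  are near \<open>\<zeta>\<close>, such a disk has measure \<open>0\<close>.
\<close>

lemma counting_measure_bound_imp_boundary:
  assumes \<alpha>: "-1 < \<alpha>" "\<alpha> < 0" and \<phi>: "\<phi> holomorphic_on unit_disk" and nc: "\<not> \<phi> constant_on unit_disk"
    and \<delta>: "0 < \<delta>" and r: "0 < r"
    and ii: "\<And>z. z \<in> unit_disk \<Longrightarrow> emeasure (counting_measure \<phi> \<alpha>) (bergman_disk z r)
             \<ge> ennreal \<delta> * emeasure (weighted_area \<alpha>) (bergman_disk z r)"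
  shows "sphere 0 1 \<subseteq> closure (\<phi> ` unit_disk)"
proof
  fix \<zeta> :: complex assume "\<zeta> \<in> sphere 0 1"
  then have \<zeta>: "cmod \<zeta> = 1" by simp
  show "\<zeta> \<in> closure (\<phi> ` unit_disk)"
  proof (rule ccontr)
    assume "\<zeta> \<notin> closure (\<phi> ` unit_disk)"
    then have "\<zeta> \<in> - closure (\<phi> ` unit_disk)" by simp
    then obtain e where "0 < e" "ball \<zeta> e \<subseteq> - closure (\<phi> ` unit_disk)"
      using openE[OF open_Compl[OF closed_closure]] by blast
    then have e: "0 < e" "ball \<zeta> e \<inter> closure (\<phi> ` unit_disk) = {}" by blast+
    define c where "c = 2 * tanh r / (1 - tanh r)"
    have c: "0 < c" using r tanh_real_lt_1[of r] by (simp add: c_def)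
    define s where "s = min (1/2) (e / (2 * (1 + c)))"
    have s: "0 < s" "s < 1" using e c by (auto simp: s_def)
    define z where "z = of_real (1 - s) * \<zeta>"
    have cz: "cmod z = 1 - s" using \<zeta> s by (simp add: z_def norm_mult del: of_real_diff)
    have z: "z \<in> unit_disk" using cz s by simp
    have "bergman_disk z r \<subseteq> ball \<zeta> e"
    proof
      fix w assume "w \<in> bergman_disk z r"
      then have "cmod (w - z) \<le> c * s" using bergman_disk_euclidean_size[OF z r] cz by (simp add: c_def)
      moreover have "\<zeta> - z = of_real s * \<zeta>" by (simp add: z_def algebra_simps)
      then have "cmod (\<zeta> - z) = s" using \<zeta> s by (simp add: norm_mult)
      moreover have "cmod (\<zeta> - w) \<le> cmod (\<zeta> - z) + cmod (w - z)"
        using norm_triangle_ineq4[of "\<zeta> - z" "w - z"] by simp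
      ultimately have "cmod (\<zeta> - w) \<le> (1 + c) * s" by (simp add: algebra_simps)
      also have "\<dots> \<le> (1 + c) * (e / (2 * (1 + c)))" using c by (intro mult_left_mono) (auto simp: s_def)
      also have "\<dots> = e / 2" using c by (simp add: field_simps)
      also have "\<dots> < e" using e by simp
      finally show "w \<in> ball \<zeta> e" by (simp add: dist_norm)
    qed
    then have "bergman_disk z r \<inter> \<phi> ` unit_disk = {}"
      using e(2) closure_subset[of "\<phi> ` unit_disk"] by (simp add: disjoint_iff subset_iff) metis
    then have N0: "counting_fun \<phi> \<alpha> w * indicator (bergman_disk z r) w = 0" for w
      using counting_fun_outside[of w \<phi> \<alpha>] by (auto simp: indicator_def)
    have "emeasure (counting_measure \<phi> \<alpha>) (bergman_disk z r) = (\<integral>\<^sup>+w. counting_fun \<phi> \<alpha> w * indicator (bergman_disk z r) w \<partial>disk_area)"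
      unfolding counting_measure_def
      by (intro emeasure_density measurable_disk_area_borel measurable_counting_fun \<phi> nc
          sets_disk_area_open open_bergman_disk z bergman_disk_subset_unit_disk)
    also have "\<dots> = 0" by (simp add: N0)
    finally have "ennreal \<delta> * emeasure (weighted_area \<alpha>) (bergman_disk z r) = 0" using ii[OF z] by simp
    then show False using emeasure_bergman_disk_pos[OF \<alpha> z r] \<delta> by simp
  qed
qed

section \<open>Reverse Carleson measures and closed range\<close>

text \<open>
  By the maximum principle the values on \<open>cmod z \<le> r0\<close> are bounded by those on the circle of radius
  \<open>(1 + r0) / 2\<close>, and these by area means over balls of radius \<open>(1 - r0) / 2\<close>, which stay in the annulus.
\<close>

lemma annulus_controls_bergman_integral:
  assumes \<alpha>: "-1 < \<alpha>" "\<alpha> < 0" and r0: "0 < r0" "r0 < (1::real)"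
  obtains C where "0 < C" and
    "\<And>g. g holomorphic_on unit_disk \<Longrightarrow> (\<integral>\<^sup>+z. ennreal ((cmod (g z))\<^sup>2) \<partial>weighted_area \<alpha>)
       \<le> ennreal C * (\<integral>\<^sup>+z. indicator {z. r0 < cmod z} z * ennreal ((cmod (g z))\<^sup>2) \<partial>weighted_area \<alpha>)"
proof -
  define s where "s = (1 - r0) / 2"
  define R where "R = (1 + r0) / 2"
  have s: "0 < s" and R: "r0 < R" "R < 1" "0 < R" using r0 by (auto simp: s_def R_def)
  define k where "k = 1 / ((1 + \<alpha>) * s\<^sup>2)"
  have k: "0 < k" using \<alpha> s by (simp add: k_def)
  let ?A = "{z :: complex. r0 < cmod z}"
  have bA: "?A \<in> sets borel" by (intro borel_open open_Collect_less continuous_intros)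
  show thesis
  proof (rule that[of "1 + k"])
    show "0 < 1 + k" using k by simp
    fix g assume g: "g holomorphic_on unit_disk"
    define G :: "complex \<Rightarrow> ennreal" where "G z = ennreal ((cmod (g z))\<^sup>2)" for z
    have G: "G \<in> borel_measurable disk_area" unfolding G_def by (rule measurable_cmod_sq_holomorphic[OF g])
    have iA: "(\<lambda>z. indicator ?A z) \<in> borel_measurable disk_area"
      by (intro measurable_disk_area_borel borel_measurable_indicator bA)
    have AG: "(\<lambda>z. indicator ?A z * G z) \<in> borel_measurable disk_area"
      by (rule borel_measurable_times_ennreal[OF iA G])
    have wt: "(\<lambda>z. ennreal (disk_weight \<alpha> z)) \<in> borel_measurable disk_area"
      by (intro measurable_disk_area_borel) measurable
    have wAG: "(\<lambda>z. ennreal (disk_weight \<alpha> z) * (indicator ?A z * G z)) \<in> borel_measurable disk_area"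
      by (rule borel_measurable_times_ennreal[OF wt AG])
    define I where "I = (\<integral>\<^sup>+z. indicator ?A z * G z \<partial>weighted_area \<alpha>)"
    have circ: "G z \<le> ennreal k * I" if z: "cmod z = R" for z
    proof -
      have B: "w \<in> unit_disk" "w \<in> ?A" if "w \<in> ball z s" for w
      proof -
        have d: "cmod (w - z) < s" using that by (simp add: dist_norm norm_minus_commute)
        have "cmod z - cmod w \<le> cmod (w - z)" "cmod w - cmod z \<le> cmod (w - z)"
          by (metis norm_minus_commute norm_triangle_ineq2)+
        then show "w \<in> unit_disk" "w \<in> ?A" using d z by (auto simp: s_def R_def field_simps)
      qed
      have "ennreal (pi * s\<^sup>2 * (cmod (g z))\<^sup>2) \<le> (\<integral>\<^sup>+w. indicator (ball z s) w * ennreal ((cmod (g w))\<^sup>2) \<partial>lborel)"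
        by (rule area_submean[OF _ s]) (use B(1) in \<open>auto intro: holomorphic_on_subset[OF g]\<close>)
      also have "\<dots> \<le> (\<integral>\<^sup>+w. indicator unit_disk w * (ennreal (disk_weight \<alpha> w) * (indicator ?A w * G w)) \<partial>lborel)"
      proof (rule nn_integral_mono)
        fix w
        show "indicator (ball z s) w * ennreal ((cmod (g w))\<^sup>2)
          \<le> indicator unit_disk w * (ennreal (disk_weight \<alpha> w) * (indicator ?A w * G w))"
        proof (cases "w \<in> ball z s")
          case True
          have "disk_weight \<alpha> 0 \<le> disk_weight \<alpha> w" using B(1)[OF True] \<alpha> by (intro disk_weight_antimono) auto
          then have "1 \<le> ennreal (disk_weight \<alpha> w)" by (simp add: disk_weight_def)
          then have "1 * G w \<le> ennreal (disk_weight \<alpha> w) * G w" by (rule mult_right_mono) simp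
          then show ?thesis using True B[OF True] by (simp add: G_def)
        qed simp
      qed
      also have "\<dots> = ennreal pi * (\<integral>\<^sup>+w. ennreal (disk_weight \<alpha> w) * (indicator ?A w * G w) \<partial>disk_area)"
        by (simp only: nn_integral_disk_area[OF wAG]) (simp add: mult.assoc[symmetric] ennreal_mult[symmetric])
      also have "(\<integral>\<^sup>+w. ennreal (disk_weight \<alpha> w) * (indicator ?A w * G w) \<partial>disk_area) = ennreal (1 / (1 + \<alpha>)) * I"
        using \<alpha> by (simp only: I_def nn_integral_weighted_area[OF AG \<alpha>(1)])
          (simp add: mult.assoc[symmetric] ennreal_mult[symmetric])
      finally have le: "ennreal (pi * s\<^sup>2 * (cmod (g z))\<^sup>2) \<le> ennreal pi * (ennreal (1 / (1 + \<alpha>)) * I)" .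
      have "G z = ennreal (1 / (pi * s\<^sup>2)) * ennreal (pi * s\<^sup>2 * (cmod (g z))\<^sup>2)"
        using s by (simp add: G_def ennreal_mult[symmetric])
      also have "\<dots> \<le> ennreal (1 / (pi * s\<^sup>2)) * (ennreal pi * (ennreal (1 / (1 + \<alpha>)) * I))"
        by (rule mult_left_mono[OF le]) simp
      also have "\<dots> = ennreal (1 / (pi * s\<^sup>2) * (pi * (1 / (1 + \<alpha>)))) * I"
        using \<alpha> by (simp add: mult.assoc[symmetric] ennreal_mult[symmetric])
      also have "1 / (pi * s\<^sup>2) * (pi * (1 / (1 + \<alpha>))) = k" by (simp add: k_def)
      finally show ?thesis .
    qed
    have inner: "G z \<le> ennreal k * I" if z: "cmod z \<le> r0" for z
    proof (cases "I = \<infinity>")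
      case True
      then show ?thesis using k by (simp add: ennreal_mult_top)
    next
      case False
      then obtain J where J: "I = ennreal J" "0 \<le> J" by (cases I) auto
      have "cmod (g z) \<le> sqrt (k * J)"
      proof (rule maximum_modulus_frontier[of g "cball 0 R"])
        show "g holomorphic_on interior (cball 0 R)" using R by (auto intro: holomorphic_on_subset[OF g])
        show "continuous_on (closure (cball 0 R)) g"
          using R by (intro holomorphic_on_imp_continuous_on holomorphic_on_subset[OF g]) auto
        fix u assume "u \<in> frontier (cball (0::complex) R)"
        then have "cmod u = R" by simp
        then have "ennreal ((cmod (g u))\<^sup>2) \<le> ennreal (k * J)"
          using circ[of u] k J by (simp add: G_def ennreal_mult)
        then have "(cmod (g u))\<^sup>2 \<le> k * J" using k J by simp
        then show "cmod (g u) \<le> sqrt (k * J)" by (rule real_le_rsqrt)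
      qed (use z R in auto)
      then have "(cmod (g z))\<^sup>2 \<le> k * J" using k J by (metis mult_nonneg_nonneg less_imp_le norm_ge_zero power_mono real_sqrt_pow2)
      then show ?thesis using k J by (simp add: G_def ennreal_mult[symmetric] ennreal_leI)
    qed
    have "(\<integral>\<^sup>+z. G z \<partial>weighted_area \<alpha>) \<le> (\<integral>\<^sup>+z. indicator ?A z * G z + ennreal k * I \<partial>weighted_area \<alpha>)"
    proof (rule nn_integral_mono)
      fix z
      show "G z \<le> indicator ?A z * G z + ennreal k * I"
      proof (cases "r0 < cmod z")
        case False
        then show ?thesis using inner[of z] by (simp add: indicator_def)
      qed simp
    qed
    also have "\<dots> = I + (\<integral>\<^sup>+z. ennreal k * I \<partial>weighted_area \<alpha>)"
      unfolding I_def by (rule nn_integral_add) (use AG in \<open>auto simp: measurable_weighted_area_iff\<close>)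
    also have "(\<integral>\<^sup>+z. ennreal k * I \<partial>weighted_area \<alpha>) = ennreal k * I"
      using emeasure_weighted_area_disk[OF \<alpha>(1)] by (simp add: space_weighted_area)
    also have "I + ennreal k * I = ennreal (1 + k) * I"
      using k by (simp add: ennreal_plus distrib_right)
    finally show "(\<integral>\<^sup>+z. ennreal ((cmod (g z))\<^sup>2) \<partial>weighted_area \<alpha>)
       \<le> ennreal (1 + k) * (\<integral>\<^sup>+z. indicator ?A z * ennreal ((cmod (g z))\<^sup>2) \<partial>weighted_area \<alpha>)"
      unfolding I_def G_def .
  qed
qed

lemma bergman_norm_sq_nn_integral:
  assumes "g \<in> bergman_space \<alpha>"
  shows "ennreal ((bergman_norm \<alpha> g)\<^sup>2) = (\<integral>\<^sup>+z. ennreal ((cmod (g z))\<^sup>2) \<partial>weighted_area \<alpha>)"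
proof -
  have "(bergman_norm \<alpha> g)\<^sup>2 = (\<integral>z. (cmod (g z))\<^sup>2 \<partial>weighted_area \<alpha>)"
    by (simp add: bergman_norm_def)
  then show ?thesis using assms by (subst nn_integral_eq_integral) (auto simp: bergman_space_def)
qed

lemma annulus_imp_reverse_carleson:
  assumes \<alpha>: "-1 < \<alpha>" "\<alpha> < 0" and \<phi>: "\<phi> holomorphic_on unit_disk" "\<phi> ` unit_disk \<subseteq> unit_disk" "\<phi> 0 = 0"
    and nc: "\<not> \<phi> constant_on unit_disk"
    and r0: "0 < r0" "r0 < (1::real)" and ann: "unit_disk - closure (ball 0 r0) \<subseteq> \<phi> ` unit_disk"
  shows "reverse_carleson \<alpha> (counting_measure \<phi> \<alpha>)"
  unfolding reverse_carleson_def
proof (intro conjI)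
  show "sets (counting_measure \<phi> \<alpha>) = sets (restrict_space borel unit_disk)"
    by (simp add: counting_measure_def sets_disk_area)
  obtain C where C: "0 < C" and
    le: "\<And>g. g holomorphic_on unit_disk \<Longrightarrow> (\<integral>\<^sup>+z. ennreal ((cmod (g z))\<^sup>2) \<partial>weighted_area \<alpha>)
       \<le> ennreal C * (\<integral>\<^sup>+z. indicator {z. r0 < cmod z} z * ennreal ((cmod (g z))\<^sup>2) \<partial>weighted_area \<alpha>)"
    by (rule annulus_controls_bergman_integral[OF \<alpha> r0]) (rule that)
  define c where "c = 1 / (C * (1 + \<alpha>))"
  have c: "0 < c" using C \<alpha> by (simp add: c_def)
  have "ennreal (c * (bergman_norm \<alpha> g)\<^sup>2) \<le> (\<integral>\<^sup>+z. ennreal ((cmod (g z))\<^sup>2) \<partial>counting_measure \<phi> \<alpha>)"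
    if gB: "g \<in> bergman_space \<alpha>" for g
  proof -
    have g: "g holomorphic_on unit_disk" using gB by (auto simp: bergman_space_def disk_analytic_def)
    define G :: "complex \<Rightarrow> ennreal" where "G z = ennreal ((cmod (g z))\<^sup>2)" for z
    have G: "G \<in> borel_measurable disk_area" unfolding G_def by (rule measurable_cmod_sq_holomorphic[OF g])
    have AG: "(\<lambda>z. indicator {z. r0 < cmod z} z * G z) \<in> borel_measurable disk_area"
      by (intro borel_measurable_times_ennreal G measurable_disk_area_borel borel_measurable_indicator borel_open
          open_Collect_less continuous_intros)
    have "ennreal ((bergman_norm \<alpha> g)\<^sup>2) \<le> ennreal C * (\<integral>\<^sup>+z. indicator {z. r0 < cmod z} z * G z \<partial>weighted_area \<alpha>)"
      using le[OF g] bergman_norm_sq_nn_integral[OF gB] by (simp add: G_def)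
    also have "\<dots> = ennreal C * (ennreal (1 + \<alpha>) * (\<integral>\<^sup>+z. ennreal (disk_weight \<alpha> z) * (indicator {z. r0 < cmod z} z * G z) \<partial>disk_area))"
      by (simp only: nn_integral_weighted_area[OF AG \<alpha>(1)])
    also have "\<dots> \<le> ennreal C * (ennreal (1 + \<alpha>) * (\<integral>\<^sup>+z. counting_fun \<phi> \<alpha> z * G z \<partial>disk_area))"
    proof (intro mult_left_mono nn_integral_mono)
      fix z assume "z \<in> space disk_area"
      then have z: "z \<in> unit_disk" by (simp add: space_disk_area)
      show "ennreal (disk_weight \<alpha> z) * (indicator {z. r0 < cmod z} z * G z) \<le> counting_fun \<phi> \<alpha> z * G z"
      proof (cases "r0 < cmod z")
        case True
        then have "z \<in> \<phi> ` unit_disk" using ann z r0 by auto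
        then show ?thesis using counting_fun_ge_weight[OF \<phi> nc \<alpha>(2)] True by (simp add: mult_right_mono)
      qed simp
    qed auto
    also have "(\<integral>\<^sup>+z. counting_fun \<phi> \<alpha> z * G z \<partial>disk_area) = (\<integral>\<^sup>+z. G z \<partial>counting_measure \<phi> \<alpha>)"
      unfolding counting_measure_def
      by (rule nn_integral_density[symmetric]) (intro measurable_disk_area_borel measurable_counting_fun \<phi> nc G)+
    finally have le2: "ennreal ((bergman_norm \<alpha> g)\<^sup>2) \<le> ennreal (C * (1 + \<alpha>)) * (\<integral>\<^sup>+z. G z \<partial>counting_measure \<phi> \<alpha>)"
      using C \<alpha> by (simp add: ennreal_mult mult.assoc)
    have "ennreal (c * (bergman_norm \<alpha> g)\<^sup>2) = ennreal c * ennreal ((bergman_norm \<alpha> g)\<^sup>2)"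
      using c by (simp add: ennreal_mult)
    also have "\<dots> \<le> ennreal c * (ennreal (C * (1 + \<alpha>)) * (\<integral>\<^sup>+z. G z \<partial>counting_measure \<phi> \<alpha>))"
      by (rule mult_left_mono[OF le2]) simp
    also have "\<dots> = (\<integral>\<^sup>+z. G z \<partial>counting_measure \<phi> \<alpha>)"
      using C \<alpha> by (simp add: mult.assoc[symmetric] ennreal_mult[symmetric] c_def)
    finally show ?thesis by (simp add: G_def)
  qed
  then show "\<exists>c>0. \<forall>g\<in>bergman_space \<alpha>. ennreal (c * (bergman_norm \<alpha> g)\<^sup>2) \<le> (\<integral>\<^sup>+z. ennreal ((cmod (g z))\<^sup>2) \<partial>counting_measure \<phi> \<alpha>)"
    using c by blast
qed

lemma comp_op_disk_analytic:
  assumes \<phi>: "\<phi> holomorphic_on unit_disk" "\<phi> ` unit_disk \<subseteq> unit_disk" and f: "f holomorphic_on unit_disk"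
  shows "comp_op \<phi> f \<in> disk_analytic"
    and "\<And>z. z \<in> unit_disk \<Longrightarrow> deriv (comp_op \<phi> f) z = deriv f (\<phi> z) * deriv \<phi> z"
proof -
  have der: "(comp_op \<phi> f has_field_derivative deriv f (\<phi> z) * deriv \<phi> z) (at z)" if z: "z \<in> unit_disk" for z
  proof (rule has_field_derivative_transform_within_open[OF _ open_ball z])
    have "\<phi> z \<in> unit_disk" using \<phi>(2) z by blast
    then have "(f has_field_derivative deriv f (\<phi> z)) (at (\<phi> z))" using holomorphic_derivI[OF f] by simp
    moreover have "(\<phi> has_field_derivative deriv \<phi> z) (at z)" using holomorphic_derivI[OF \<phi>(1) _ z] by simp
    ultimately show "((\<lambda>z. f (\<phi> z)) has_field_derivative deriv f (\<phi> z) * deriv \<phi> z) (at z)"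
      by (rule DERIV_chain2)
  qed (simp add: comp_op_def)
  then show "deriv (comp_op \<phi> f) z = deriv f (\<phi> z) * deriv \<phi> z" if "z \<in> unit_disk" for z
    using that DERIV_imp_deriv by blast
  have "comp_op \<phi> f holomorphic_on unit_disk"
    unfolding holomorphic_on_open[OF open_ball] using der by blast
  then show "comp_op \<phi> f \<in> disk_analytic" by (simp add: disk_analytic_def comp_op_def)
qed

text \<open>
  The reverse Carleson inequality for the derivative of \<open>f\<close>. By the change of variables its right side is the
  derivative part of the norm of \<open>f \<circ> \<phi>\<close>, up to a constant, and \<open>\<phi> 0 = 0\<close> matches the values at \<open>0\<close>.
\<close>

lemma reverse_carleson_bounded_below:
  assumes \<alpha>: "-1 < \<alpha>" "\<alpha> < 0" and \<phi>: "\<phi> holomorphic_on unit_disk" "\<phi> ` unit_disk \<subseteq> unit_disk" "\<phi> 0 = 0"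
    and nc: "\<not> \<phi> constant_on unit_disk"
    and rc: "reverse_carleson \<alpha> (counting_measure \<phi> \<alpha>)"
  obtains k where "0 < k" and "\<And>f. f \<in> dirichlet_space \<alpha> \<Longrightarrow> comp_op \<phi> f \<in> dirichlet_space \<alpha> \<Longrightarrow>
    k * dirichlet_norm \<alpha> f \<le> dirichlet_norm \<alpha> (comp_op \<phi> f)"
proof -
  obtain c where c: "0 < c" and le: "\<And>g. g \<in> bergman_space \<alpha> \<Longrightarrow>
       ennreal (c * (bergman_norm \<alpha> g)\<^sup>2) \<le> (\<integral>\<^sup>+z. ennreal ((cmod (g z))\<^sup>2) \<partial>counting_measure \<phi> \<alpha>)"
    using rc unfolding reverse_carleson_def by blast
  define m where "m = min 1 ((1 + \<alpha>) * c)"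
  have m: "0 < m" "m \<le> 1" "m \<le> (1 + \<alpha>) * c" using c \<alpha> by (auto simp: m_def)
  show thesis
  proof (rule that[of "sqrt m"])
    show "0 < sqrt m" using m by simp
    fix f assume f: "f \<in> dirichlet_space \<alpha>" and Cf: "comp_op \<phi> f \<in> dirichlet_space \<alpha>"
    have hol: "f holomorphic_on unit_disk" using f by (simp add: dirichlet_space_def disk_analytic_def)
    have dhol: "deriv f holomorphic_on unit_disk" by (rule holomorphic_deriv[OF hol]) simp
    \<comment> \<open>Elements of the Bergman space vanish off the disk; \<open>deriv f\<close> need not vanish on the circle.\<close>
    define g where "g z = (if z \<in> unit_disk then deriv f z else 0)" for z
    have gh: "g holomorphic_on unit_disk"
      by (rule holomorphic_transform[OF dhol]) (simp add: g_def)
    have gd: "(\<integral>z. (cmod (g z))\<^sup>2 \<partial>weighted_area \<alpha>) = (\<integral>z. (cmod (deriv f z))\<^sup>2 \<partial>weighted_area \<alpha>)"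
      by (intro Bochner_Integration.integral_cong) (auto simp: g_def space_weighted_area)
    have "integrable (weighted_area \<alpha>) (\<lambda>z. (cmod (g z))\<^sup>2) \<longleftrightarrow> integrable (weighted_area \<alpha>) (\<lambda>z. (cmod (deriv f z))\<^sup>2)"
      by (intro Bochner_Integration.integrable_cong) (auto simp: g_def space_weighted_area)
    then have gB: "g \<in> bergman_space \<alpha>"
      using f gh by (simp add: bergman_space_def dirichlet_space_def disk_analytic_def g_def)
    define If where "If = (\<integral>z. (cmod (deriv f z))\<^sup>2 \<partial>weighted_area \<alpha>)"
    define IC where "IC = (\<integral>z. (cmod (deriv (comp_op \<phi> f) z))\<^sup>2 \<partial>weighted_area \<alpha>)"
    have I0: "0 \<le> If" "0 \<le> IC" by (simp_all add: If_def IC_def)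
    define G :: "complex \<Rightarrow> ennreal" where "G z = ennreal ((cmod (g z))\<^sup>2)" for z
    have "g = (\<lambda>z. if z \<in> unit_disk then deriv f z else 0)" by (simp add: fun_eq_iff g_def)
    then have gm: "g \<in> borel_measurable borel"
      using dhol by (simp only:) (intro borel_measurable_continuous_on_if holomorphic_on_imp_continuous_on, auto)
    then have G: "G \<in> borel_measurable borel" unfolding G_def by measurable
    have Cm: "(\<lambda>z. ennreal ((cmod (deriv (comp_op \<phi> f) z))\<^sup>2)) \<in> borel_measurable disk_area"
      using comp_op_disk_analytic(1)[OF \<phi>(1,2) hol]
      by (intro measurable_cmod_sq_holomorphic holomorphic_deriv) (auto simp: disk_analytic_def)
    have "ennreal (c * If) \<le> (\<integral>\<^sup>+z. G z \<partial>counting_measure \<phi> \<alpha>)"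
      using le[OF gB] by (simp add: bergman_norm_def G_def gd If_def)
    also have "\<dots> = (\<integral>\<^sup>+z. ennreal (disk_weight \<alpha> z) * (ennreal ((cmod (deriv \<phi> z))\<^sup>2) * G (\<phi> z)) \<partial>disk_area)"
      by (rule nn_integral_counting_measure[OF \<phi>(1,2) nc G])
    also have "\<dots> = (\<integral>\<^sup>+z. ennreal (disk_weight \<alpha> z) * ennreal ((cmod (deriv (comp_op \<phi> f) z))\<^sup>2) \<partial>disk_area)"
    proof (rule nn_integral_cong)
      fix z assume "z \<in> space disk_area"
      then have z: "z \<in> unit_disk" by (simp add: space_disk_area)
      then have "\<phi> z \<in> unit_disk" using \<phi>(2) by blast
      then show "ennreal (disk_weight \<alpha> z) * (ennreal ((cmod (deriv \<phi> z))\<^sup>2) * G (\<phi> z))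
        = ennreal (disk_weight \<alpha> z) * ennreal ((cmod (deriv (comp_op \<phi> f) z))\<^sup>2)"
        by (simp add: comp_op_disk_analytic(2)[OF \<phi>(1,2) hol z] G_def g_def norm_mult power_mult_distrib ennreal_mult mult.commute)
    qed
    finally have "ennreal (1 + \<alpha>) * ennreal (c * If)
       \<le> ennreal (1 + \<alpha>) * (\<integral>\<^sup>+z. ennreal (disk_weight \<alpha> z) * ennreal ((cmod (deriv (comp_op \<phi> f) z))\<^sup>2) \<partial>disk_area)"
      by (rule mult_left_mono) simp
    also have "\<dots> = ennreal IC"
      unfolding IC_def nn_integral_deriv_dirichlet[OF Cf, symmetric]
      by (rule nn_integral_weighted_area[OF Cm \<alpha>(1), symmetric])
    finally have "ennreal (1 + \<alpha>) * ennreal (c * If) \<le> ennreal IC" .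
    then have "(1 + \<alpha>) * (c * If) \<le> IC"
      using \<alpha> c I0 by (simp add: ennreal_mult[symmetric])
    moreover have "m * If \<le> (1 + \<alpha>) * c * If" using m I0 by (intro mult_right_mono) auto
    moreover have "m * (cmod (f 0))\<^sup>2 \<le> 1 * (cmod (f 0))\<^sup>2" using m by (intro mult_right_mono) auto
    moreover have "comp_op \<phi> f 0 = f 0" using \<phi>(3) by (simp add: comp_op_def)
    ultimately have "m * (dirichlet_norm \<alpha> f)\<^sup>2 \<le> (dirichlet_norm \<alpha> (comp_op \<phi> f))\<^sup>2"
      unfolding dirichlet_norm_sq If_def[symmetric] IC_def[symmetric] by (simp add: distrib_left)
    then have "(sqrt m * dirichlet_norm \<alpha> f)\<^sup>2 \<le> (dirichlet_norm \<alpha> (comp_op \<phi> f))\<^sup>2"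
      using m by (simp add: power_mult_distrib)
    then show "sqrt m * dirichlet_norm \<alpha> f \<le> dirichlet_norm \<alpha> (comp_op \<phi> f)"
      by (rule power2_le_imp_le) (rule dirichlet_norm_nonneg)
  qed
qed

lemma zero_in_dirichlet_space: "(\<lambda>z. 0) \<in> dirichlet_space \<alpha>"
  by (simp add: dirichlet_space_def disk_analytic_def)

text \<open>
  Derivatives converge pointwise, and Fatou's lemma bounds the integral of the limit. The limit of
  a uniformly convergent bounded sequence thus stays in the space.
\<close>

lemma dirichlet_space_bounded_limit:
  assumes f: "\<And>n. f n \<in> dirichlet_space \<alpha>" and bd: "\<And>n. dirichlet_norm \<alpha> (f n) \<le> M"
    and lim: "uniform_limit unit_disk f F sequentially" and F0: "\<And>z. z \<notin> unit_disk \<Longrightarrow> F z = 0"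
  shows "F \<in> dirichlet_space \<alpha>"
proof -
  have hol: "f n holomorphic_on unit_disk" for n using f by (simp add: dirichlet_space_def disk_analytic_def)
  have F: "F holomorphic_on unit_disk"
  proof (rule holomorphic_uniform_sequence[OF open_ball hol])
    fix x :: complex assume "x \<in> unit_disk"
    then obtain d where "0 < d" "cball x d \<subseteq> unit_disk" using open_contains_cball[of unit_disk] open_ball by blast
    then show "\<exists>d>0. cball x d \<subseteq> unit_disk \<and> uniform_limit (cball x d) f F sequentially"
      using uniform_limit_on_subset[OF lim] by blast
  qed
  have an: "F \<in> disk_analytic" using F F0 by (simp add: disk_analytic_def)
  have dl: "(\<lambda>n. deriv (f n) z) \<longlonglongrightarrow> deriv F z" if "z \<in> unit_disk" for z
    using higher_deriv_complex_uniform_limit[OF lim always_eventually[OF allI[OF hol]] _ open_ball that, of 1] by simp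
  have "(\<integral>\<^sup>+z. ennreal ((cmod (deriv F z))\<^sup>2) \<partial>weighted_area \<alpha>)
     = (\<integral>\<^sup>+z. liminf (\<lambda>n. ennreal ((cmod (deriv (f n) z))\<^sup>2)) \<partial>weighted_area \<alpha>)"
  proof (rule nn_integral_cong)
    fix z assume "z \<in> space (weighted_area \<alpha>)"
    then have z: "z \<in> unit_disk" by (simp add: space_weighted_area)
    have "(\<lambda>n. ennreal ((cmod (deriv (f n) z))\<^sup>2)) \<longlonglongrightarrow> ennreal ((cmod (deriv F z))\<^sup>2)"
      by (intro tendsto_intros dl z)
    then show "ennreal ((cmod (deriv F z))\<^sup>2) = liminf (\<lambda>n. ennreal ((cmod (deriv (f n) z))\<^sup>2))"
      by (rule lim_imp_Liminf[OF trivial_limit_sequentially, symmetric])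
  qed
  also have "\<dots> \<le> liminf (\<lambda>n. \<integral>\<^sup>+z. ennreal ((cmod (deriv (f n) z))\<^sup>2) \<partial>weighted_area \<alpha>)"
  proof (rule nn_integral_liminf)
    fix n
    show "(\<lambda>z. ennreal ((cmod (deriv (f n) z))\<^sup>2)) \<in> borel_measurable (weighted_area \<alpha>)"
      using measurable_deriv[of "f n" \<alpha>] f[of n] by (simp add: dirichlet_space_def)
  qed
  also have "\<dots> \<le> ennreal (M\<^sup>2)"
  proof (rule Liminf_le)
    show "eventually (\<lambda>n. (\<integral>\<^sup>+z. ennreal ((cmod (deriv (f n) z))\<^sup>2) \<partial>weighted_area \<alpha>) \<le> ennreal (M\<^sup>2)) sequentially"
    proof (intro always_eventually allI)
      fix n
      have "(dirichlet_norm \<alpha> (f n))\<^sup>2 \<le> M\<^sup>2" using bd dirichlet_norm_nonneg by (intro power_mono) auto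
      then show "(\<integral>\<^sup>+z. ennreal ((cmod (deriv (f n) z))\<^sup>2) \<partial>weighted_area \<alpha>) \<le> ennreal (M\<^sup>2)"
        using nn_integral_deriv_le_norm[OF f[of n]] by (meson ennreal_leI order_trans)
    qed
  qed simp
  finally show ?thesis by (rule dirichlet_spaceI[OF an])
qed

text \<open>
  If \<open>f n \<circ> \<phi>\<close> converges to \<open>l\<close>, then \<open>f n\<close> is a Cauchy sequence in norm, hence uniformly on the disk. Its limit
  \<open>F\<close> is in the space, and \<open>F \<circ> \<phi> = l\<close> holds pointwise.
\<close>

lemma bounded_below_imp_closed_range:
  assumes \<alpha>: "-1 < \<alpha>" "\<alpha> < 0" and \<phi>: "\<phi> ` unit_disk \<subseteq> unit_disk"
    and bdd: "bounded_comp_op \<alpha> \<phi>"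
    and k: "0 < k" and below: "\<And>f. f \<in> dirichlet_space \<alpha> \<Longrightarrow> k * dirichlet_norm \<alpha> f \<le> dirichlet_norm \<alpha> (comp_op \<phi> f)"
  shows "closed_range_comp_op \<alpha> \<phi>"
proof -
  interpret M: Metric_space "dirichlet_space \<alpha>" "dirichlet_dist \<alpha>" by (rule Metric_space_dirichlet[OF \<alpha>(1)])
  have CD: "comp_op \<phi> f \<in> dirichlet_space \<alpha>" if "f \<in> dirichlet_space \<alpha>" for f
    using bdd that unfolding bounded_comp_op_def by blast
  obtain B where B: "0 < B" "\<And>f z. f \<in> dirichlet_space \<alpha> \<Longrightarrow> z \<in> unit_disk \<Longrightarrow> cmod (f z) \<le> B * dirichlet_norm \<alpha> f"
    by (rule dirichlet_sup_bound[OF \<alpha>]) (rule that)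
  show ?thesis
    unfolding closed_range_comp_op_def M.metric_closedin_iff_sequentially_closed
  proof (intro conjI allI impI)
    show "comp_op \<phi> ` dirichlet_space \<alpha> \<subseteq> dirichlet_space \<alpha>" using CD by blast
    fix \<sigma> :: "nat \<Rightarrow> complex \<Rightarrow> complex" and l
    assume "range \<sigma> \<subseteq> comp_op \<phi> ` dirichlet_space \<alpha> \<and> limitin M.mtopology \<sigma> l sequentially"
    then have ran: "\<And>n. \<sigma> n \<in> comp_op \<phi> ` dirichlet_space \<alpha>" and lim: "limitin M.mtopology \<sigma> l sequentially" by auto
    have "\<forall>n. \<exists>f\<in>dirichlet_space \<alpha>. \<sigma> n = comp_op \<phi> f" using ran by blast
    then obtain f where f: "\<And>n. f n \<in> dirichlet_space \<alpha>" "\<And>n. \<sigma> n = comp_op \<phi> (f n)" by metis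
    have l: "l \<in> dirichlet_space \<alpha>" and
      conv: "\<And>\<epsilon>. 0 < \<epsilon> \<Longrightarrow> \<exists>N. \<forall>n\<ge>N. dirichlet_dist \<alpha> (\<sigma> n) l < \<epsilon>"
      using lim unfolding M.limit_metric_sequentially by blast+
    have \<sigma>D: "\<sigma> n \<in> dirichlet_space \<alpha>" for n using f CD by simp
    have diff: "k * dirichlet_norm \<alpha> (\<lambda>z. f m z - f n z) \<le> dirichlet_dist \<alpha> (\<sigma> m) (\<sigma> n)" for m n
    proof -
      have "comp_op \<phi> (\<lambda>z. f m z - f n z) = (\<lambda>z. \<sigma> m z - \<sigma> n z)" by (auto simp: f(2) comp_op_def)
      then show ?thesis
        using below[OF dirichlet_space_diff[OF f(1) f(1)], of m n] by (simp add: dirichlet_dist_def)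
    qed
    have cau: "uniformly_Cauchy_on unit_disk f"
    proof (rule uniformly_Cauchy_onI)
      fix e :: real assume e: "0 < e"
      then obtain N where N: "\<And>n. n \<ge> N \<Longrightarrow> dirichlet_dist \<alpha> (\<sigma> n) l < k * e / (2 * B)"
        using conv[of "k * e / (2 * B)"] k B by auto
      have "dist (f m z) (f n z) < e" if z: "z \<in> unit_disk" and mn: "m \<ge> N" "n \<ge> N" for z m n
      proof -
        have "k * cmod (f m z - f n z) \<le> k * (B * dirichlet_norm \<alpha> (\<lambda>z. f m z - f n z))"
          using k B(2)[OF dirichlet_space_diff[OF f(1) f(1)] z, of m n] by (intro mult_left_mono) auto
        also have "\<dots> = B * (k * dirichlet_norm \<alpha> (\<lambda>z. f m z - f n z))" by simp
        also have "\<dots> \<le> B * dirichlet_dist \<alpha> (\<sigma> m) (\<sigma> n)" using diff B by (intro mult_left_mono) auto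
        also have "\<dots> \<le> B * (dirichlet_dist \<alpha> (\<sigma> m) l + dirichlet_dist \<alpha> (\<sigma> n) l)"
          using M.triangle''[OF \<sigma>D[of m] l \<sigma>D[of n]] M.commute B M.triangle[OF \<sigma>D[of m] l \<sigma>D[of n]]
          by (intro mult_left_mono) auto
        also have "\<dots> < B * (k * e / (2 * B) + k * e / (2 * B))"
          using N[OF mn(1)] N[OF mn(2)] B by (intro mult_strict_left_mono add_strict_mono) auto
        also have "\<dots> = k * e" using B by simp
        finally show ?thesis using k by (simp add: dist_norm)
      qed
      then show "\<exists>N. \<forall>z\<in>unit_disk. \<forall>m\<ge>N. \<forall>n\<ge>N. dist (f m z) (f n z) < e" by blast
    qed
    then obtain F1 where F1: "uniform_limit unit_disk f F1 sequentially"
      using Cauchy_uniformly_convergent uniformly_convergent_on_def by blast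
    define F where "F z = (if z \<in> unit_disk then F1 z else 0)" for z
    have F: "uniform_limit unit_disk f F sequentially"
      by (rule uniform_limit_cong'[THEN iffD1, OF _ _ F1]) (auto simp: F_def)
    obtain N where N: "\<And>n. n \<ge> N \<Longrightarrow> dirichlet_dist \<alpha> (\<sigma> n) l < 1" using conv[of 1] by auto
    have "F \<in> dirichlet_space \<alpha>"
    proof (rule dirichlet_space_bounded_limit)
      show "f (n + N) \<in> dirichlet_space \<alpha>" for n by (rule f(1))
      show "uniform_limit unit_disk (\<lambda>n. f (n + N)) F sequentially"
        unfolding uniform_limit_sequentially_iff
      proof (intro allI impI)
        fix e :: real assume "0 < e"
        then obtain K where "\<forall>n\<ge>K. \<forall>x\<in>unit_disk. dist (f n x) (F x) < e"
          using F unfolding uniform_limit_sequentially_iff by blast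
        then show "\<exists>K. \<forall>n\<ge>K. \<forall>x\<in>unit_disk. dist (f (n + N) x) (F x) < e"
          by (intro exI[of _ K]) auto
      qed
      show "F z = 0" if "z \<notin> unit_disk" for z using that by (simp add: F_def)
      fix n
      have "k * dirichlet_norm \<alpha> (f (n + N)) \<le> dirichlet_norm \<alpha> (\<sigma> (n + N))"
        using below[OF f(1)] f(2) by simp
      also have "dirichlet_norm \<alpha> (\<sigma> (n + N)) = dirichlet_norm \<alpha> (\<lambda>z. (\<sigma> (n + N) z - l z) - (0 - l z))" by simp
      also have "\<dots> \<le> dirichlet_dist \<alpha> (\<sigma> (n + N)) l + dirichlet_dist \<alpha> (\<lambda>z. 0) l"
        unfolding dirichlet_dist_def
        by (intro dirichlet_norm_diff_le \<alpha> dirichlet_space_diff \<sigma>D l zero_in_dirichlet_space)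
      also have "dirichlet_dist \<alpha> (\<lambda>z. 0) l = dirichlet_norm \<alpha> l"
        by (subst dirichlet_dist_commute) (simp add: dirichlet_dist_def)
      also have "dirichlet_dist \<alpha> (\<sigma> (n + N)) l + dirichlet_norm \<alpha> l \<le> 1 + dirichlet_norm \<alpha> l"
        using N[of "n + N"] by simp
      finally show "dirichlet_norm \<alpha> (f (n + N)) \<le> (1 + dirichlet_norm \<alpha> l) / k"
        using k by (simp add: pos_le_divide_eq mult.commute)
    qed
    moreover have "comp_op \<phi> F = l"
    proof
      fix z
      show "comp_op \<phi> F z = l z"
      proof (cases "z \<in> unit_disk")
        case True
        then have \<phi>z: "\<phi> z \<in> unit_disk" using \<phi> by blast
        have "(\<lambda>n. f n (\<phi> z)) \<longlonglongrightarrow> F (\<phi> z)" by (rule tendsto_uniform_limitI[OF F \<phi>z])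
        then have "(\<lambda>n. \<sigma> n z) \<longlonglongrightarrow> comp_op \<phi> F z" using True by (simp add: f(2) comp_op_def)
        moreover have "(\<lambda>n. \<sigma> n z) \<longlonglongrightarrow> l z"
        proof (rule LIMSEQ_I)
          fix e :: real assume e: "0 < e"
          then obtain N where N: "\<And>n. n \<ge> N \<Longrightarrow> dirichlet_dist \<alpha> (\<sigma> n) l < e / B"
            using conv[of "e / B"] B by auto
          have "norm (\<sigma> n z - l z) < e" if "n \<ge> N" for n
          proof -
            have "cmod (\<sigma> n z - l z) \<le> B * dirichlet_dist \<alpha> (\<sigma> n) l"
              using B(2)[OF dirichlet_space_diff[OF \<sigma>D l] True] by (simp add: dirichlet_dist_def)
            also have "\<dots> < B * (e / B)" using N[OF that] B by (intro mult_strict_left_mono) auto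
            finally show ?thesis using B by simp
          qed
          then show "\<exists>N. \<forall>n\<ge>N. norm (\<sigma> n z - l z) < e" by blast
        qed
        ultimately show ?thesis by (rule LIMSEQ_unique)
      next
        case False
        then show ?thesis using l by (simp add: comp_op_def dirichlet_space_def disk_analytic_def)
      qed
    qed
    ultimately show "l \<in> comp_op \<phi> ` dirichlet_space \<alpha>" by blast
  qed
qed

section \<open>Closed range forces boundary contact\<close>

lemma nn_integral_weighted_area_bounded:
  assumes \<alpha>: "-1 < \<alpha>" and le: "\<And>z. z \<in> unit_disk \<Longrightarrow> F z \<le> ennreal c"
  shows "(\<integral>\<^sup>+z. F z \<partial>weighted_area \<alpha>) \<le> ennreal c"
proof -
  have "(\<integral>\<^sup>+z. F z \<partial>weighted_area \<alpha>) \<le> (\<integral>\<^sup>+z. ennreal c \<partial>weighted_area \<alpha>)"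
    using le by (intro nn_integral_mono) (auto simp: space_weighted_area)
  also have "\<dots> = ennreal c"
    using emeasure_weighted_area_disk[OF \<alpha>] by (simp add: space_weighted_area)
  finally show ?thesis .
qed

definition identity_on_disk :: "complex \<Rightarrow> complex" where
  "identity_on_disk u = (if u \<in> unit_disk then u else 0)"

lemma identity_in_dirichlet:
  assumes "-1 < \<alpha>"
  shows "identity_on_disk \<in> dirichlet_space \<alpha>"
proof -
  have der: "(identity_on_disk has_field_derivative 1) (at u)" if u: "u \<in> unit_disk" for u
    by (rule has_field_derivative_transform_within_open[OF DERIV_ident open_ball u]) (simp add: identity_on_disk_def)
  then have "identity_on_disk holomorphic_on unit_disk"
    unfolding holomorphic_on_open[OF open_ball] by blast
  then have an: "identity_on_disk \<in> disk_analytic" by (simp add: disk_analytic_def identity_on_disk_def)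
  have "(\<integral>\<^sup>+z. ennreal ((cmod (deriv identity_on_disk z))\<^sup>2) \<partial>weighted_area \<alpha>) \<le> ennreal 1"
    by (rule nn_integral_weighted_area_bounded[OF assms]) (simp add: DERIV_imp_deriv[OF der])
  then show ?thesis by (rule dirichlet_spaceI[OF an])
qed

definition cauchy_kernel :: "complex \<Rightarrow> complex \<Rightarrow> complex" where
  "cauchy_kernel b u = (if u \<in> unit_disk then 1 / (b - u) else 0)"

lemma cauchy_kernel_deriv:
  assumes b: "1 \<le> cmod b" and u: "u \<in> unit_disk"
  shows "b - u \<noteq> 0" and "(cauchy_kernel b has_field_derivative 1 / (b - u)\<^sup>2) (at u)"
proof -
  show nz: "b - u \<noteq> 0" using b u by auto
  show "(cauchy_kernel b has_field_derivative 1 / (b - u)\<^sup>2) (at u)"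
  proof (rule has_field_derivative_transform_within_open[OF _ open_ball u])
    show "((\<lambda>u. 1 / (b - u)) has_field_derivative 1 / (b - u)\<^sup>2) (at u)"
      using nz by (auto intro!: derivative_eq_intros simp: power2_eq_square)
  qed (simp add: cauchy_kernel_def)
qed

lemma cauchy_kernel_holomorphic:
  assumes "1 \<le> cmod b" shows "cauchy_kernel b holomorphic_on unit_disk"
  unfolding holomorphic_on_open[OF open_ball] using cauchy_kernel_deriv(2)[OF assms] by blast

lemma cauchy_kernel_in_dirichlet:
  assumes \<alpha>: "-1 < \<alpha>" and b: "1 < cmod b"
  shows "cauchy_kernel b \<in> dirichlet_space \<alpha>"
proof -
  have b1: "1 \<le> cmod b" using b by simp
  have an: "cauchy_kernel b \<in> disk_analytic"
    using cauchy_kernel_holomorphic[OF b1] by (simp add: disk_analytic_def cauchy_kernel_def)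
  have "(\<integral>\<^sup>+z. ennreal ((cmod (deriv (cauchy_kernel b) z))\<^sup>2) \<partial>weighted_area \<alpha>) \<le> ennreal ((1 / (cmod b - 1)\<^sup>2)\<^sup>2)"
  proof (intro nn_integral_weighted_area_bounded[OF \<alpha>] ennreal_leI power_mono)
    fix z assume z: "z \<in> unit_disk"
    have "cmod b - 1 \<le> cmod (b - z)" using norm_triangle_ineq2[of b z] z by simp
    then have "(cmod b - 1)\<^sup>2 \<le> (cmod (b - z))\<^sup>2" using b by (intro power_mono) auto
    moreover have "0 < (cmod b - 1)\<^sup>2" using b by simp
    ultimately show "cmod (deriv (cauchy_kernel b) z) \<le> 1 / (cmod b - 1)\<^sup>2"
      unfolding DERIV_imp_deriv[OF cauchy_kernel_deriv(2)[OF b1 z]]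
      by (simp add: norm_divide norm_power frac_le)
  qed simp
  then show ?thesis by (rule dirichlet_spaceI[OF an])
qed

text \<open>
  The hypothesis on the real part says that moving from \<open>a\<close> in the direction \<open>\<zeta>\<close> does not decrease the modulus.
  Both denominators are therefore at least \<open>e\<^sup>2\<close> in modulus, and the difference is linear in \<open>t\<close>.
\<close>

lemma inverse_square_difference_bound:
  fixes a :: complex and \<zeta> :: complex and t e :: real
  assumes t: "0 \<le> t" and e: "0 < e" "e \<le> cmod a" and re: "0 \<le> Re (a * cnj \<zeta>)" and \<zeta>: "cmod \<zeta> = 1"
  shows "cmod (1 / (a + of_real t * \<zeta>)\<^sup>2 - 1 / a\<^sup>2) \<le> 2 * t / e ^ 3"
proof -
  define b where "b = a + of_real t * \<zeta>"
  have ab: "(cmod b)\<^sup>2 = (cmod a)\<^sup>2 + 2 * t * Re (a * cnj \<zeta>) + t\<^sup>2"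
  proof -
    have "(cmod b)\<^sup>2 = (cmod a)\<^sup>2 + 2 * t * Re (a * cnj \<zeta>) + t\<^sup>2 * (cmod \<zeta>)\<^sup>2"
      unfolding b_def cmod_power2 by (simp add: power2_eq_square algebra_simps)
    then show ?thesis using \<zeta> by simp
  qed
  have "(cmod a)\<^sup>2 \<le> (cmod b)\<^sup>2" using ab t re by simp
  then have b: "cmod a \<le> cmod b" by (rule power2_le_imp_le) simp
  have p: "0 < cmod a" "0 < cmod b" "e \<le> cmod b" using e b by auto
  have nz: "a \<noteq> 0" "b \<noteq> 0" using p by auto
  have "1 / b\<^sup>2 - 1 / a\<^sup>2 = - (of_real t * \<zeta>) * (1 / (a * b\<^sup>2) + 1 / (a\<^sup>2 * b))"
  proof -
    have "1 / b\<^sup>2 - 1 / a\<^sup>2 = (a - b) * (1 / (a * b\<^sup>2) + 1 / (a\<^sup>2 * b))"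
      using nz by (simp add: field_simps power2_eq_square)
    then show ?thesis by (simp add: b_def)
  qed
  then have "cmod (1 / b\<^sup>2 - 1 / a\<^sup>2) = t * cmod (1 / (a * b\<^sup>2) + 1 / (a\<^sup>2 * b))"
    using t \<zeta> by (simp add: norm_mult)
  also have "\<dots> \<le> t * (cmod (1 / (a * b\<^sup>2)) + cmod (1 / (a\<^sup>2 * b)))"
    by (rule mult_left_mono[OF norm_triangle_ineq t])
  also have "\<dots> \<le> t * (1 / (e * e\<^sup>2) + 1 / (e\<^sup>2 * e))"
    unfolding norm_divide norm_mult norm_power norm_one using e p
    by (intro mult_left_mono t add_mono frac_le mult_mono power_mono mult_pos_pos) auto
  also have "\<dots> = 2 * t / e ^ 3" by (simp add: power2_eq_square power3_eq_cube mult_ac)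
  finally show ?thesis by (simp add: b_def)
qed

text \<open>
  If \<open>\<Omega>\<close> stays away from \<open>\<zeta>\<close>, the kernels \<open>1 / (b - u)\<close> with \<open>b = (1 + t) * \<zeta>\<close> lie in the space for \<open>t > 0\<close>, and
  their compositions with \<open>\<phi>\<close> converge in norm, as \<open>t\<close> tends to \<open>0\<close>, to \<open>1 / (\<zeta> - \<phi> z)\<close>. A function \<open>F\<close> of the
  space with the same composition would agree with \<open>1 / (\<zeta> - u)\<close> on the open set \<open>\<Omega>\<close>, hence on the disk, and
  would be unbounded.
\<close>

lemma closed_range_imp_boundary:
  assumes \<alpha>: "-1 < \<alpha>" "\<alpha> < 0" and \<phi>: "\<phi> holomorphic_on unit_disk" "\<phi> ` unit_disk \<subseteq> unit_disk" "\<phi> 0 = 0"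
    and nc: "\<not> \<phi> constant_on unit_disk" and bdd: "bounded_comp_op \<alpha> \<phi>"
    and clo: "closed_range_comp_op \<alpha> \<phi>"
  shows "sphere 0 1 \<subseteq> closure (\<phi> ` unit_disk)"
proof
  interpret M: Metric_space "dirichlet_space \<alpha>" "dirichlet_dist \<alpha>" by (rule Metric_space_dirichlet[OF \<alpha>(1)])
  fix \<zeta> :: complex assume "\<zeta> \<in> sphere 0 1"
  then have \<zeta>: "cmod \<zeta> = 1" by simp
  have CD: "comp_op \<phi> f \<in> dirichlet_space \<alpha>" if "f \<in> dirichlet_space \<alpha>" for f
    using bdd that unfolding bounded_comp_op_def by blast
  show "\<zeta> \<in> closure (\<phi> ` unit_disk)"
  proof (rule ccontr)
    assume "\<zeta> \<notin> closure (\<phi> ` unit_disk)"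
    then have "\<zeta> \<in> - closure (\<phi> ` unit_disk)" by simp
    then obtain e where e: "0 < e" "ball \<zeta> e \<subseteq> - closure (\<phi> ` unit_disk)"
      using openE[OF open_Compl[OF closed_closure]] by blast
    have far: "e \<le> cmod (\<zeta> - \<phi> z)" if "z \<in> unit_disk" for z
    proof (rule ccontr)
      assume "\<not> e \<le> cmod (\<zeta> - \<phi> z)"
      then have "\<phi> z \<in> ball \<zeta> e" by (simp add: dist_norm)
      then show False using e(2) closure_subset[of "\<phi> ` unit_disk"] that by blast
    qed
    \<comment> \<open>Boundedness of the operator puts \<open>\<phi>\<close> itself into the Dirichlet space.\<close>
    define \<iota> where "\<iota> = comp_op \<phi> identity_on_disk"
    have \<iota>D: "\<iota> \<in> dirichlet_space \<alpha>" unfolding \<iota>_def by (rule CD[OF identity_in_dirichlet[OF \<alpha>(1)]])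
    have d\<iota>: "deriv \<iota> z = deriv \<phi> z" if z: "z \<in> unit_disk" for z
    proof -
      have "(\<iota> has_field_derivative deriv \<phi> z) (at z)"
      proof (rule has_field_derivative_transform_within_open[OF _ open_ball z])
        show "(\<phi> has_field_derivative deriv \<phi> z) (at z)" using holomorphic_derivI[OF \<phi>(1) _ z] by simp
        show "\<phi> w = \<iota> w" if "w \<in> unit_disk" for w
        proof -
          have "\<phi> w \<in> unit_disk" using \<phi>(2) that by blast
          then show ?thesis using that by (simp add: \<iota>_def comp_op_def identity_on_disk_def)
        qed
      qed
      then show ?thesis by (rule DERIV_imp_deriv)
    qed
    \<comment> \<open>All integrands below are dominated by multiples of \<open>(cmod (deriv \<phi> z))\<^sup>2\<close>, whose integral is at most \<open>N\<close>.\<close>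
    define N where "N = (dirichlet_norm \<alpha> \<iota>)\<^sup>2"
    have intN: "(\<integral>\<^sup>+z. ennreal ((c * cmod (deriv \<phi> z))\<^sup>2) \<partial>weighted_area \<alpha>) \<le> ennreal (c\<^sup>2 * N)" for c
    proof -
      have "(\<integral>\<^sup>+z. ennreal ((c * cmod (deriv \<phi> z))\<^sup>2) \<partial>weighted_area \<alpha>)
         = (\<integral>\<^sup>+z. ennreal (c\<^sup>2) * ennreal ((cmod (deriv \<iota> z))\<^sup>2) \<partial>weighted_area \<alpha>)"
        by (intro nn_integral_cong) (simp add: d\<iota> space_weighted_area power_mult_distrib ennreal_mult)
      also have "\<dots> = ennreal (c\<^sup>2) * (\<integral>\<^sup>+z. ennreal ((cmod (deriv \<iota> z))\<^sup>2) \<partial>weighted_area \<alpha>)"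
        by (rule nn_integral_cmult) (use measurable_deriv[of \<iota> \<alpha>] \<iota>D in \<open>auto simp: dirichlet_space_def\<close>)
      also have "\<dots> \<le> ennreal (c\<^sup>2) * ennreal N"
        unfolding N_def by (rule mult_left_mono[OF nn_integral_deriv_le_norm[OF \<iota>D]]) simp
      finally show ?thesis by (simp add: ennreal_mult N_def)
    qed
    have hk: "cauchy_kernel \<zeta> holomorphic_on unit_disk" by (rule cauchy_kernel_holomorphic) (simp add: \<zeta>)
    define l where "l = comp_op \<phi> (cauchy_kernel \<zeta>)"
    have lan: "l \<in> disk_analytic" unfolding l_def by (rule comp_op_disk_analytic(1)[OF \<phi>(1,2) hk])
    have dl: "deriv l z = 1 / (\<zeta> - \<phi> z)\<^sup>2 * deriv \<phi> z" if z: "z \<in> unit_disk" for z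
    proof -
      have "\<phi> z \<in> unit_disk" using \<phi>(2) z by blast
      then have "deriv (cauchy_kernel \<zeta>) (\<phi> z) = 1 / (\<zeta> - \<phi> z)\<^sup>2"
        by (intro DERIV_imp_deriv cauchy_kernel_deriv(2)) (simp_all add: \<zeta>)
      then show ?thesis using comp_op_disk_analytic(2)[OF \<phi>(1,2) hk z] by (simp add: l_def)
    qed
    have lD: "l \<in> dirichlet_space \<alpha>"
    proof (rule dirichlet_spaceI[OF lan])
      have "(\<integral>\<^sup>+z. ennreal ((cmod (deriv l z))\<^sup>2) \<partial>weighted_area \<alpha>)
         \<le> (\<integral>\<^sup>+z. ennreal ((1 / e\<^sup>2 * cmod (deriv \<phi> z))\<^sup>2) \<partial>weighted_area \<alpha>)"
      proof (intro nn_integral_mono ennreal_leI power_mono)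
        fix z assume "z \<in> space (weighted_area \<alpha>)"
        then have z: "z \<in> unit_disk" by (simp add: space_weighted_area)
        have "1 / (cmod (\<zeta> - \<phi> z))\<^sup>2 \<le> 1 / e\<^sup>2" using far[OF z] e by (intro frac_le power_mono) auto
        then show "cmod (deriv l z) \<le> 1 / e\<^sup>2 * cmod (deriv \<phi> z)"
          unfolding dl[OF z] norm_mult norm_divide norm_power norm_one by (rule mult_right_mono) simp
      qed simp
      also have "\<dots> \<le> ennreal ((1 / e\<^sup>2)\<^sup>2 * N)" by (rule intN)
      finally show "(\<integral>\<^sup>+z. ennreal ((cmod (deriv l z))\<^sup>2) \<partial>weighted_area \<alpha>) \<le> ennreal ((1 / e\<^sup>2)\<^sup>2 * N)" .
    qed
    define t where "t n = inverse (real (Suc n))" for n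
    have t: "0 < t n" for n by (simp add: t_def)
    define b where "b n = of_real (1 + t n) * \<zeta>" for n
    have cb: "cmod (b n) = 1 + t n" for n using \<zeta> t[of n] by (simp add: b_def norm_mult del: of_real_add)
    have b1: "1 < cmod (b n)" "1 \<le> cmod (b n)" for n using cb[of n] t[of n] by auto
    define \<sigma> where "\<sigma> n = comp_op \<phi> (cauchy_kernel (b n))" for n
    have KD: "cauchy_kernel (b n) \<in> dirichlet_space \<alpha>" for n by (rule cauchy_kernel_in_dirichlet[OF \<alpha>(1) b1(1)])
    have \<sigma>D: "\<sigma> n \<in> dirichlet_space \<alpha>" for n unfolding \<sigma>_def by (rule CD[OF KD])
    have dist: "(dirichlet_dist \<alpha> (\<sigma> n) l)\<^sup>2 \<le> (t n)\<^sup>2 * (1 + (2 / e ^ 3)\<^sup>2 * N)" for n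
    proof -
      have an: "\<sigma> n \<in> disk_analytic" using \<sigma>D by (simp add: dirichlet_space_def)
      have ds: "deriv (\<sigma> n) z = 1 / (b n - \<phi> z)\<^sup>2 * deriv \<phi> z" if z: "z \<in> unit_disk" for z
      proof -
        have "\<phi> z \<in> unit_disk" using \<phi>(2) z by blast
        then have "deriv (cauchy_kernel (b n)) (\<phi> z) = 1 / (b n - \<phi> z)\<^sup>2"
          by (intro DERIV_imp_deriv cauchy_kernel_deriv(2) b1)
        then show ?thesis
          using comp_op_disk_analytic(2)[OF \<phi>(1,2) cauchy_kernel_holomorphic[OF b1(2)[of n]] z] by (simp add: \<sigma>_def)
      qed
      have "(\<integral>\<^sup>+z. ennreal ((cmod (deriv (\<lambda>z. \<sigma> n z - l z) z))\<^sup>2) \<partial>weighted_area \<alpha>)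
         \<le> (\<integral>\<^sup>+z. ennreal ((2 * t n / e ^ 3 * cmod (deriv \<phi> z))\<^sup>2) \<partial>weighted_area \<alpha>)"
      proof (intro nn_integral_mono ennreal_leI power_mono)
        fix z assume "z \<in> space (weighted_area \<alpha>)"
        then have z: "z \<in> unit_disk" by (simp add: space_weighted_area)
        then have \<phi>z: "cmod (\<phi> z) < 1" using \<phi>(2) by force
        have "deriv (\<lambda>z. \<sigma> n z - l z) z = (1 / (b n - \<phi> z)\<^sup>2 - 1 / (\<zeta> - \<phi> z)\<^sup>2) * deriv \<phi> z"
          unfolding deriv_disk_diff[OF an lan z] ds[OF z] dl[OF z] by (simp only: left_diff_distrib)
        moreover have "b n - \<phi> z = (\<zeta> - \<phi> z) + of_real (t n) * \<zeta>" by (simp add: b_def algebra_simps)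
        moreover have "cmod (1 / ((\<zeta> - \<phi> z) + of_real (t n) * \<zeta>)\<^sup>2 - 1 / (\<zeta> - \<phi> z)\<^sup>2) \<le> 2 * t n / e ^ 3"
        proof (rule inverse_square_difference_bound[OF _ e(1) far[OF z] _ \<zeta>])
          have "Re (\<phi> z * cnj \<zeta>) \<le> cmod (\<phi> z * cnj \<zeta>)" by (rule complex_Re_le_cmod)
          also have "\<dots> \<le> 1" using \<phi>z \<zeta> by (simp add: norm_mult)
          finally show "0 \<le> Re ((\<zeta> - \<phi> z) * cnj \<zeta>)"
            using \<zeta> by (simp add: left_diff_distrib complex_norm_square[symmetric] del: complex_cnj_cnj)
        qed (use t[of n] in simp)
        ultimately show "cmod (deriv (\<lambda>z. \<sigma> n z - l z) z) \<le> 2 * t n / e ^ 3 * cmod (deriv \<phi> z)"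
          by (simp only: norm_mult) (rule mult_right_mono, simp_all)
      qed simp
      also have "\<dots> \<le> ennreal ((2 * t n / e ^ 3)\<^sup>2 * N)" by (rule intN)
      finally have le: "(\<integral>\<^sup>+z. ennreal ((cmod (deriv (\<lambda>z. \<sigma> n z - l z) z))\<^sup>2) \<partial>weighted_area \<alpha>) \<le> ennreal ((2 * t n / e ^ 3)\<^sup>2 * N)" .
      have "cmod (\<sigma> n 0 - l 0) \<le> t n"
      proof -
        have z0: "\<zeta> \<noteq> 0" using \<zeta> by auto
        have "\<sigma> n 0 - l 0 = 1 / b n - 1 / \<zeta>" using \<phi>(3) by (simp add: \<sigma>_def l_def comp_op_def cauchy_kernel_def)
        also have "\<dots> = (\<zeta> - b n) / (b n * \<zeta>)"
          using z0 b1(1)[of n] by (subst diff_frac_eq) auto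
        also have "\<zeta> - b n = - of_real (t n) * \<zeta>" by (simp add: b_def algebra_simps)
        finally have "cmod (\<sigma> n 0 - l 0) = t n / (1 + t n)"
          using cb[of n] t[of n] \<zeta> z0 by (simp add: norm_divide norm_mult)
        also have "\<dots> \<le> t n / 1" using t[of n] by (intro divide_left_mono) auto
        finally show ?thesis by simp
      qed
      then have "(cmod (\<sigma> n 0 - l 0))\<^sup>2 \<le> (t n)\<^sup>2" by (intro power_mono) auto
      moreover have "(dirichlet_norm \<alpha> (\<lambda>z. \<sigma> n z - l z))\<^sup>2 \<le> (cmod (\<sigma> n 0 - l 0))\<^sup>2 + (2 * t n / e ^ 3)\<^sup>2 * N"
        by (rule dirichlet_norm_sq_le[OF disk_analytic_diff[OF an lan] le]) (simp add: N_def)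
      moreover have "(2 * t n / e ^ 3)\<^sup>2 * N = (t n)\<^sup>2 * ((2 / e ^ 3)\<^sup>2 * N)"
        by (simp add: power_mult_distrib power_divide)
      ultimately show ?thesis by (simp add: dirichlet_dist_def distrib_left)
    qed
    have "(\<lambda>n. dirichlet_dist \<alpha> (\<sigma> n) l) \<longlonglongrightarrow> 0"
    proof -
      have "t \<longlonglongrightarrow> 0" unfolding t_def by (rule LIMSEQ_inverse_real_of_nat)
      then have "(\<lambda>n. (t n)\<^sup>2 * (1 + (2 / e ^ 3)\<^sup>2 * N)) \<longlonglongrightarrow> 0\<^sup>2 * (1 + (2 / e ^ 3)\<^sup>2 * N)"
        by (intro tendsto_intros)
      then have "(\<lambda>n. (t n)\<^sup>2 * (1 + (2 / e ^ 3)\<^sup>2 * N)) \<longlonglongrightarrow> 0" by simp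
      from tendsto_sandwich[OF always_eventually[OF allI[OF zero_le_power2]]
          always_eventually[OF allI[OF dist]] tendsto_const this]
      have "(\<lambda>n. (dirichlet_dist \<alpha> (\<sigma> n) l)\<^sup>2) \<longlonglongrightarrow> 0" .
      then have "(\<lambda>n. sqrt ((dirichlet_dist \<alpha> (\<sigma> n) l)\<^sup>2)) \<longlonglongrightarrow> sqrt 0" by (rule tendsto_real_sqrt)
      then show ?thesis by (simp add: dirichlet_dist_def dirichlet_norm_nonneg)
    qed
    then have "limitin M.mtopology \<sigma> l sequentially"
      unfolding M.limit_metric_sequentially using lD \<sigma>D
      by (auto simp: LIMSEQ_def dirichlet_dist_def dirichlet_norm_nonneg)
    moreover have "range \<sigma> \<subseteq> comp_op \<phi> ` dirichlet_space \<alpha>" using KD by (auto simp: \<sigma>_def)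
    ultimately have "l \<in> comp_op \<phi> ` dirichlet_space \<alpha>"
      using clo unfolding closed_range_comp_op_def M.metric_closedin_iff_sequentially_closed by blast
    then obtain F where F: "F \<in> dirichlet_space \<alpha>" "l = comp_op \<phi> F" by blast
    have Fh: "F holomorphic_on unit_disk" using F(1) by (simp add: dirichlet_space_def disk_analytic_def)
    have oO: "open (\<phi> ` unit_disk)"
      by (rule open_mapping_thm[OF \<phi>(1) _ _ open_ball subset_refl nc]) auto
    have eqO: "F w = cauchy_kernel \<zeta> w" if w: "w \<in> \<phi> ` unit_disk" for w
    proof -
      obtain z where z: "z \<in> unit_disk" "w = \<phi> z" using w by blast
      have "comp_op \<phi> F z = comp_op \<phi> (cauchy_kernel \<zeta>) z" using F(2) by (simp add: l_def)
      then show ?thesis using z by (simp add: comp_op_def)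
    qed
    have eqD: "F u = cauchy_kernel \<zeta> u" if "u \<in> unit_disk" for u
      by (rule analytic_continuation_open[OF oO open_ball _ _ \<phi>(2) Fh hk eqO that]) auto
    obtain B where B: "0 < B" "\<And>f z. f \<in> dirichlet_space \<alpha> \<Longrightarrow> z \<in> unit_disk \<Longrightarrow> cmod (f z) \<le> B * dirichlet_norm \<alpha> f"
      by (rule dirichlet_sup_bound[OF \<alpha>]) (rule that)
    define m where "m = max 1 (B * dirichlet_norm \<alpha> F)"
    define s where "s = 1 / (2 * m)"
    have s: "0 < s" "s < 1" by (auto simp: s_def m_def)
    define u where "u = of_real (1 - s) * \<zeta>"
    have cu: "cmod u = 1 - s" using \<zeta> s by (simp add: u_def norm_mult del: of_real_diff)
    have uD: "u \<in> unit_disk" using cu s by simp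
    have "\<zeta> - u = of_real s * \<zeta>" by (simp add: u_def algebra_simps)
    then have "cmod (\<zeta> - u) = s" using \<zeta> s by (simp add: norm_mult)
    then have "cmod (F u) = 2 * m" using eqD[OF uD] uD s by (simp add: cauchy_kernel_def norm_divide s_def)
    then have "2 * m \<le> B * dirichlet_norm \<alpha> F" using B(2)[OF F(1) uD] by simp
    moreover have "1 \<le> m" "B * dirichlet_norm \<alpha> F \<le> m" by (simp_all add: m_def)
    ultimately show False by linarith
  qed
qed

section \<open>The equivalences\<close>

theorem theorem2p14:
  fixes \<alpha> :: real and \<phi> :: "complex \<Rightarrow> complex"
  assumes "-1 < \<alpha>" and "\<alpha> < 0"
    and "\<phi> holomorphic_on unit_disk"
    and "\<phi> ` unit_disk \<subseteq> unit_disk"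
    and "\<not> \<phi> constant_on unit_disk"
    and "\<phi> 0 = 0"
    and "bounded_comp_op \<alpha> \<phi>"
    and "compact_hole_condition (\<phi> ` unit_disk)"
  defines "cond_i \<equiv> closed_range_comp_op \<alpha> \<phi>"
    and "cond_ii \<equiv> \<exists>\<delta>>0. \<exists>r>0. \<forall>z\<in>unit_disk.
           emeasure (counting_measure \<phi> \<alpha>) (bergman_disk z r)
             \<ge> ennreal \<delta> * emeasure (weighted_area \<alpha>) (bergman_disk z r)"
    and "cond_iii \<equiv> \<exists>\<delta>>0. \<exists>r>0. \<forall>z\<in>unit_disk.
           emeasure (weighted_area \<alpha>) (\<phi> ` unit_disk \<inter> bergman_disk z r)
             \<ge> ennreal \<delta> * emeasure (weighted_area \<alpha>) (bergman_disk z r)"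
    and "cond_iv \<equiv> \<exists>r0::real. 0 < r0 \<and> r0 < 1 \<and> unit_disk - closure (ball 0 r0) \<subseteq> \<phi> ` unit_disk"
    and "cond_v \<equiv> reverse_carleson \<alpha> (counting_measure \<phi> \<alpha>)"
  shows "(cond_i \<longleftrightarrow> cond_ii) \<and> (cond_i \<longleftrightarrow> cond_iii) \<and> (cond_i \<longleftrightarrow> cond_iv) \<and> (cond_i \<longleftrightarrow> cond_v) \<and>
         (cond_i \<longleftrightarrow> sphere 0 1 \<subseteq> closure (\<phi> ` unit_disk)) \<and>
         (simply_connected (\<phi> ` unit_disk) \<longrightarrow> (cond_i \<longleftrightarrow> \<phi> ` unit_disk = unit_disk))"
proof -
  note \<alpha> = assms(1,2) and \<phi> = assms(3,4,6) and nc = assms(5) and bdd = assms(7) and hole = assms(8)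
  let ?\<Omega> = "\<phi> ` unit_disk"
  let ?bdry = "sphere 0 1 \<subseteq> closure ?\<Omega>"
  have open_range: "open ?\<Omega>"
    by (rule open_mapping_thm[OF \<phi>(1) _ _ open_ball subset_refl nc]) auto
  have i_bdry: "?bdry" if cond_i
    using closed_range_imp_boundary[OF \<alpha> \<phi> nc bdd] that unfolding cond_i_def by blast
  have bdry_iv: cond_iv if ?bdry
    unfolding cond_iv_def by (rule annulus_subset_of_boundary[OF \<alpha> \<phi> bdd hole that])
  have iv_v: cond_v if cond_iv
    using that annulus_imp_reverse_carleson[OF \<alpha> \<phi> nc] unfolding cond_iv_def cond_v_def by blast
  have v_i: cond_i if cond_v
  proof -
    have CD: "comp_op \<phi> f \<in> dirichlet_space \<alpha>" if "f \<in> dirichlet_space \<alpha>" for f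
      using bdd that unfolding bounded_comp_op_def by blast
    obtain k where k: "0 < k" and below: "\<And>f. f \<in> dirichlet_space \<alpha> \<Longrightarrow> comp_op \<phi> f \<in> dirichlet_space \<alpha> \<Longrightarrow>
        k * dirichlet_norm \<alpha> f \<le> dirichlet_norm \<alpha> (comp_op \<phi> f)"
      by (rule reverse_carleson_bounded_below[OF \<alpha> \<phi> nc \<open>cond_v\<close>[unfolded cond_v_def]]) (rule that)
    show cond_i
      unfolding cond_i_def by (rule bounded_below_imp_closed_range[OF \<alpha> \<phi>(2) bdd k below[OF _ CD]])
  qed
  have iv_iii: cond_iii if cond_iv
    using that annulus_imp_area_bound[OF \<alpha> open_range \<phi>(2)] unfolding cond_iv_def cond_iii_def by blast
  have iii_ii: cond_ii if iii: cond_iii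
  proof -
    obtain \<delta> r where \<delta>: "0 < \<delta>" and r: "0 < r" and ge: "\<And>z. z \<in> unit_disk \<Longrightarrow>
        ennreal \<delta> * emeasure (weighted_area \<alpha>) (bergman_disk z r) \<le> emeasure (weighted_area \<alpha>) (?\<Omega> \<inter> bergman_disk z r)"
      using iii unfolding cond_iii_def by blast
    have "ennreal (\<delta> / (1 + \<alpha>)) * emeasure (weighted_area \<alpha>) (bergman_disk z r) \<le> emeasure (counting_measure \<phi> \<alpha>) (bergman_disk z r)"
      if z: "z \<in> unit_disk" for z
    proof -
      have le: "ennreal \<delta> * emeasure (weighted_area \<alpha>) (bergman_disk z r) \<le> ennreal (1 + \<alpha>) * emeasure (counting_measure \<phi> \<alpha>) (bergman_disk z r)"
        by (rule order_trans[OF ge[OF z] weighted_area_range_le_counting_measure[OF \<alpha> \<phi> nc]];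
            intro sets_disk_area_open open_Int open_range open_bergman_disk z bergman_disk_subset_unit_disk)
          (use \<phi>(2) in blast)
      have "ennreal (\<delta> / (1 + \<alpha>)) * emeasure (weighted_area \<alpha>) (bergman_disk z r)
         = ennreal (1 / (1 + \<alpha>)) * (ennreal \<delta> * emeasure (weighted_area \<alpha>) (bergman_disk z r))"
        using \<alpha> \<delta> by (simp add: mult.assoc[symmetric] ennreal_mult[symmetric])
      also have "\<dots> \<le> ennreal (1 / (1 + \<alpha>)) * (ennreal (1 + \<alpha>) * emeasure (counting_measure \<phi> \<alpha>) (bergman_disk z r))"
        by (rule mult_left_mono[OF le]) simp
      also have "\<dots> = emeasure (counting_measure \<phi> \<alpha>) (bergman_disk z r)"
        using \<alpha> by (simp add: mult.assoc[symmetric] ennreal_mult[symmetric])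
      finally show ?thesis .
    qed
    moreover have "0 < \<delta> / (1 + \<alpha>)" using \<delta> \<alpha> by simp
    ultimately show cond_ii unfolding cond_ii_def using r by blast
  qed
  have ii_bdry: ?bdry if cond_ii
    using that counting_measure_bound_imp_boundary[OF \<alpha> \<phi>(1) nc] unfolding cond_ii_def by blast
  have sc: "cond_i \<longleftrightarrow> ?\<Omega> = unit_disk" if s: "simply_connected ?\<Omega>"
  proof
    assume cond_i
    show "?\<Omega> = unit_disk"
      by (rule simply_connected_hull_full[OF \<alpha> \<phi> bdd open_range s \<phi>(2) subset_refl i_bdry[OF \<open>cond_i\<close>]])
  next
    assume "?\<Omega> = unit_disk"
    then have cond_iv unfolding cond_iv_def by (intro exI[of _ "1/2"]) auto
    then show cond_i by (intro v_i iv_v)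
  qed
  show ?thesis
    using i_bdry bdry_iv iv_v v_i iv_iii iii_ii ii_bdry sc by blast
qed

end
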